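(* Let $\beta>0$ and let $A^0,B^0:\mathbb N_0^2\to\mathbb R$ be given by $$A^0_{(n_1,n_2)}=\frac{(\beta)_{n_1}(\beta)_{n_2}(1-2\beta)_{|n_1-n_2|}}{(1)_{n_1}(1)_{n_2}(2\beta)_{|n_1-n_2|}},\qquad B^0_{(n_1,n_2)}=-\frac{(\beta)_{n_1+1}(\beta)_{n_2+1}(1-2\beta)_{|n_1-n_2|}}{(1)_{n_1}(1)_{n_2}(2\beta)_{|n_1-n_2|}}.$$ Both $\sum_{n\in\mathbb N_0^2}A^0_nr^n$ and $\sum_{n\in\mathbb N_0^2}B^0_nr^n$ converge locally uniformly in $(-1,1)^2$. Let $F_0$ and $G_0$ denote the respective sums. Then they are analytic and symmetric and satisfy, for $\{j,k\}=\{1,2\}$, $$r_j(1-r_j)\partial_j^2F_0+(2\beta-2r_j)\partial_jF_0-\beta(1-\beta)F_0=(1-r_k)G_0,$$ and $$\beta r_1\partial_1F_0+\beta r_2\partial_2F_0+\beta^2F_0=-(1-r_1r_2)G_0.$$ Moreover, $F_0>0$ on $(-1,1)^2$ and $F_0$ is given by the Horn function $$F_0(r_1,r_2)=G_2^{\mathrm{Horn}}(\beta,\beta;1-2\beta,1-2\beta;-r_1,-r_2).$$ In addition: (i) Suppose $\beta>1/3$. Then for any $n_1\in\mathbb N_0$, $A^\Sigma_{n_1}:=\sum_{n_2=0}^\infty A^0_{(n_1,n_2)}$ converges absolutely, and $$A^\Sigma_{n_1}=\frac{\Gamma(2\beta)\Gamma(3\beta-1)}{\Gamma(\beta)\Gamma(4\beta-1)}\cdot\frac{(\beta)_{n_1}(1-\beta)_{n_1}}{(1)_{n_1}(2\beta)_{n_1}}.$$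 Moreover, for any $L\in(0,1)$, $$\sum_{n_1=0}^\infty\sum_{n_2=0}^\infty|A^0_{(n_1,n_2)}|L^{n_2}=\sum_{n_1=0}^\infty\sum_{n_2=0}^\infty|A^0_{(n_1,n_2)}|L^{n_1}<\infty.$$ In this case, $F_0$ (the sum of the series) is continuous and positive on $[0,1]^2\setminus\{(1,1)\}$ with $$F_0(x,1)=F_0(1,x)=\frac{\Gamma(2\beta)\Gamma(3\beta-1)}{\Gamma(\beta)\Gamma(4\beta-1)}\cdot f_\beta(x),\quad x\in[0,1).$$ (ii) If $\beta>1/2$, then $F_0$ extends continuously to a positive function on $[0,1]^2$ with $$F_0(1,1)=\frac{\Gamma(2\beta)^2\Gamma(2\beta-1)}{\Gamma(\beta)^2\Gamma(4\beta-1)}.$$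
   Context: $\mathbb N_0=\{0,1,2,\dots\}$, $r^n=r_1^{n_1}r_2^{n_2}$, $\partial_j=\partial_{r_j}$, $(q)_m=q(q+1)\cdots(q+m-1)$, $(q)_0=1$ (Pochhammer symbol), and for negative index $(q)_{-m}:=(q-1)^{-1}(q-2)^{-1}\cdots(q-m)^{-1}$ for $m\in\{1,2,\dots\}$, $q\notin\{1,\dots,m\}$. $f_\beta(x)={}_2F_1(1-\beta,\beta;2\beta;x)$. The Horn function is $G_2^{\mathrm{Horn}}(a,a';b,b';x,y)=\sum_{m,n\ge0}(a)_m(a')_n(b)_{n-m}(b')_{m-n}\frac{x^my^n}{m!\,n!}$ for $|x|,|y|<1$. *)

theory Defs
  imports "HOL-Analysis.Analysis"
begin

text \<open>
  For \<open>m \<ge> 1\<close>, the symbol \<open>(q)\<^sub>-\<^sub>m\<close> is \<open>(q-1)\<^sup>-\<^sup>1 \<cdots> (q-m)\<^sup>-\<^sup>1\<close>. This is meaningful only for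
  \<open>q \<notin> {1,\<dots>,m}\<close> (HOL's \<open>inverse 0 = 0\<close> gives it a junk value otherwise); for \<open>q = 1 - 2 * \<beta>\<close>
  with \<open>\<beta> > 0\<close>, the restriction is met for every \<open>m\<close>.
\<close>

definition poch_int :: "real \<Rightarrow> int \<Rightarrow> real" where
  "poch_int q k =
     (if 0 \<le> k then pochhammer q (nat k) else (\<Prod>i=1..nat (- k). inverse (q - real i)))"

definition horn_G2 :: "real \<Rightarrow> real \<Rightarrow> real \<Rightarrow> real \<Rightarrow> real \<Rightarrow> real \<Rightarrow> real" where
  "horn_G2 a a' b b' x y =
     (\<Sum>\<^sub>\<infinity>(m, n)\<in>UNIV. pochhammer a m * pochhammer a' n *
        poch_int b (int n - int m) * poch_int b' (int m - int n) * (x ^ m * y ^ n) / (fact m * fact n))"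

text \<open>\<open>\<^sub>2F\<^sub>1(1-\<beta>, \<beta>; 2\<beta>; x)\<close>\<close>

definition f_hyp :: "real \<Rightarrow> real \<Rightarrow> real" where
  "f_hyp \<beta> x = eval_fps (fps_hypergeo [1 - \<beta>, \<beta>] [2 * \<beta>] 1) x"


text \<open>
  A double series is summed over \<open>\<nat> \<times> \<nat>\<close> unconditionally, i.e. as the limit of the sums over
  finite index sets ordered by inclusion. For real terms this is absolute convergence.
\<close>

definition term2 :: "(nat \<Rightarrow> nat \<Rightarrow> real) \<Rightarrow> real \<times> real \<Rightarrow> nat \<times> nat \<Rightarrow> real" where
  "term2 c r n = c (fst n) (snd n) * (fst r ^ fst n * snd r ^ snd n)"

definition series2 :: "(nat \<Rightarrow> nat \<Rightarrow> real) \<Rightarrow> real \<times> real \<Rightarrow> real" where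
  "series2 c r = (\<Sum>\<^sub>\<infinity>n\<in>UNIV. term2 c r n)"

definition series2_conv_loc_unif_on :: "(nat \<Rightarrow> nat \<Rightarrow> real) \<Rightarrow> (real \<times> real) set \<Rightarrow> bool" where
  "series2_conv_loc_unif_on c S \<longleftrightarrow>
     (\<forall>r\<in>S. \<exists>U. open U \<and> r \<in> U \<and>
        uniform_limit (U \<inter> S) (\<lambda>N s. \<Sum>n\<in>N. term2 c s n) (series2 c)
          (finite_subsets_at_top UNIV))"

definition real_analytic2_on :: "(real \<times> real \<Rightarrow> real) \<Rightarrow> (real \<times> real) set \<Rightarrow> bool" where
  "real_analytic2_on F S \<longleftrightarrow>
     (\<forall>p\<in>S. \<exists>c. \<exists>e>0. \<forall>r. \<bar>fst r - fst p\<bar> < e \<and> \<bar>snd r - snd p\<bar> < e \<longrightarrow>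
        (term2 c (r - p) has_sum F r) UNIV)"

definition partial1 :: "(real \<times> real \<Rightarrow> real) \<Rightarrow> real \<times> real \<Rightarrow> real" where
  "partial1 F r = deriv (\<lambda>t. F (t, snd r)) (fst r)"

definition partial2 :: "(real \<times> real \<Rightarrow> real) \<Rightarrow> real \<times> real \<Rightarrow> real" where
  "partial2 F r = deriv (\<lambda>t. F (fst r, t)) (snd r)"


definition absdiff :: "nat \<Rightarrow> nat \<Rightarrow> nat" where
  "absdiff m n = nat \<bar>int m - int n\<bar>"

definition A0 :: "real \<Rightarrow> nat \<Rightarrow> nat \<Rightarrow> real" where
  "A0 \<beta> n1 n2 =
     (pochhammer \<beta> n1 * pochhammer \<beta> n2 * pochhammer (1 - 2 * \<beta>) (absdiff n1 n2)) /
     (pochhammer 1 n1 * pochhammer 1 n2 * pochhammer (2 * \<beta>) (absdiff n1 n2))"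

definition B0 :: "real \<Rightarrow> nat \<Rightarrow> nat \<Rightarrow> real" where
  "B0 \<beta> n1 n2 =
     - ((pochhammer \<beta> (n1 + 1) * pochhammer \<beta> (n2 + 1) * pochhammer (1 - 2 * \<beta>) (absdiff n1 n2)) /
        (pochhammer 1 n1 * pochhammer 1 n2 * pochhammer (2 * \<beta>) (absdiff n1 n2)))"

definition F0 :: "real \<Rightarrow> real \<times> real \<Rightarrow> real" where
  "F0 \<beta> = series2 (A0 \<beta>)"

definition G0 :: "real \<Rightarrow> real \<times> real \<Rightarrow> real" where
  "G0 \<beta> = series2 (B0 \<beta>)"

abbreviation open_square :: "(real \<times> real) set" where
  "open_square \<equiv> {-1<..<1} \<times> {-1<..<1}"

abbreviation unit_square :: "(real \<times> real) set" where
  "unit_square \<equiv> {0..1} \<times> {0..1}"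

end

theory Submission
  imports Defs
begin

text \<open>
  With \<open>t, s\<close> independent and \<open>Beta(\<beta>, \<beta>)\<close>-distributed on \<open>[0, 1]\<close>, Vandermonde's identity gives
  \<open>F\<^sub>0(x, y) = E[(1 - ty)\<^bsup>2\<beta>-1\<^esup> (1 - x)\<^bsup>3\<beta>-1\<^esup> (1 - x(1 - s(1 - ty)))\<^bsup>1-4\<beta>\<^esup>]\<close>. Expanding in powers of \<open>x\<close> and
  then of \<open>y\<close> converges absolutely for all \<open>|x|, |y| < 1\<close>, so no analytic continuation is needed and
  positivity is visible for every \<open>\<beta> > 0\<close>. The same expansion at \<open>y = 1\<close> sums the rows of \<open>A\<^sup>0\<close>.
  Applying Euler's transformation to the integral over \<open>s\<close> turns the formula into one whose integrand
  is dominated by \<open>1 + (1 - t)\<^bsup>\<beta>-1\<^esup>\<close> uniformly on \<open>[0, 1]\<^sup>2\<close>, which is integrable for \<open>\<beta> > 1/2\<close>; this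
  yields the continuous extension to the corner.
\<close>

subsection \<open>Double power series\<close>

text \<open>The factor of \<open>A0\<close> in |m - n| couples the indices and can be negative, so
  neither the row sums nor positivity can be read off the coefficients. For fixed m, Vandermonde's
  identity splits it into finitely many terms that depend on n only through
  \<open>(1 - 2\<beta> - j)_n / (2\<beta>)_n\<close>. Each sums to an Euler integral, so a row
  becomes an expectation of \<open>(1 - ty)^(2\<beta> - 1)\<close> times a polynomial in
  \<open>w = 1 - ty\<close>. Summing over m in powers of w would require
  \<open>|xw| < |1 - x|\<close>; averaging over s and expanding in \<open>v = 1 - sw\<close>, which
  lies in [-1, 1], requires only |x| < 1.

  The thresholds are integrability conditions: the edge y = 1 uses the moment of
  \<open>(1 - t)^(2\<beta> - 1)\<close>, finite for 3\<beta> > 1, and the corner that of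
  \<open>(1 - t)^(\<beta> - 1)\<close>, finite for 2\<beta> > 1. As x tends to 1 the first formula
  degenerates for \<beta> > 1/3: \<open>(1 - x)^(3\<beta> - 1)\<close> vanishes while
  \<open>s^(1 - 4\<beta>)\<close> is not integrable against the weight. Euler's transformation
  produces exactly the power of 1 - x that cancels.\<close>

lemma term2_simp: "term2 c (x, y) (m, n) = c m n * (x ^ m * y ^ n)"
  by (simp add: term2_def)

lemma summable_on_product_nat:
  fixes f g :: "nat \<Rightarrow> real"
  assumes "summable f" "summable g" "\<And>m. 0 \<le> f m" "\<And>n. 0 \<le> g n"
  shows "(\<lambda>(m, n). f m * g n) summable_on UNIV"
proof -
  have f: "f summable_on UNIV" and g: "g summable_on UNIV"
    using assms by (auto intro: summable_nonneg_imp_summable_on)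
  have "(\<lambda>(m, n). f m * g n) summable_on (SIGMA m:UNIV. UNIV)"
  proof (rule summable_on_SigmaI)
    show "((\<lambda>n. case (m, n) of (m, n) \<Rightarrow> f m * g n) has_sum (f m * infsum g UNIV)) UNIV" for m
      using has_sum_cmult_right[OF has_sum_infsum[OF g]] by simp
    show "(\<lambda>m. f m * infsum g UNIV) summable_on UNIV"
      by (rule summable_on_cmult_left[OF f])
  qed (use assms in auto)
  then show ?thesis by simp
qed

text \<open>Two separate majorants, so that the closed edges are covered too: one factor may be
  summable at 1 while the other is controlled only inside the unit interval.\<close>

lemma term2_summable_on:
  assumes c: "\<And>m n. \<bar>c m n\<bar> \<le> g m * h n" and nn: "\<And>m. 0 \<le> g m" "\<And>n. 0 \<le> h n"
    and g: "summable (\<lambda>m. g m * \<bar>x\<bar> ^ m)" and h: "summable (\<lambda>n. h n * \<bar>y\<bar> ^ n)"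
  shows "term2 c (x, y) summable_on UNIV"
proof -
  have "(\<lambda>(m, n). (g m * \<bar>x\<bar> ^ m) * (h n * \<bar>y\<bar> ^ n)) summable_on UNIV"
    by (rule summable_on_product_nat) (use g h nn in auto)
  then have "(\<lambda>k. norm (term2 c (x, y) k)) summable_on UNIV"
  proof (rule summable_on_comparison_test)
    fix k :: "nat \<times> nat"
    obtain m n where k: "k = (m, n)" by fastforce
    have "\<bar>c m n\<bar> * (\<bar>x\<bar> ^ m * \<bar>y\<bar> ^ n) \<le> (g m * h n) * (\<bar>x\<bar> ^ m * \<bar>y\<bar> ^ n)"
      using c by (intro mult_right_mono) auto
    then show "norm (term2 c (x, y) k) \<le> (case k of (m, n) \<Rightarrow> (g m * \<bar>x\<bar> ^ m) * (h n * \<bar>y\<bar> ^ n))"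
      by (simp add: k term2_simp abs_mult power_abs mult_ac)
  qed auto
  then show ?thesis
    by (rule abs_summable_summable)
qed

text \<open>A single hypothesis from which convergence, analyticity and termwise differentiation all
  follow. It is preserved by formal differentiation, so it can be applied again to the
  derivatives.\<close>

definition prod_dominated :: "(nat \<Rightarrow> nat \<Rightarrow> real) \<Rightarrow> bool" where
  "prod_dominated c \<longleftrightarrow>
     (\<exists>g. (\<forall>m n. \<bar>c m n\<bar> \<le> g m * g n) \<and> (\<forall>m. 0 \<le> g m) \<and>
        (\<forall>x. \<bar>x\<bar> < 1 \<longrightarrow> summable (\<lambda>m. g m * x ^ m)))"

lemma prod_dominatedE:
  assumes "prod_dominated c"
  obtains g where "\<And>m n. \<bar>c m n\<bar> \<le> g m * g n" "\<And>m. 0 \<le> g m"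
    "\<And>x. \<bar>x\<bar> < 1 \<Longrightarrow> summable (\<lambda>m. g m * x ^ m)"
  using assms unfolding prod_dominated_def by blast

lemma prod_dominated_summable:
  assumes "prod_dominated c" "\<bar>x\<bar> < 1" "\<bar>y\<bar> < 1"
  shows "term2 c (x, y) summable_on UNIV"
proof -
  obtain g where "\<And>m n. \<bar>c m n\<bar> \<le> g m * g n" "\<And>m. 0 \<le> g m"
    "\<And>x. \<bar>x\<bar> < 1 \<Longrightarrow> summable (\<lambda>m. g m * x ^ m)"
    by (rule prod_dominatedE[OF assms(1)], blast)
  then show ?thesis
    using assms by (intro term2_summable_on[where g = g and h = g]) auto
qed

lemma prod_dominated_abs_summable:
  assumes "prod_dominated c" "\<bar>x\<bar> < 1" "\<bar>y\<bar> < 1"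
  shows "(\<lambda>k. \<bar>term2 c (x, y) k\<bar>) summable_on UNIV"
  using prod_dominated_summable[OF assms]
  by (subst (asm) summable_on_iff_abs_summable_on_real) simp

lemma prod_dominated_loc_unif:
  assumes c: "prod_dominated c"
  shows "series2_conv_loc_unif_on c open_square"
  unfolding series2_conv_loc_unif_on_def
proof
  fix r :: "real \<times> real" assume r: "r \<in> open_square"
  \<comment> \<open>Halfway between \<open>r\<close> and the boundary: the box with these
    half-widths contains \<open>r\<close>, and the terms at its corner serve as constants for the
    M-test.\<close>
  define x y where "x = (1 + \<bar>fst r\<bar>) / 2" and "y = (1 + \<bar>snd r\<bar>) / 2"
  define U where "U = {-x<..<x} \<times> {-y<..<y}"
  have xy: "\<bar>x\<bar> < 1" "\<bar>y\<bar> < 1" "x \<ge> 0" "y \<ge> 0"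
    using r by (auto simp: x_def y_def)
  have "uniform_limit (U \<inter> open_square) (\<lambda>N s. \<Sum>n\<in>N. term2 c s n) (\<lambda>s. \<Sum>\<^sub>\<infinity>n\<in>UNIV. term2 c s n)
      (finite_subsets_at_top UNIV)"
  proof (rule Weierstrass_m_test_general[where M = "\<lambda>k. \<bar>term2 c (x, y) k\<bar>"])
    show "(\<lambda>k. \<bar>term2 c (x, y) k\<bar>) summable_on UNIV"
      by (rule prod_dominated_abs_summable[OF c]) (use xy in auto)
    fix k s assume s: "s \<in> U \<inter> open_square"
    have "\<bar>fst s\<bar> ^ fst k * \<bar>snd s\<bar> ^ snd k \<le> x ^ fst k * y ^ snd k"
      using s by (intro mult_mono power_mono) (auto simp: U_def)
    then show "norm (term2 c s k) \<le> \<bar>term2 c (x, y) k\<bar>"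
      using xy by (auto simp: term2_def abs_mult power_abs intro!: mult_left_mono)
  qed
  moreover have "r \<in> U" "open U"
    using r by (auto simp: U_def x_def y_def mem_Times_iff abs_if field_simps intro!: open_Times)
  ultimately show "\<exists>U. open U \<and> r \<in> U \<and> uniform_limit (U \<inter> open_square)
      (\<lambda>N s. \<Sum>n\<in>N. term2 c s n) (series2 c) (finite_subsets_at_top UNIV)"
    unfolding series2_def by blast
qed

text \<open>The binomial theorem summed over all i, so that the range does not depend on m when sums
  are exchanged. For i > m the truncated exponent \<open>m - i\<close> is harmless, since the
  binomial coefficient vanishes.\<close>

lemma binomial_has_sum:
  fixes a h :: real
  shows "((\<lambda>i. of_nat (m choose i) * h ^ i * a ^ (m - i)) has_sum (h + a) ^ m) UNIV"
  by (subst binomial_ring, rule has_sum_finite_neutralI[where B = "{..m}"]) auto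

lemma has_sum_product_nat:
  fixes f g :: "nat \<Rightarrow> real"
  assumes "(f has_sum S) UNIV" "(g has_sum T) UNIV"
  shows "((\<lambda>(m, n). f m * g n) has_sum (S * T)) UNIV"
proof -
  have af: "(\<lambda>m. \<bar>f m\<bar>) summable_on UNIV" and ag: "(\<lambda>m. \<bar>g m\<bar>) summable_on UNIV"
    using assms summable_on_iff_abs_summable_on_real by (auto simp: has_sum_iff)
  have "(\<lambda>(m, n). \<bar>f m\<bar> * \<bar>g n\<bar>) summable_on UNIV"
    using af ag by (intro summable_on_product_nat) (auto intro: summable_on_imp_summable)
  then have "(\<lambda>k. norm (case k of (m, n) \<Rightarrow> f m * g n)) summable_on UNIV"
    by (simp add: case_prod_unfold abs_mult)
  then have "(\<lambda>(m, n). f m * g n) summable_on (SIGMA m:UNIV. UNIV)"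
    by (simp add: abs_summable_summable[of "\<lambda>(m, n). f m * g n"])
  then have "((\<lambda>(m, n). f m * g n) has_sum (S * T)) (SIGMA m:UNIV. UNIV)"
    by (intro has_sum_SigmaI[where g = "\<lambda>m. f m * T"])
      (use assms in \<open>auto intro: has_sum_cmult_left has_sum_cmult_right\<close>)
  then show ?thesis by simp
qed

text \<open>Each monomial is re-expanded about \<open>p\<close> by the binomial theorem and the two
  double sums are exchanged. The radius is the distance from \<open>p\<close> to the boundary in the
  maximum norm.\<close>

lemma prod_dominated_analytic:
  assumes c: "prod_dominated c"
  shows "real_analytic2_on (series2 c) open_square"
  unfolding real_analytic2_on_def
proof
  fix p :: "real \<times> real" assume p: "p \<in> open_square"
  obtain a b where ab: "p = (a, b)" by fastforce
  define e where "e = min (1 - \<bar>a\<bar>) (1 - \<bar>b\<bar>)"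
  have e: "e > 0" using p by (auto simp: e_def ab)
  define d where "d i j = (\<Sum>\<^sub>\<infinity>(m, n)\<in>UNIV. c m n *
    ((of_nat (m choose i) * a ^ (m - i)) * (of_nat (n choose j) * b ^ (n - j))))" for i j
  have "(term2 d (r - p) has_sum series2 c r) UNIV"
    if r: "\<bar>fst r - fst p\<bar> < e" "\<bar>snd r - snd p\<bar> < e" for r
  proof -
    define h k where "h = fst r - a" and "k = snd r - b"
    have hk: "\<bar>h\<bar> + \<bar>a\<bar> < 1" "\<bar>k\<bar> + \<bar>b\<bar> < 1"
      using r by (auto simp: e_def ab h_def k_def)
    have r': "r = (h + a, k + b)" by (simp add: h_def k_def)
    define B where "B h a m i = of_nat (m choose i) * h ^ i * a ^ (m - i)" for h a :: real and m i :: nat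
    define T where "T mn ij = c (fst mn) (snd mn) * (B h a (fst mn) (fst ij) * B k b (snd mn) (snd ij))"
      for mn ij
    have absB: "\<bar>B h a m i\<bar> = B \<bar>h\<bar> \<bar>a\<bar> m i" for h a m i
      by (simp add: B_def abs_mult power_abs)
    have hsB: "((\<lambda>(i, j). B h a m i * B k b n j) has_sum ((h + a) ^ m * (k + b) ^ n)) UNIV" for h a k b m n
      unfolding B_def by (intro has_sum_product_nat binomial_has_sum)
    have row: "(T mn has_sum term2 c r mn) UNIV" for mn
      using has_sum_cmult_right[OF hsB[of h a "fst mn" k b "snd mn"], of "c (fst mn) (snd mn)"]
      unfolding T_def term2_def r' by (simp add: case_prod_unfold)
    \<comment> \<open>Taking absolute values in the expansion gives the same binomial sum at
      \<open>|h| + |a|\<close> and \<open>|k| + |b|\<close>. This point still lies in the open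
      square, so the fourfold sum converges absolutely.\<close>
    have absrow: "((\<lambda>ij. \<bar>T mn ij\<bar>) has_sum \<bar>term2 c (\<bar>h\<bar> + \<bar>a\<bar>, \<bar>k\<bar> + \<bar>b\<bar>) mn\<bar>) UNIV" for mn
      using has_sum_cmult_right[OF hsB[of "\<bar>h\<bar>" "\<bar>a\<bar>" "fst mn" "\<bar>k\<bar>" "\<bar>b\<bar>" "snd mn"],
          of "\<bar>c (fst mn) (snd mn)\<bar>"]
      unfolding T_def term2_def by (simp add: case_prod_unfold abs_mult absB)
    have "(\<lambda>z. norm (case z of (mn, ij) \<Rightarrow> T mn ij)) summable_on (SIGMA mn:UNIV. UNIV)"
    proof (rule summable_on_SigmaI)
      show "((\<lambda>ij. norm (case (mn, ij) of (mn, ij) \<Rightarrow> T mn ij)) has_sum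
          \<bar>term2 c (\<bar>h\<bar> + \<bar>a\<bar>, \<bar>k\<bar> + \<bar>b\<bar>) mn\<bar>) UNIV" for mn
        using absrow by simp
      show "(\<lambda>mn. \<bar>term2 c (\<bar>h\<bar> + \<bar>a\<bar>, \<bar>k\<bar> + \<bar>b\<bar>) mn\<bar>) summable_on UNIV"
        by (rule prod_dominated_abs_summable[OF c]) (use hk in auto)
    qed auto
    then have sT: "(\<lambda>(mn, ij). T mn ij) summable_on (UNIV \<times> UNIV)"
      by (rule abs_summable_summable)
    have "term2 c r summable_on UNIV"
      using prod_dominated_summable[OF c, of "h + a" "k + b"] hk unfolding r' by simp
    then have "((\<lambda>(mn, ij). T mn ij) has_sum series2 c r) (UNIV \<times> UNIV)"
      unfolding series2_def
      by (intro has_sum_SigmaI[OF _ has_sum_infsum sT]) (use row in auto)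
    then have *: "((\<lambda>(ij, mn). T mn ij) has_sum series2 c r) (UNIV \<times> UNIV)"
      by (subst (asm) has_sum_swap) simp
    show ?thesis
    proof (rule has_sum_SigmaD[OF *])
      fix ij :: "nat \<times> nat"
      have "(\<lambda>mn. T mn ij) summable_on UNIV"
        by (rule summable_on_SigmaD1[OF has_sum_imp_summable[OF *]]) simp
      moreover have "infsum (\<lambda>mn. T mn ij) UNIV = term2 d (r - p) ij"
        unfolding d_def term2_def
        by (subst infsum_cmult_left'[symmetric], rule infsum_cong)
          (simp add: T_def B_def h_def k_def ab case_prod_unfold mult_ac)
      ultimately show "((\<lambda>mn. case (ij, mn) of (ij, mn) \<Rightarrow> T mn ij) has_sum term2 d (r - p) ij) UNIV"
        by (simp add: has_sum_iff)
    qed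
  qed
  then show "\<exists>c' e. e > 0 \<and> (\<forall>r. \<bar>fst r - fst p\<bar> < e \<and> \<bar>snd r - snd p\<bar> < e \<longrightarrow>
        (term2 c' (r - p) has_sum series2 c r) UNIV)"
    using e by (intro exI[of _ d] exI[of _ e]) simp
qed

section \<open>Termwise differentiation in the first variable\<close>

definition d1 :: "(nat \<Rightarrow> nat \<Rightarrow> real) \<Rightarrow> nat \<Rightarrow> nat \<Rightarrow> real" where
  "d1 c m n = real (Suc m) * c (Suc m) n"

lemma prod_dominated_d1:
  assumes "prod_dominated c"
  shows "prod_dominated (d1 c)"
proof -
  obtain g where g: "\<And>m n. \<bar>c m n\<bar> \<le> g m * g n" "\<And>m. 0 \<le> g m"
    "\<And>x. \<bar>x\<bar> < 1 \<Longrightarrow> summable (\<lambda>m. g m * x ^ m)"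
    by (rule prod_dominatedE[OF assms(1)], blast)
  \<comment> \<open>Only the first index is differentiated, but the majorant has the same factor for
    both indices; the sum dominates both \<open>diffs g\<close> and \<open>g\<close>.\<close>
  define g' where "g' m = diffs g m + g m" for m
  have dn: "0 \<le> diffs g m" for m using g(2) by (simp add: diffs_def)
  have "\<bar>d1 c m n\<bar> \<le> g' m * g' n" for m n
  proof -
    have "\<bar>d1 c m n\<bar> \<le> real (Suc m) * (g (Suc m) * g n)"
      unfolding d1_def abs_mult using g(1) by (intro mult_mono) auto
    also have "\<dots> = diffs g m * g n" by (simp add: diffs_def)
    also have "\<dots> \<le> g' m * g' n"
      unfolding g'_def using g(2) dn by (intro mult_mono) auto
    finally show ?thesis .
  qed
  moreover have "0 \<le> g' m" for m using g(2) dn by (simp add: g'_def)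
  moreover have "summable (\<lambda>m. g' m * x ^ m)" if "\<bar>x\<bar> < 1" for x
  proof -
    have "summable (\<lambda>m. diffs g m * x ^ m)"
      by (rule termdiff_converges[where K = 1]) (use that g(3) in auto)
    then show ?thesis
      unfolding g'_def distrib_right using g(3) that by (intro summable_add) auto
  qed
  ultimately show ?thesis unfolding prod_dominated_def by (intro exI[of _ g']) simp
qed

lemma series2_iterated:
  assumes s: "term2 c (x, y) summable_on UNIV"
  shows "(\<lambda>m. (\<Sum>\<^sub>\<infinity>n. c m n * y ^ n) * x ^ m) sums series2 c (x, y)"
proof -
  have s': "(\<lambda>(m, n). c m n * (x ^ m * y ^ n)) summable_on (SIGMA m:UNIV. UNIV)"
    using s by (simp add: term2_def[abs_def] case_prod_unfold)
  have "((\<lambda>m. \<Sum>\<^sub>\<infinity>n. c m n * (x ^ m * y ^ n)) has_sum series2 c (x, y)) UNIV"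
    unfolding has_sum_iff
    using infsum_Sigma'_banach[OF s'] summable_on_Sigma_banach[OF s']
    by (simp add: series2_def term2_def[abs_def] case_prod_unfold)
  moreover have "(\<Sum>\<^sub>\<infinity>n. c m n * (x ^ m * y ^ n)) = (\<Sum>\<^sub>\<infinity>n. c m n * y ^ n) * x ^ m" for m
    by (subst infsum_cmult_left'[symmetric]) (simp add: mult_ac)
  ultimately show ?thesis by (simp add: has_sum_imp_sums)
qed

text \<open>With y frozen, summing over n first leaves a power series in one variable whose
  coefficients are the row sums, so the one-variable theorem applies.\<close>

lemma series2_has_derivative1:
  assumes c: "prod_dominated c" and x: "\<bar>x\<bar> < 1" and y: "\<bar>y\<bar> < 1"
  shows "((\<lambda>t. series2 c (t, y)) has_field_derivative series2 (d1 c) (x, y)) (at x)"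
proof -
  define a where "a m = (\<Sum>\<^sub>\<infinity>n. c m n * y ^ n)" for m
  have a: "(\<lambda>m. a m * t ^ m) sums series2 c (t, y)" if "\<bar>t\<bar> < 1" for t
    unfolding a_def using c y that by (intro series2_iterated prod_dominated_summable)
  have "diffs a m = (\<Sum>\<^sub>\<infinity>n. d1 c m n * y ^ n)" for m
    unfolding diffs_def a_def d1_def by (simp add: infsum_cmult_right' mult.assoc)
  then have d: "(\<lambda>m. diffs a m * x ^ m) sums series2 (d1 c) (x, y)"
    using series2_iterated[OF prod_dominated_summable[OF prod_dominated_d1[OF c] x y]] by simp
  have "((\<lambda>t. \<Sum>m. a m * t ^ m) has_field_derivative (\<Sum>m. diffs a m * x ^ m)) (at x)"
    by (rule termdiffs_strong'[where K = 1]) (use a x in \<open>auto simp: sums_iff\<close>)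
  then have "((\<lambda>t. \<Sum>m. a m * t ^ m) has_field_derivative series2 (d1 c) (x, y)) (at x)"
    using d by (simp add: sums_iff)
  then show ?thesis
    by (rule has_field_derivative_transform_within_open[where S = "{-1<..<1}"])
      (use a x in \<open>auto simp: sums_iff\<close>)
qed

lemma partial1_series2:
  assumes "prod_dominated c" "\<bar>x\<bar> < 1" "\<bar>y\<bar> < 1"
  shows "partial1 (series2 c) (x, y) = series2 (d1 c) (x, y)"
  unfolding partial1_def using DERIV_imp_deriv[OF series2_has_derivative1[OF assms]] by simp

lemma partial1_partial1_series2:
  assumes c: "prod_dominated c" "\<bar>x\<bar> < 1" "\<bar>y\<bar> < 1"
  shows "partial1 (partial1 (series2 c)) (x, y) = series2 (d1 (d1 c)) (x, y)"
proof -
  have "((\<lambda>t. partial1 (series2 c) (t, y)) has_field_derivative series2 (d1 (d1 c)) (x, y)) (at x)"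
    by (rule has_field_derivative_transform_within_open[where S = "{-1<..<1}",
          OF series2_has_derivative1[OF prod_dominated_d1]])
      (use assms in \<open>auto simp: partial1_series2\<close>)
  from DERIV_imp_deriv[OF this] show ?thesis
    by (simp add: partial1_def[of "partial1 _"])
qed

section \<open>Multiplication by a variable, on coefficients\<close>

text \<open>Coefficients of the series times its first variable. Together with \<open>d1\<close>
  this turns a differential equation with polynomial coefficients into an identity between
  coefficients.\<close>

definition shift1 :: "(nat \<Rightarrow> nat \<Rightarrow> real) \<Rightarrow> nat \<Rightarrow> nat \<Rightarrow> real" where
  "shift1 c m n = (case m of 0 \<Rightarrow> 0 | Suc m' \<Rightarrow> c m' n)"

definition shift2 :: "(nat \<Rightarrow> nat \<Rightarrow> real) \<Rightarrow> nat \<Rightarrow> nat \<Rightarrow> real" where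
  "shift2 c m n = (case n of 0 \<Rightarrow> 0 | Suc n' \<Rightarrow> c m n')"

lemma term2_swap: "(term2 (\<lambda>m n. c n m) (y, x) has_sum S) UNIV \<longleftrightarrow> (term2 c (x, y) has_sum S) UNIV"
  using has_sum_swap[of "term2 c (x, y)" UNIV UNIV S]
  by (simp add: term2_def[abs_def] case_prod_unfold mult_ac)

lemma has_sum_shift1:
  assumes "(term2 c (x, y) has_sum S) UNIV"
  shows "(term2 (shift1 c) (x, y) has_sum x * S) UNIV"
proof -
  have "((\<lambda>k. x * term2 c (x, y) k) has_sum x * S) UNIV"
    by (rule has_sum_cmult_right[OF assms])
  also have "(\<lambda>k. x * term2 c (x, y) k) = term2 (shift1 c) (x, y) \<circ> map_prod Suc id"
    by (auto simp: term2_def shift1_def fun_eq_iff mult_ac)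
  also have "(\<dots> has_sum x * S) UNIV \<longleftrightarrow>
      (term2 (shift1 c) (x, y) has_sum x * S) (map_prod Suc id ` UNIV)"
    by (rule has_sum_reindex[symmetric]) (auto simp: inj_on_def)
  also have "\<dots> \<longleftrightarrow> (term2 (shift1 c) (x, y) has_sum x * S) UNIV"
  proof (rule has_sum_cong_neutral)
    fix k :: "nat \<times> nat"
    assume "k \<in> UNIV - map_prod Suc id ` UNIV"
    then show "term2 (shift1 c) (x, y) k = 0"
      by (cases k; cases "fst k") (auto simp: term2_def shift1_def image_iff)
  qed auto
  finally show ?thesis .
qed

lemma has_sum_shift2:
  assumes "(term2 c (x, y) has_sum S) UNIV"
  shows "(term2 (shift2 c) (x, y) has_sum y * S) UNIV"
proof -
  have "(term2 (\<lambda>m n. c n m) (y, x) has_sum S) UNIV"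
    by (rule iffD2[OF term2_swap assms])
  from iffD2[OF term2_swap has_sum_shift1[OF this]] show ?thesis
    by (simp add: shift1_def[abs_def] shift2_def[abs_def])
qed

lemma term2_has_sum_cmult:
  "(term2 c r has_sum S) UNIV \<Longrightarrow> (term2 (\<lambda>m n. a * c m n) r has_sum a * S) UNIV"
  using has_sum_cmult_right[of "term2 c r" UNIV S a] by (simp add: term2_def[abs_def] mult_ac)

lemma term2_has_sum_add:
  "(term2 c r has_sum S) UNIV \<Longrightarrow> (term2 d r has_sum T) UNIV \<Longrightarrow>
     (term2 (\<lambda>m n. c m n + d m n) r has_sum S + T) UNIV"
  using has_sum_add[of "term2 c r" UNIV S "term2 d r" T]
  by (simp add: term2_def[abs_def] distrib_right)

lemma series2_has_sum:
  "prod_dominated c \<Longrightarrow> \<bar>x\<bar> < 1 \<Longrightarrow> \<bar>y\<bar> < 1 \<Longrightarrow> (term2 c (x, y) has_sum series2 c (x, y)) UNIV"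
  unfolding series2_def by (intro has_sum_infsum prod_dominated_summable)


subsection \<open>The symmetric beta distribution\<close>

text \<open>Normalised to a probability measure, so that Euler integrals are expectations, bounds on
  an integrand pass to its integral unchanged, and the Gamma factors appear only in moments.\<close>

definition beta_measure :: "real \<Rightarrow> real measure" where
  "beta_measure \<beta> = density lborel
     (\<lambda>t. ennreal (indicator {0<..<1} t * (t powr (\<beta> - 1) * (1 - t) powr (\<beta> - 1)) / Beta \<beta> \<beta>))"

lemma space_beta_measure [simp]: "space (beta_measure \<beta>) = UNIV"
  by (simp add: beta_measure_def)

lemma sets_beta_measure [measurable_cong, simp]: "sets (beta_measure \<beta>) = sets borel"
  by (simp add: beta_measure_def)

lemma Beta_pos: "a > 0 \<Longrightarrow> b > 0 \<Longrightarrow> Beta a b > (0 :: real)"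
  by (simp add: Beta_def Gamma_real_pos)

lemma AE_beta_measure: "AE t in beta_measure \<beta>. 0 < t \<and> t < 1"
  unfolding beta_measure_def
  by (subst AE_density) (auto intro!: AE_I2 simp: indicator_def split: if_splits)

lemma AE_beta_measureI:
  assumes "\<And>t. 0 < t \<Longrightarrow> t < 1 \<Longrightarrow> P t"
  shows "AE t in beta_measure \<beta>. P t"
  using AE_beta_measure by (rule eventually_mono) (use assms in auto)

lemma beta_measure_moment:
  assumes "\<beta> > 0" "\<beta> + a > 0" "\<beta> + b > 0"
  shows "has_bochner_integral (beta_measure \<beta>) (\<lambda>t. t powr a * (1 - t) powr b)
           (Beta (\<beta> + a) (\<beta> + b) / Beta \<beta> \<beta>)"
proof -
  define w where "w t = indicator {0<..<1} t * (t powr (\<beta> - 1) * (1 - t) powr (\<beta> - 1)) / Beta \<beta> \<beta>" for t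
  have B: "Beta \<beta> \<beta> > 0" "Beta (\<beta> + a) (\<beta> + b) > 0" using assms by (auto intro: Beta_pos)
  have w: "w t \<ge> 0" for t using B by (simp add: w_def)
  have wm: "w \<in> borel_measurable borel" unfolding w_def by measurable
  define f where "f t = t powr (\<beta> + a - 1) * (1 - t) powr (\<beta> + b - 1) / Beta \<beta> \<beta>" for t :: real
  have "((\<lambda>t. t powr (\<beta> + a - 1) * (1 - t) powr (\<beta> + b - 1)) has_integral Beta (\<beta> + a) (\<beta> + b)) {0<..<1}"
    using has_integral_Beta_real[of "\<beta> + a" "\<beta> + b"] assms by (simp add: has_integral_Icc_iff_Ioo)
  then have "(f has_integral Beta (\<beta> + a) (\<beta> + b) / Beta \<beta> \<beta>) {0<..<1}"
    using has_integral_divide[of _ _ _ "Beta \<beta> \<beta>"] unfolding f_def[abs_def] by blast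
  then have nn: "integral\<^sup>N lborel (\<lambda>t. indicator {0<..<1} t * f t) = Beta (\<beta> + a) (\<beta> + b) / Beta \<beta> \<beta>"
    by (rule nn_integral_has_integral_lebesgue[rotated]) (use B in \<open>simp add: f_def\<close>)
  have fm: "f \<in> borel_measurable borel" unfolding f_def by measurable
  have eq: "w t * (t powr a * (1 - t) powr b) = indicator {0<..<1} t * f t" for t
    by (auto simp: w_def f_def indicator_def powr_diff powr_add)
  have "(\<integral>\<^sup>+t. t powr a * (1 - t) powr b \<partial>beta_measure \<beta>)
      = (\<integral>\<^sup>+t. ennreal (w t) * ennreal (t powr a * (1 - t) powr b) \<partial>lborel)"
    unfolding beta_measure_def w_def[symmetric] using wm by (subst nn_integral_density) auto
  also have "\<dots> = (\<integral>\<^sup>+t. indicator {0<..<1} t * f t \<partial>lborel)"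
    using w by (simp add: ennreal_mult'[symmetric] eq)
  finally show ?thesis
    using nn B by (intro has_bochner_integral_nn_integral) (auto simp: less_imp_le)
qed

lemma beta_measure_finite:
  assumes "\<beta> > 0" shows "finite_measure (beta_measure \<beta>)"
proof -
  have "has_bochner_integral (beta_measure \<beta>) (\<lambda>t. t powr 0 * (1 - t) powr 0) 1"
    using beta_measure_moment[of \<beta> 0 0] assms Beta_pos[OF assms assms] by simp
  \<comment> \<open>In HOL \<open>0 powr 0 = 0\<close>, so the zeroth moment and the constant 1 have
    integrands that agree only almost everywhere.\<close>
  also have "has_bochner_integral (beta_measure \<beta>) (\<lambda>t. t powr 0 * (1 - t) powr 0) 1 \<longleftrightarrow>
      has_bochner_integral (beta_measure \<beta>) (\<lambda>t. 1) (1 :: real)"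
    by (intro has_bochner_integral_cong_AE AE_beta_measureI) auto
  finally have "integrable (beta_measure \<beta>) (\<lambda>t. 1 :: real)"
    by (simp add: has_bochner_integral_iff)
  then show ?thesis
    by (intro finite_measureI) (simp add: integrable_iff_bounded less_top)
qed

lemma beta_measure_integral_1:
  assumes "\<beta> > 0" shows "(\<integral>t. c \<partial>beta_measure \<beta>) = (c :: real)"
proof -
  have "(\<integral>t. t powr 0 * (1 - t) powr 0 \<partial>beta_measure \<beta>) = 1"
    using beta_measure_moment[of \<beta> 0 0] assms Beta_pos[OF assms assms] 
    by (simp add: has_bochner_integral_iff)
  moreover have "(\<integral>t. t powr 0 * (1 - t) powr 0 \<partial>beta_measure \<beta>) = (\<integral>t. 1 \<partial>beta_measure \<beta>)"
    by (intro integral_cong_AE AE_beta_measureI) auto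
  ultimately show ?thesis by simp
qed

lemma beta_measure_integrable_bounded:
  fixes f :: "real \<Rightarrow> real"
  assumes "\<beta> > 0" "f \<in> borel_measurable borel" "\<And>t. 0 < t \<Longrightarrow> t < 1 \<Longrightarrow> \<bar>f t\<bar> \<le> B"
  shows "integrable (beta_measure \<beta>) f"
proof -
  interpret finite_measure "beta_measure \<beta>" by (rule beta_measure_finite[OF assms(1)])
  show ?thesis
    using assms by (intro integrable_const_bound[where B = B] AE_beta_measureI) auto
qed

lemma beta_measure_integral_cong:
  fixes f g :: "real \<Rightarrow> real"
  assumes "f \<in> borel_measurable borel" "g \<in> borel_measurable borel"
    "\<And>t. 0 < t \<Longrightarrow> t < 1 \<Longrightarrow> f t = g t"
  shows "(\<integral>t. f t \<partial>beta_measure \<beta>) = (\<integral>t. g t \<partial>beta_measure \<beta>)"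
  using assms by (intro integral_cong_AE AE_beta_measureI) auto

lemma beta_measure_integral_ge:
  fixes f :: "real \<Rightarrow> real"
  assumes \<beta>: "\<beta> > 0" and f: "integrable (beta_measure \<beta>) f" and c: "\<And>t. 0 < t \<Longrightarrow> t < 1 \<Longrightarrow> c \<le> f t"
  shows "c \<le> (\<integral>t. f t \<partial>beta_measure \<beta>)"
proof -
  have "c = (\<integral>t. c \<partial>beta_measure \<beta>)" by (rule beta_measure_integral_1[OF \<beta>, symmetric])
  also have "\<dots> \<le> (\<integral>t. f t \<partial>beta_measure \<beta>)"
    using c f by (intro integral_mono_AE AE_beta_measureI beta_measure_integrable_bounded[OF \<beta>, of "\<lambda>_. c" "\<bar>c\<bar>"]) auto
  finally show ?thesis .
qed

lemma beta_measure_integral_abs_le: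
  fixes f :: "real \<Rightarrow> real"
  assumes \<beta>: "\<beta> > 0" and f: "f \<in> borel_measurable borel" and c: "\<And>t. 0 < t \<Longrightarrow> t < 1 \<Longrightarrow> \<bar>f t\<bar> \<le> c"
  shows "\<bar>\<integral>t. f t \<partial>beta_measure \<beta>\<bar> \<le> c"
proof -
  have i: "integrable (beta_measure \<beta>) f" by (rule beta_measure_integrable_bounded[OF \<beta> f c])
  have c': "- c \<le> f t" "- c \<le> - f t" if "0 < t" "t < 1" for t
    using c[OF that] by auto
  have "- c \<le> (\<integral>t. f t \<partial>beta_measure \<beta>)"
    by (rule beta_measure_integral_ge[OF \<beta> i c'(1)])
  moreover have "- c \<le> (\<integral>t. - f t \<partial>beta_measure \<beta>)"
    using i by (intro beta_measure_integral_ge[OF \<beta> _ c'(2)]) auto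
  ultimately show ?thesis by auto
qed

lemma beta_measure_power_moment:
  assumes "\<beta> > 0"
  shows "has_bochner_integral (beta_measure \<beta>) (\<lambda>t. t ^ n) (pochhammer \<beta> n / pochhammer (2 * \<beta>) n)"
proof -
  have "has_bochner_integral (beta_measure \<beta>) (\<lambda>t. t powr real n * (1 - t) powr 0)
      (Beta (\<beta> + real n) \<beta> / Beta \<beta> \<beta>)"
    using beta_measure_moment[of \<beta> "real n" 0] assms by simp
  also have "has_bochner_integral (beta_measure \<beta>) (\<lambda>t. t powr real n * (1 - t) powr 0)
        (Beta (\<beta> + real n) \<beta> / Beta \<beta> \<beta>) \<longleftrightarrow>
      has_bochner_integral (beta_measure \<beta>) (\<lambda>t. t ^ n) (Beta (\<beta> + real n) \<beta> / Beta \<beta> \<beta>)"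
    by (intro has_bochner_integral_cong_AE AE_beta_measureI) (auto simp: powr_realpow)
  also have "Beta (\<beta> + real n) \<beta> / Beta \<beta> \<beta> = pochhammer \<beta> n / pochhammer (2 * \<beta>) n"
  proof -
    have n: "\<beta> \<notin> \<int>\<^sub>\<le>\<^sub>0" "2 * \<beta> \<notin> \<int>\<^sub>\<le>\<^sub>0" using assms by (auto elim!: nonpos_Ints_cases)
    have "Gamma \<beta> > 0" "Gamma (2 * \<beta>) > 0" "Gamma (2 * \<beta> + real n) > 0"
      using assms by (auto intro!: Gamma_real_pos)
    then show ?thesis
      unfolding pochhammer_Gamma[OF n(1)] pochhammer_Gamma[OF n(2)] Beta_def
      by (simp add: field_simps)
  qed
  finally show ?thesis .
qed

section \<open>Binomial series and Euler integrals\<close>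

lemma binomial_series_sums:
  fixes a x :: real
  assumes "\<bar>x\<bar> < 1"
  shows "(\<lambda>n. pochhammer a n / fact n * x ^ n) sums ((1 - x) powr (- a))"
proof -
  have "(\<lambda>n. ((- a) gchoose n) * (- x) ^ n) sums (1 + (- x)) powr (- a)"
    by (rule gen_binomial_real) (use assms in auto)
  moreover have "((- a) gchoose n) * (- x) ^ n = pochhammer a n / fact n * x ^ n" for n
    by (simp add: gbinomial_pochhammer power_minus[of x] mult_ac flip: power_add mult_2)
  ultimately show ?thesis by simp
qed

lemma binomial_series_abs_summable:
  fixes a x :: real
  assumes "\<bar>x\<bar> < 1"
  shows "summable (\<lambda>n. \<bar>pochhammer a n / fact n\<bar> * \<bar>x\<bar> ^ n)"
proof -
  obtain z where z: "\<bar>x\<bar> < z" "z < 1" using assms dense by blast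
  have "summable (\<lambda>n. norm (pochhammer a n / fact n * x ^ n))"
    using binomial_series_sums[of z a] z by (intro powser_insidea[of _ z]) (auto simp: sums_iff)
  then show ?thesis by (simp add: abs_mult power_abs)
qed

text \<open>Euler's integral for \<open>2F1(a, \<beta>; 2\<beta>; y)\<close>: the third parameter is
  twice the second, so the weight is the symmetric beta density. The endpoint |y| = 1 is included.
  There |ty| < 1 still holds for t < 1, so the binomial series converges pointwise, and the
  summability hypothesis pays for the exchange with the integral.\<close>

lemma euler_integral:
  assumes \<beta>: "\<beta> > 0" and y: "\<bar>y\<bar> \<le> 1"
    and s: "summable (\<lambda>n. \<bar>pochhammer a n / fact n\<bar> * (pochhammer \<beta> n / pochhammer (2 * \<beta>) n) * \<bar>y\<bar> ^ n)"
  shows "integrable (beta_measure \<beta>) (\<lambda>t. (1 - t * y) powr (- a))" (is ?th1)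
    and "(\<lambda>n. pochhammer a n / fact n * (pochhammer \<beta> n / pochhammer (2 * \<beta>) n) * y ^ n) sums
         (\<integral>t. (1 - t * y) powr (- a) \<partial>beta_measure \<beta>)" (is ?th2)
proof -
  define f where "f n t = pochhammer a n / fact n * (t * y) ^ n" for n t
  have ty: "\<bar>t * y\<bar> < 1" if "0 < t" "t < 1" for t
  proof -
    have "\<bar>t * y\<bar> \<le> t" using that y by (simp add: abs_mult mult_left_le)
    then show ?thesis using that by simp
  qed
  have sf: "(\<Sum>n. f n t) = (1 - t * y) powr (- a)" if "0 < t" "t < 1" for t
    using binomial_series_sums[OF ty[OF that]] unfolding f_def by (rule sums_unique[symmetric])
  have hf: "has_bochner_integral (beta_measure \<beta>) (f n)
      (pochhammer a n / fact n * (pochhammer \<beta> n / pochhammer (2 * \<beta>) n) * y ^ n)" for n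
    using has_bochner_integral_mult_right[OF beta_measure_power_moment[OF \<beta>, of n], of "pochhammer a n / fact n * y ^ n"]
    unfolding f_def power_mult_distrib by (simp add: mult_ac)
  have hfa: "has_bochner_integral (beta_measure \<beta>) (\<lambda>t. \<bar>f n t\<bar>)
      (\<bar>pochhammer a n / fact n\<bar> * (pochhammer \<beta> n / pochhammer (2 * \<beta>) n) * \<bar>y\<bar> ^ n)" for n
  proof -
    have "has_bochner_integral (beta_measure \<beta>) (\<lambda>t. \<bar>pochhammer a n / fact n\<bar> * \<bar>y\<bar> ^ n * t ^ n)
      (\<bar>pochhammer a n / fact n\<bar> * (pochhammer \<beta> n / pochhammer (2 * \<beta>) n) * \<bar>y\<bar> ^ n)"
      using has_bochner_integral_mult_right[OF beta_measure_power_moment[OF \<beta>, of n], of "\<bar>pochhammer a n / fact n\<bar> * \<bar>y\<bar> ^ n"]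
      by (simp add: mult_ac)
    also have "?this \<longleftrightarrow> ?thesis"
      unfolding f_def
      by (intro has_bochner_integral_cong_AE AE_beta_measureI)
        (auto simp: abs_mult power_mult_distrib power_abs)
    finally show ?thesis .
  qed
  have int: "integrable (beta_measure \<beta>) (f n)" for n
    using hf by (simp add: has_bochner_integral_iff)
  have ae: "AE t in beta_measure \<beta>. summable (\<lambda>n. norm (f n t))"
    using binomial_series_abs_summable[OF ty, of _ a]
    by (intro AE_beta_measureI) (simp add: f_def abs_mult power_abs)
  have sn: "summable (\<lambda>n. \<integral>t. norm (f n t) \<partial>beta_measure \<beta>)"
    using s hfa by (simp add: has_bochner_integral_iff)
  have m: "(\<lambda>t. \<Sum>n. f n t) \<in> borel_measurable borel" "(\<lambda>t. (1 - t * y) powr (- a)) \<in> borel_measurable borel"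
    unfolding f_def by measurable
  have "integrable (beta_measure \<beta>) (\<lambda>t. \<Sum>n. f n t)"
    by (rule integrable_suminf[OF int ae sn])
  also have "?this \<longleftrightarrow> ?th1"
    using m sf by (intro integrable_cong_AE AE_beta_measureI) auto
  finally show ?th1 .
  have "(\<integral>t. (\<Sum>n. f n t) \<partial>beta_measure \<beta>) = (\<integral>t. (1 - t * y) powr (- a) \<partial>beta_measure \<beta>)"
    using m sf by (intro beta_measure_integral_cong)
  then show ?th2
    using sums_integral[OF int ae sn] hf by (simp add: has_bochner_integral_iff)
qed

lemma euler_summable:
  fixes \<beta> a y :: real
  assumes \<beta>: "\<beta> > 0" and y: "\<bar>y\<bar> < 1"
  shows "summable (\<lambda>n. \<bar>pochhammer a n / fact n\<bar> * (pochhammer \<beta> n / pochhammer (2 * \<beta>) n) * \<bar>y\<bar> ^ n)"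
proof -
  have le1: "pochhammer \<beta> n / pochhammer (2 * \<beta>) n \<le> 1" "pochhammer \<beta> n / pochhammer (2 * \<beta>) n \<ge> 0" for n
  proof -
    have "pochhammer \<beta> n \<le> pochhammer (2 * \<beta>) n"
      unfolding pochhammer_prod using \<beta> by (intro prod_mono) auto
    then show "pochhammer \<beta> n / pochhammer (2 * \<beta>) n \<le> 1" "pochhammer \<beta> n / pochhammer (2 * \<beta>) n \<ge> 0"
      using \<beta> by (auto simp: divide_le_eq_1 pochhammer_pos less_imp_le)
  qed
  show ?thesis
  proof (rule summable_comparison_test'[OF binomial_series_abs_summable[OF y]])
    fix n :: nat
    show "norm (\<bar>pochhammer a n / fact n\<bar> * (pochhammer \<beta> n / pochhammer (2 * \<beta>) n) * \<bar>y\<bar> ^ n)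
        \<le> \<bar>pochhammer a n / fact n\<bar> * \<bar>y\<bar> ^ n"
      using mult_left_mono[OF le1(1)[of n], of "\<bar>pochhammer a n / fact n\<bar> * \<bar>y\<bar> ^ n"]
      unfolding real_norm_def abs_mult abs_of_nonneg[OF le1(2)] by (simp add: mult_ac)
  qed
qed

lemma beta_measure_series:
  fixes f :: "nat \<Rightarrow> real \<Rightarrow> real"
  assumes \<beta>: "\<beta> > 0" and m: "\<And>n. f n \<in> borel_measurable borel" "F \<in> borel_measurable borel"
    and b: "\<And>n t. 0 < t \<Longrightarrow> t < 1 \<Longrightarrow> \<bar>f n t\<bar> \<le> M n" and M: "summable M"
    and s: "\<And>t. 0 < t \<Longrightarrow> t < 1 \<Longrightarrow> (\<lambda>n. f n t) sums F t"
  shows "(\<lambda>n. \<integral>t. f n t \<partial>beta_measure \<beta>) sums (\<integral>t. F t \<partial>beta_measure \<beta>)"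
proof -
  have int: "integrable (beta_measure \<beta>) (f n)" for n
    by (rule beta_measure_integrable_bounded[OF \<beta> m(1) b])
  have ae: "AE t in beta_measure \<beta>. summable (\<lambda>n. norm (f n t))"
    by (intro AE_beta_measureI summable_comparison_test'[OF M]) (use b in auto)
  have sn: "summable (\<lambda>n. \<integral>t. norm (f n t) \<partial>beta_measure \<beta>)"
  proof (rule summable_comparison_test'[OF M])
    fix n :: nat
    show "norm (\<integral>t. norm (f n t) \<partial>beta_measure \<beta>) \<le> M n"
      using m b unfolding real_norm_def by (intro beta_measure_integral_abs_le[OF \<beta>]) auto
  qed
  have "(\<integral>t. (\<Sum>n. f n t) \<partial>beta_measure \<beta>) = (\<integral>t. F t \<partial>beta_measure \<beta>)"
    using m s by (intro beta_measure_integral_cong) (auto simp: sums_iff)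
  then show ?thesis
    using sums_integral[OF int ae sn] by simp
qed

section \<open>Chu-Vandermonde summation\<close>

text \<open>Written with \<open>rGamma\<close> instead of quotients by
  \<open>pochhammer c j\<close>, so that c may be a nonpositive integer. This matters later for
  \<open>c = 2\<beta> - n\<close>. The induction on m uses Pascal's rule and needs a and c to
  vary.\<close>

lemma vandermonde_rGamma:
  fixes a c :: real
  shows "(\<Sum>j\<le>m. real (m choose j) * (- 1) ^ j * pochhammer a j * rGamma (c + real j))
       = pochhammer (c - a) m * rGamma (c + real m)"
proof (induction m arbitrary: a c)
  case (Suc m)
  define g where "g j = (- 1) ^ j * pochhammer a j * rGamma (c + real j)" for j
  have "(\<Sum>j\<le>Suc m. real (Suc m choose j) * g j)
      = g 0 + (\<Sum>j\<le>m. real (Suc m choose Suc j) * g (Suc j))"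
    by (subst sum.atMost_Suc_shift) simp
  also have "\<dots> = g 0 + (\<Sum>j\<le>m. real (m choose Suc j) * g (Suc j)) + (\<Sum>j\<le>m. real (m choose j) * g (Suc j))"
    by (simp add: algebra_simps sum.distrib)
  also have "g 0 + (\<Sum>j\<le>m. real (m choose Suc j) * g (Suc j)) = (\<Sum>j\<le>Suc m. real (m choose j) * g j)"
    by (subst sum.atMost_Suc_shift) simp
  also have "\<dots> = (\<Sum>j\<le>m. real (m choose j) * g j)"
    by simp
  also have "\<dots> = pochhammer (c - a) m * rGamma (c + real m)"
    using Suc.IH[of a c] by (simp add: g_def mult.assoc)
  \<comment> \<open>Pulling the first factor out of \<open>pochhammer a (j + 1)\<close> leaves the
    same sum for \<open>a + 1\<close> and \<open>c + 1\<close>.\<close>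
  also have "(\<Sum>j\<le>m. real (m choose j) * g (Suc j))
      = - a * (\<Sum>j\<le>m. real (m choose j) * (- 1) ^ j * pochhammer (a + 1) j * rGamma (c + 1 + real j))"
    unfolding sum_distrib_left by (intro sum.cong) (auto simp: g_def pochhammer_rec mult_ac add_ac)
  also have "\<dots> = - a * (pochhammer (c - a) m * rGamma (c + real m + 1))"
    using Suc.IH[of "a + 1" "c + 1"] by (simp add: add_ac)
  also have "rGamma (c + real m) = (c + real m) * rGamma (c + real m + 1)"
    by (rule rGamma_plus1[symmetric])
  also have "pochhammer (c - a) m * ((c + real m) * rGamma (c + real m + 1)) + - a * (pochhammer (c - a) m * rGamma (c + real m + 1))
      = pochhammer (c - a) (Suc m) * rGamma (c + real (Suc m))"
    by (simp add: pochhammer_Suc algebra_simps)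
  finally show ?case by (simp add: g_def mult.assoc)
qed simp

lemma vandermonde_quotient:
  fixes a c :: real
  assumes "c > 0"
  shows "(\<Sum>j\<le>m. real (m choose j) * (- 1) ^ j * pochhammer a j / pochhammer c j)
       = pochhammer (c - a) m / pochhammer c m"
proof -
  have r: "rGamma (c + real j) = rGamma c / pochhammer c j" for j
    using pochhammer_rGamma[of c j] pochhammer_pos[OF assms, of j] by (simp add: field_simps)
  have "rGamma c \<noteq> 0" using assms by (auto simp: rGamma_eq_zero_iff elim!: nonpos_Ints_cases)
  moreover have "rGamma c * (\<Sum>j\<le>m. real (m choose j) * (- 1) ^ j * pochhammer a j / pochhammer c j)
       = rGamma c * (pochhammer (c - a) m / pochhammer c m)"
    using vandermonde_rGamma[of m a c] unfolding r sum_distrib_left by (simp add: mult_ac)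
  ultimately show ?thesis using mult_left_cancel by blast
qed

lemma pochhammer_reflect:
  fixes z :: real
  shows "pochhammer (1 - z - real n) n = (-1) ^ n * pochhammer z n"
  using pochhammer_minus[of "z + real n - 1" n] by (simp add: algebra_simps)


subsection \<open>The coefficients and their recurrences\<close>

text \<open>The Taylor coefficients of \<open>(1 - x)^(-\<beta>)\<close>.\<close>

definition bcoef :: "real \<Rightarrow> nat \<Rightarrow> real" where
  "bcoef \<beta> m = pochhammer \<beta> m / fact m"

definition ccoef :: "real \<Rightarrow> nat \<Rightarrow> real" where
  "ccoef \<beta> k = pochhammer (1 - 2 * \<beta>) k / pochhammer (2 * \<beta>) k"

lemma A0_altdef: "A0 \<beta> m n = bcoef \<beta> m * bcoef \<beta> n * ccoef \<beta> (absdiff m n)"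
  by (simp add: A0_def bcoef_def ccoef_def pochhammer_fact)

lemma B0_altdef: "B0 \<beta> m n = - ((\<beta> + real m) * (\<beta> + real n) * A0 \<beta> m n)"
  by (simp add: B0_def A0_def pochhammer_Suc)

lemma absdiff_commute: "absdiff m n = absdiff n m"
  by (simp add: absdiff_def abs_minus_commute)

lemma A0_commute: "A0 \<beta> m n = A0 \<beta> n m"
  by (simp add: A0_altdef absdiff_commute)

lemma B0_commute: "B0 \<beta> m n = B0 \<beta> n m"
  by (simp add: B0_altdef A0_commute[of \<beta> m n])

text \<open>No convergence is assumed: the two families are summable together or not at all, and in
  the latter case both sums have the same default value. Symmetry is therefore available on the
  edges as well.\<close>

lemma series2_commute:
  assumes "\<And>m n. c m n = c n m"
  shows "series2 c (x, y) = series2 c (y, x)"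
proof -
  have "(\<lambda>m n. c n m) = c" using assms by auto
  then have "\<And>S. (term2 c (y, x) has_sum S) UNIV \<longleftrightarrow> (term2 c (x, y) has_sum S) UNIV"
    using term2_swap[of c y x] by simp
  then show ?thesis
    unfolding series2_def by (metis has_sum_infsum infsumI infsum_not_exists summable_on_def)
qed

lemma F0_commute: "F0 \<beta> (x, y) = F0 \<beta> (y, x)"
  unfolding F0_def by (rule series2_commute) (rule A0_commute)

lemma G0_commute: "G0 \<beta> (x, y) = G0 \<beta> (y, x)"
  unfolding G0_def by (rule series2_commute) (rule B0_commute)

lemma bcoef_pos: "\<beta> > 0 \<Longrightarrow> bcoef \<beta> m > 0"
  by (simp add: bcoef_def pochhammer_pos)

lemma bcoef_Suc: "real (Suc m) * bcoef \<beta> (Suc m) = (\<beta> + real m) * bcoef \<beta> m"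
  by (simp add: bcoef_def pochhammer_Suc del: of_nat_Suc)

text \<open>A crude bound, enough for convergence inside the square. Estimating
  \<open>|1 - 2\<beta> + k|\<close> by \<open>1 + 2\<beta> + k\<close> makes the product of the
  ratios telescope.\<close>

lemma ccoef_bound:
  assumes "\<beta> > 0"
  shows "\<bar>ccoef \<beta> k\<bar> \<le> 1 + real k / (2 * \<beta>)"
proof (induction k)
  case 0
  then show ?case by (simp add: ccoef_def)
next
  case (Suc k)
  have p: "2 * \<beta> + real k > 0" using assms by simp
  have "\<bar>ccoef \<beta> (Suc k)\<bar> = \<bar>ccoef \<beta> k\<bar> * (\<bar>1 - 2 * \<beta> + real k\<bar> / (2 * \<beta> + real k))"
    using p by (simp add: ccoef_def pochhammer_Suc abs_mult abs_divide)
  also have "\<dots> \<le> (1 + real k / (2 * \<beta>)) * ((1 + 2 * \<beta> + real k) / (2 * \<beta> + real k))"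
    using p assms Suc by (intro mult_mono divide_right_mono) auto
  also have "\<dots> = (2 * \<beta> + real k) / (2 * \<beta>) * ((1 + 2 * \<beta> + real k) / (2 * \<beta> + real k))"
    using assms by (simp add: add_divide_distrib)
  also have "\<dots> = (1 + 2 * \<beta> + real k) / (2 * \<beta>)"
    using p by simp
  also have "\<dots> = 1 + real (Suc k) / (2 * \<beta>)"
    using assms by (simp add: field_simps)
  finally show ?case .
qed

lemma summable_times_linear:
  fixes f :: "nat \<Rightarrow> real"
  assumes "\<And>x. \<bar>x\<bar> < 1 \<Longrightarrow> summable (\<lambda>m. f m * x ^ m)" "\<bar>x\<bar> < 1"
  shows "summable (\<lambda>m. (a + b * real m) * f m * x ^ m)"
proof -
  have "summable (\<lambda>m. diffs f m * x ^ m)"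
    by (rule termdiff_converges[where K = 1]) (use assms in auto)
  then have "summable (\<lambda>m. diffs f m * x ^ m * x)" by (rule summable_mult2)
  then have "summable (\<lambda>m. real (Suc m) * f (Suc m) * x ^ Suc m)"
    by (simp add: diffs_def mult_ac)
  then have "summable (\<lambda>m. real m * f m * x ^ m)"
    by (subst (asm) summable_Suc_iff)
  then have "summable (\<lambda>m. a * (f m * x ^ m) + b * (real m * f m * x ^ m))"
    using assms by (intro summable_add summable_mult) auto
  then show ?thesis by (simp add: algebra_simps)
qed

lemma A0_bound:
  assumes "\<beta> > 0"
  shows "\<bar>A0 \<beta> m n\<bar> \<le> ((1 + 1 / (2 * \<beta>) * real m) * bcoef \<beta> m) * ((1 + 1 / (2 * \<beta>) * real n) * bcoef \<beta> n)"
proof -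
  have "\<bar>ccoef \<beta> (absdiff m n)\<bar> \<le> 1 + real (absdiff m n) / (2 * \<beta>)"
    by (rule ccoef_bound[OF assms])
  also have "\<dots> \<le> 1 + real (m + n) / (2 * \<beta>)"
    using assms by (intro add_left_mono divide_right_mono) (auto simp: absdiff_def)
  \<comment> \<open>The extra mixed term is nonnegative; admitting it puts the bound in product
    form.\<close>
  also have "\<dots> \<le> (1 + 1 / (2 * \<beta>) * real m) * (1 + 1 / (2 * \<beta>) * real n)"
    using assms by (simp add: field_simps)
  finally have "bcoef \<beta> m * bcoef \<beta> n * \<bar>ccoef \<beta> (absdiff m n)\<bar> \<le> bcoef \<beta> m * bcoef \<beta> n * \<dots>"
    using bcoef_pos[OF assms] by (intro mult_left_mono) (auto simp: less_imp_le)
  then show ?thesis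
    using bcoef_pos[OF assms] by (simp add: A0_altdef abs_mult abs_of_pos mult_ac)
qed

lemma prod_dominated_A0:
  assumes "\<beta> > 0"
  shows "prod_dominated (A0 \<beta>)"
proof -
  have "summable (\<lambda>m. bcoef \<beta> m * x ^ m)" if "\<bar>x\<bar> < 1" for x
    unfolding bcoef_def using binomial_series_sums[OF that] by (rule sums_summable)
  then have "summable (\<lambda>m. (1 + 1 / (2 * \<beta>) * real m) * bcoef \<beta> m * x ^ m)" if "\<bar>x\<bar> < 1" for x
    using that by (rule summable_times_linear)
  moreover have "0 \<le> (1 + 1 / (2 * \<beta>) * real m) * bcoef \<beta> m" for m
    using assms bcoef_pos[OF assms, of m] by simp
  ultimately show ?thesis
    unfolding prod_dominated_def
    by (intro exI[of _ "\<lambda>m. (1 + 1 / (2 * \<beta>) * real m) * bcoef \<beta> m"] conjI allI A0_bound[OF assms]) auto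
qed

lemma prod_dominated_B0:
  assumes \<beta>: "\<beta> > 0"
  shows "prod_dominated (B0 \<beta>)"
proof -
  obtain g where g: "\<And>m n. \<bar>A0 \<beta> m n\<bar> \<le> g m * g n" "\<And>m. 0 \<le> g m"
    "\<And>x. \<bar>x\<bar> < 1 \<Longrightarrow> summable (\<lambda>m. g m * x ^ m)"
    by (rule prod_dominatedE[OF prod_dominated_A0[OF \<beta>]], blast)
  define g' where "g' m = (\<beta> + 1 * real m) * g m" for m
  have "\<bar>B0 \<beta> m n\<bar> \<le> g' m * g' n" for m n
  proof -
    have "\<bar>B0 \<beta> m n\<bar> = ((\<beta> + real m) * (\<beta> + real n)) * \<bar>A0 \<beta> m n\<bar>"
      using \<beta> by (simp add: B0_altdef abs_mult)
    also have "\<dots> \<le> ((\<beta> + real m) * (\<beta> + real n)) * (g m * g n)"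
      using \<beta> g(1) by (intro mult_left_mono) auto
    finally show ?thesis by (simp add: g'_def mult_ac)
  qed
  moreover have "summable (\<lambda>m. g' m * x ^ m)" if "\<bar>x\<bar> < 1" for x
    unfolding g'_def by (rule summable_times_linear[OF g(3) that])
  moreover have "0 \<le> g' m" for m
    using g(2) \<beta> by (simp add: g'_def)
  ultimately show ?thesis unfolding prod_dominated_def by (intro exI[of _ g']) simp
qed

section \<open>Recurrences and differential equations\<close>

text \<open>Passing from m to m + 1 increases |m - n| on one side of the diagonal and decreases it
  on the other. The signed recurrence is nevertheless the same on both sides, because the parameters
  \<open>1 - 2\<beta>\<close> and \<open>2\<beta>\<close> add up to 1.\<close>

lemma ccoef_rec:
  assumes "\<beta> > 0"
  shows "(real m - real n + 2 * \<beta>) * ccoef \<beta> (absdiff (Suc m) n)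
       = (real m - real n + 1 - 2 * \<beta>) * ccoef \<beta> (absdiff m n)"
proof -
  have S: "(2 * \<beta> + real k) * ccoef \<beta> (Suc k) = (1 - 2 * \<beta> + real k) * ccoef \<beta> k" for k
  proof -
    have "2 * \<beta> + real k \<noteq> 0" using assms by simp
    then show ?thesis by (simp add: ccoef_def pochhammer_Suc)
  qed
  show ?thesis
  proof (cases "n \<le> m")
    case True
    define k where "k = m - n"
    have e: "absdiff (Suc m) n = Suc k" "absdiff m n = k" "real m - real n = real k"
      using True by (auto simp: absdiff_def k_def)
    show ?thesis unfolding e using S[of k] by (simp add: add_ac diff_add_eq)
  next
    case False
    define l where "l = n - Suc m"
    have e: "absdiff (Suc m) n = l" "absdiff m n = Suc l" "real m - real n = - 1 - real l"
      using False by (auto simp: absdiff_def l_def)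
    have "(- 1 - real l + 2 * \<beta>) * ccoef \<beta> l = - ((1 - 2 * \<beta> + real l) * ccoef \<beta> l)"
      by (simp add: algebra_simps)
    also have "\<dots> = - ((2 * \<beta> + real l) * ccoef \<beta> (Suc l))" by (simp only: S)
    finally show ?thesis unfolding e by (simp add: algebra_simps)
  qed
qed

text \<open>The coefficient form of the second-order equation. Since |m - (n - 1)| = |(m + 1) - n|,
  the shifted \<open>B0\<close> involves the same value of \<open>ccoef\<close> as
  \<open>A0 \<beta> (Suc m) n\<close>, and everything becomes a multiple of
  \<open>ccoef_rec\<close>.\<close>

lemma A0_rec1:
  assumes "\<beta> > 0"
  shows "real (Suc m) * (real m + 2 * \<beta>) * A0 \<beta> (Suc m) n
       - (real m * (real m + 1) + \<beta> * (1 - \<beta>)) * A0 \<beta> m n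
       = B0 \<beta> m n - shift2 (B0 \<beta>) m n"
proof -
  have sh: "shift2 (B0 \<beta>) m n = - ((\<beta> + real m) * real n * bcoef \<beta> m * bcoef \<beta> n * ccoef \<beta> (absdiff (Suc m) n))"
  proof (cases n)
    case (Suc n')
    have "absdiff (Suc m) (Suc n') = absdiff m n'" by (simp add: absdiff_def)
    then show ?thesis
      using bcoef_Suc[of n' \<beta>] by (simp add: Suc shift2_def B0_altdef A0_altdef mult_ac)
  qed (simp add: shift2_def)
  have "real (Suc m) * (real m + 2 * \<beta>) * A0 \<beta> (Suc m) n
      = (real m + 2 * \<beta>) * ((\<beta> + real m) * bcoef \<beta> m) * bcoef \<beta> n * ccoef \<beta> (absdiff (Suc m) n)"
    unfolding A0_altdef using bcoef_Suc[of m \<beta>] by (simp add: mult_ac)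
  \<comment> \<open>This factorisation exposes the factor \<open>\<beta> + m\<close>, which all the
    other terms already carry.\<close>
  moreover have "real m * (real m + 1) + \<beta> * (1 - \<beta>) = (\<beta> + real m) * (real m + 1 - \<beta>)"
    by (simp add: algebra_simps)
  moreover have "(\<beta> + real m) * bcoef \<beta> m * bcoef \<beta> n *
      ((real m - real n + 2 * \<beta>) * ccoef \<beta> (absdiff (Suc m) n)
        - (real m - real n + 1 - 2 * \<beta>) * ccoef \<beta> (absdiff m n)) = 0"
    using ccoef_rec[OF assms, of m n] by simp
  ultimately show ?thesis
    unfolding sh B0_altdef A0_altdef[of \<beta> m n] by (simp only:) (simp add: algebra_simps)
qed

text \<open>A diagonal shift leaves |m - n| unchanged, so the shifted \<open>B0\<close> is
  \<open>- m n A0\<close>. What remains is the expansion of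
  \<open>(\<beta> + m) (\<beta> + n) - m n\<close>.\<close>

lemma A0_rec2:
  "(\<beta> * real m + \<beta> * real n + \<beta>\<^sup>2) * A0 \<beta> m n = - B0 \<beta> m n + shift1 (shift2 (B0 \<beta>)) m n"
proof -
  have "shift1 (shift2 (B0 \<beta>)) m n = - (real m * real n * A0 \<beta> m n)"
  proof (cases "m = 0 \<or> n = 0")
    case False
    then obtain m' n' where mn: "m = Suc m'" "n = Suc n'" by (cases m; cases n) auto
    have "absdiff (Suc m') (Suc n') = absdiff m' n'" by (simp add: absdiff_def)
    then show ?thesis
      using bcoef_Suc[of m' \<beta>] bcoef_Suc[of n' \<beta>]
      by (simp add: mn shift1_def shift2_def B0_altdef A0_altdef mult_ac)
         (metis (no_types, opaque_lifting) mult.assoc mult.left_commute)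
  qed (auto simp: shift1_def shift2_def split: nat.splits)
  then show ?thesis
    by (simp add: B0_altdef power2_eq_square algebra_simps)
qed

lemma F0_pde1:
  assumes \<beta>: "\<beta> > 0" and x: "\<bar>x\<bar> < 1" and y: "\<bar>y\<bar> < 1"
  shows "x * (1 - x) * partial1 (partial1 (F0 \<beta>)) (x, y)
         + (2 * \<beta> - 2 * x) * partial1 (F0 \<beta>) (x, y)
         - \<beta> * (1 - \<beta>) * F0 \<beta> (x, y) = (1 - y) * G0 \<beta> (x, y)"
proof -
  let ?A = "A0 \<beta>" and ?B = "B0 \<beta>"
  define F F1 F2 G where "F = F0 \<beta> (x, y)" and "F1 = series2 (d1 ?A) (x, y)"
    and "F2 = series2 (d1 (d1 ?A)) (x, y)" and "G = G0 \<beta> (x, y)"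
  have A: "prod_dominated ?A" and B: "prod_dominated ?B"
    using \<beta> by (rule prod_dominated_A0, rule prod_dominated_B0)
  have hF: "(term2 ?A (x, y) has_sum F) UNIV" and hG: "(term2 ?B (x, y) has_sum G) UNIV"
    unfolding F_def F0_def G_def G0_def using A B x y by (auto intro: series2_has_sum)
  have h1: "(term2 (d1 ?A) (x, y) has_sum F1) UNIV"
    unfolding F1_def using A x y by (intro series2_has_sum prod_dominated_d1)
  have h2: "(term2 (d1 (d1 ?A)) (x, y) has_sum F2) UNIV"
    unfolding F2_def using A x y by (intro series2_has_sum prod_dominated_d1)
  \<comment> \<open>The left side of the equation, assembled as one double series; the next
    \<open>note\<close> does the same for the right side. Once the coefficients agree, uniqueness of
    sums gives the equation.\<close>
  note * = term2_has_sum_add[OF term2_has_sum_add[OF term2_has_sum_add[OF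
      term2_has_sum_add[OF has_sum_shift1[OF h2]
        term2_has_sum_cmult[where a = "-1", OF has_sum_shift1[OF has_sum_shift1[OF h2]]]]
      term2_has_sum_cmult[where a = "2 * \<beta>", OF h1]]
      term2_has_sum_cmult[where a = "-2", OF has_sum_shift1[OF h1]]]
      term2_has_sum_cmult[where a = "- (\<beta> * (1 - \<beta>))", OF hF]]
  note ** = term2_has_sum_add[OF hG term2_has_sum_cmult[where a = "-1", OF has_sum_shift2[OF hG]]]
  have "shift1 (d1 (d1 ?A)) m n + - 1 * shift1 (shift1 (d1 (d1 ?A))) m n + 2 * \<beta> * d1 ?A m n
      + - 2 * shift1 (d1 ?A) m n + - (\<beta> * (1 - \<beta>)) * ?A m n
      = ?B m n + - 1 * shift2 ?B m n" for m n
  proof -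
    have "shift1 (d1 (d1 ?A)) m n = real m * real (Suc m) * ?A (Suc m) n"
      by (cases m) (auto simp: shift1_def d1_def)
    moreover have "shift1 (shift1 (d1 (d1 ?A))) m n = real m * (real m - 1) * ?A m n"
      by (cases m; cases "m - 1") (auto simp: shift1_def d1_def)
    moreover have "shift1 (d1 ?A) m n = real m * ?A m n"
      by (cases m) (auto simp: shift1_def d1_def)
    ultimately show ?thesis
      using A0_rec1[OF \<beta>, of m n] by (simp add: d1_def algebra_simps)
  qed
  with * ** have "x * F2 + - 1 * (x * (x * F2)) + 2 * \<beta> * F1 + - 2 * (x * F1) + - (\<beta> * (1 - \<beta>)) * F
      = G + - 1 * (y * G)"
    using has_sum_unique by (metis (no_types, lifting) ext)
  then show ?thesis
    using partial1_series2[OF A x y, folded F0_def] partial1_partial1_series2[OF A x y, folded F0_def]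
    by (simp add: F_def[symmetric] G_def[symmetric] F1_def[symmetric] F2_def[symmetric]
        algebra_simps)
qed

text \<open>Symmetry moves derivatives in the second variable to the swapped point, so termwise
  differentiation is needed in the first variable only.\<close>

lemma partial2_F0: "partial2 (F0 \<beta>) (x, y) = partial1 (F0 \<beta>) (y, x)"
  unfolding partial1_def partial2_def by (simp add: F0_commute[of \<beta> x])

lemma partial2_partial2_F0: "partial2 (partial2 (F0 \<beta>)) (x, y) = partial1 (partial1 (F0 \<beta>)) (y, x)"
  unfolding partial1_def[of "partial1 _"] partial2_def[of "partial2 _"] by (simp add: partial2_F0)

lemma F0_euler:
  assumes \<beta>: "\<beta> > 0" and x: "\<bar>x\<bar> < 1" and y: "\<bar>y\<bar> < 1"
  shows "\<beta> * x * partial1 (F0 \<beta>) (x, y) + \<beta> * y * partial2 (F0 \<beta>) (x, y)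
         + \<beta>\<^sup>2 * F0 \<beta> (x, y) = - (1 - x * y) * G0 \<beta> (x, y)"
proof -
  let ?A = "A0 \<beta>" and ?B = "B0 \<beta>"
  define F F1 F2 G where "F = F0 \<beta> (x, y)" and "F1 = series2 (d1 ?A) (x, y)"
    and "F2 = series2 (d1 ?A) (y, x)" and "G = G0 \<beta> (x, y)"
  have A: "prod_dominated ?A" and B: "prod_dominated ?B"
    using \<beta> by (rule prod_dominated_A0, rule prod_dominated_B0)
  have hF: "(term2 ?A (x, y) has_sum F) UNIV" and hG: "(term2 ?B (x, y) has_sum G) UNIV"
    unfolding F_def F0_def G_def G0_def using A B x y by (auto intro: series2_has_sum)
  have h1: "(term2 (d1 ?A) (x, y) has_sum F1) UNIV"
    unfolding F1_def using A x y by (intro series2_has_sum prod_dominated_d1)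
  have "(term2 (d1 ?A) (y, x) has_sum F2) UNIV"
    unfolding F2_def using A x y by (intro series2_has_sum prod_dominated_d1)
  then have h2: "(term2 (\<lambda>m n. d1 ?A n m) (x, y) has_sum F2) UNIV"
    by (rule iffD2[OF term2_swap])
  note * = term2_has_sum_add[OF term2_has_sum_add[OF
      term2_has_sum_cmult[where a = \<beta>, OF has_sum_shift1[OF h1]]
      term2_has_sum_cmult[where a = \<beta>, OF has_sum_shift2[OF h2]]]
      term2_has_sum_cmult[where a = "\<beta>\<^sup>2", OF hF]]
  note ** = term2_has_sum_add[OF term2_has_sum_cmult[where a = "-1", OF hG] has_sum_shift1[OF has_sum_shift2[OF hG]]]
  have "\<beta> * shift1 (d1 ?A) m n + \<beta> * shift2 (\<lambda>m n. d1 ?A n m) m n + \<beta>\<^sup>2 * ?A m n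
      = - 1 * ?B m n + shift1 (shift2 ?B) m n" for m n
  proof -
    have "shift1 (d1 ?A) m n = real m * ?A m n"
      by (cases m) (auto simp: shift1_def d1_def)
    moreover have "shift2 (\<lambda>m n. d1 ?A n m) m n = real n * ?A m n"
      by (cases n) (auto simp: shift2_def d1_def A0_commute)
    ultimately show ?thesis
      using A0_rec2[of \<beta> m n] by (simp add: algebra_simps)
  qed
  with * ** have "\<beta> * (x * F1) + \<beta> * (y * F2) + \<beta>\<^sup>2 * F = - 1 * G + x * (y * G)"
    using has_sum_unique by (metis (no_types, lifting) ext)
  then show ?thesis
    using partial1_series2[OF A x y, folded F0_def] partial1_series2[OF A y x, folded F0_def]
    by (simp add: F_def[symmetric] G_def[symmetric] F1_def[symmetric] F2_def[symmetric] partial2_F0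
        algebra_simps)
qed

section \<open>The Horn function\<close>

text \<open>The two indices are opposite, so one factor is \<open>(1 - 2\<beta>)_k\<close> and the
  other, of index -k, is \<open>(-1)^k / (2\<beta>)_k\<close>, where k = |m - n|. Since k and m + n
  have the same parity, the sign can be absorbed by negating both arguments of the Horn
  function.\<close>

lemma poch_int_pair:
  assumes "\<beta> > 0"
  shows "poch_int (1 - 2 * \<beta>) (int n - int m) * poch_int (1 - 2 * \<beta>) (int m - int n)
       = (-1) ^ (m + n) * ccoef \<beta> (absdiff m n)"
proof -
  have neg: "(\<Prod>i=1..k. inverse (1 - 2 * \<beta> - real i)) = (-1) ^ k / pochhammer (2 * \<beta>) k" for k
  proof (induction k)
    case (Suc k)
    have "inverse (1 - 2 * \<beta> - real (Suc k)) = - 1 / (2 * \<beta> + real k)"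
    proof -
      have "1 - 2 * \<beta> - real (Suc k) = - (2 * \<beta> + real k)" by simp
      then show ?thesis by (simp only: inverse_minus_eq) (simp add: divide_inverse)
    qed
    then show ?case
      using Suc by (simp add: pochhammer_Suc del: of_nat_Suc)
  qed simp
  have "poch_int (1 - 2 * \<beta>) (int k) * poch_int (1 - 2 * \<beta>) (- int k) = (-1) ^ k * ccoef \<beta> k" for k
    by (cases "k = 0") (auto simp: poch_int_def neg[unfolded One_nat_def] ccoef_def)
  note * = this
  have sgn: "(-1) ^ (m + (m + k)) = ((-1) ^ k :: real)" for m k
    by (simp add: power_add flip: mult.assoc power_mult_distrib)
  show ?thesis
  proof (cases "m \<le> n")
    case True
    then obtain k where n: "n = m + k" using le_Suc_ex by blast
    have "int n - int m = int k" "int m - int n = - int k" "absdiff m n = k"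
      by (auto simp: n absdiff_def)
    with *[of k] show ?thesis by (simp only: n sgn)
  next
    case False
    then obtain k where m: "m = n + k" using le_Suc_ex nat_le_linear by blast
    have "int n - int m = - int k" "int m - int n = int k" "absdiff m n = k"
      by (auto simp: m absdiff_def)
    with *[of k] show ?thesis by (simp only: m sgn mult.commute[of "poch_int _ (- int k)"] add.commute[of "n + k"])
  qed
qed

lemma F0_eq_horn:
  assumes "\<beta> > 0"
  shows "F0 \<beta> (x, y) = horn_G2 \<beta> \<beta> (1 - 2 * \<beta>) (1 - 2 * \<beta>) (- x) (- y)"
  unfolding F0_def series2_def horn_G2_def
proof (rule infsum_cong)
  fix k :: "nat \<times> nat"
  obtain m n where k: "k = (m, n)" by fastforce
  have s: "(- x) ^ m * (- y) ^ n = (-1) ^ (m + n) * (x ^ m * y ^ n)"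
    by (simp add: power_minus[of x] power_minus[of y] power_add)
  have sq: "(-1) ^ (m + n) * (-1) ^ (m + n) = (1::real)"
    by (simp flip: power_add mult_2)
  have eq: "pochhammer \<beta> m * pochhammer \<beta> n *
     poch_int (1 - 2 * \<beta>) (int n - int m) * poch_int (1 - 2 * \<beta>) (int m - int n) * ((- x) ^ m * (- y) ^ n)
     = pochhammer \<beta> m * pochhammer \<beta> n * ((-1) ^ (m + n) * (-1) ^ (m + n)) * ccoef \<beta> (absdiff m n) * (x ^ m * y ^ n)"
    using poch_int_pair[OF assms, of n m] unfolding s by (simp only: mult_ac)
  show "term2 (A0 \<beta>) (x, y) k = (case k of (m, n) \<Rightarrow> pochhammer \<beta> m * pochhammer \<beta> n *
     poch_int (1 - 2 * \<beta>) (int n - int m) * poch_int (1 - 2 * \<beta>) (int m - int n) * ((- x) ^ m * (- y) ^ n)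
      / (fact m * fact n))"
    unfolding k prod.case eq[unfolded sq] by (simp add: term2_simp A0_altdef bcoef_def)
qed


subsection \<open>Integral representation and positivity\<close>

text \<open>The purpose is to confine the dependence on n to
  \<open>(1 - 2\<beta> - j)_n / (2\<beta>)_n\<close>, which makes the sum over n an Euler integral.
  On either side of the diagonal \<open>ccoef\<close> equals \<open>(1 - 2\<beta> - n)_m (1 -
  2\<beta> - m)_n / ((2\<beta>)_m (2\<beta>)_n)\<close>. This is what Chu-Vandermonde gives for
  \<open>a = 4\<beta> - 1\<close> and \<open>c = 2\<beta> - n\<close>, up to the common
  denominator.\<close>

lemma ccoef_expansion:
  assumes \<beta>: "\<beta> > 0"
  shows "ccoef \<beta> (absdiff m n) =
    (\<Sum>j\<le>m. real (m choose j) * (- 1) ^ j * pochhammer (4 * \<beta> - 1) j / pochhammer (2 * \<beta>) j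
       * pochhammer (1 - 2 * \<beta> - real j) n) / pochhammer (2 * \<beta>) n"
proof -
  define x where "x = 2 * \<beta>"
  have x: "x > 0" using \<beta> by (simp add: x_def)
  have pp: "pochhammer x k > 0" for k using x by (rule pochhammer_pos)
  have rx: "rGamma x \<noteq> 0" using x by (auto simp: rGamma_eq_zero_iff elim!: nonpos_Ints_cases)
  have refl: "pochhammer (1 - x - real j) n = (- 1) ^ n * pochhammer (x + real j - real n) n" for j n
  proof -
    have "1 - (x + real j - real n) - real n = 1 - x - real j" by simp
    then show ?thesis using pochhammer_reflect[of "x + real j - real n" n] by metis
  qed
  \<comment> \<open>Reflection brings the reciprocal Gamma factors of the Vandermonde sum into the
    required Pochhammer form; j = m also covers its right-hand side.\<close>
  have rG: "rGamma (x - real n + real j) = (- 1) ^ n * rGamma x * (pochhammer (1 - x - real j) n / pochhammer x j)" for j n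
  proof -
    have "rGamma x = pochhammer x j * rGamma (x + real j)" by (rule pochhammer_rGamma)
    then have "rGamma (x + real j) = rGamma x / pochhammer x j" using pp[of j] by (simp add: field_simps)
    moreover have "rGamma (x + real j - real n) = pochhammer (x + real j - real n) n * rGamma (x + real j)"
      using pochhammer_rGamma[of "x + real j - real n" n] by simp
    moreover have "(- 1) ^ n * (- 1) ^ n = (1 :: real)" by (simp flip: power_add mult_2)
    ultimately show ?thesis
      unfolding refl by (simp add: algebra_simps)
  qed
  have "rGamma x * (\<Sum>j\<le>m. real (m choose j) * (- 1) ^ j * pochhammer (2 * x - 1) j / pochhammer x j
       * pochhammer (1 - x - real j) n) * (- 1) ^ n
     = (\<Sum>j\<le>m. real (m choose j) * (- 1) ^ j * pochhammer (2 * x - 1) j * rGamma (x - real n + real j))"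
    unfolding rG sum_distrib_left sum_distrib_right by (intro sum.cong) (auto simp: mult_ac)
  also have "\<dots> = pochhammer (x - real n - (2 * x - 1)) m * rGamma (x - real n + real m)"
    by (rule vandermonde_rGamma)
  also have "x - real n - (2 * x - 1) = 1 - x - real n" by simp
  also have "pochhammer (1 - x - real n) m * rGamma (x - real n + real m) = rGamma x *
      (pochhammer (1 - x - real n) m * pochhammer (1 - x - real m) n / pochhammer x m) * (- 1) ^ n"
    unfolding rG by (simp add: mult_ac)
  finally have S: "(\<Sum>j\<le>m. real (m choose j) * (- 1) ^ j * pochhammer (2 * x - 1) j / pochhammer x j
       * pochhammer (1 - x - real j) n)
     = pochhammer (1 - x - real n) m * pochhammer (1 - x - real m) n / pochhammer x m"
    by (metis (no_types, lifting) rx mult.assoc mult_right_cancel mult_left_cancel power_not_zero zero_neq_neg_one)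
  \<comment> \<open>Stated for a smaller index n and a larger index n + k. The target is symmetric
    in the two indices, so this serves both sides of the diagonal.\<close>
  have main: "pochhammer (1 - x - real n) (n + k) * pochhammer (1 - x - real (n + k)) n
      = pochhammer (1 - x) k / pochhammer x k * pochhammer x n * pochhammer x (n + k)" for n k
  proof -
    have 1: "pochhammer (1 - x - real n) (n + k) = (- 1) ^ n * pochhammer x n * pochhammer (1 - x) k"
      by (subst pochhammer_product'[of _ n k]) (simp add: pochhammer_reflect)
    have "pochhammer (1 - x - real (n + k)) n = (- 1) ^ n * pochhammer (x + real k) n"
      using refl[of "n + k" n] by simp
    moreover have "pochhammer x (n + k) = pochhammer x k * pochhammer (x + real k) n"
      using pochhammer_product'[of x k n] by (simp add: add.commute)
    moreover have "(- 1) ^ n * (- 1) ^ n = (1 :: real)" by (simp flip: power_add mult_2)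
    ultimately show ?thesis
      using 1 pp[of k] by simp
  qed
  have "ccoef \<beta> (absdiff m n) * pochhammer x n * pochhammer x m
      = pochhammer (1 - x - real n) m * pochhammer (1 - x - real m) n"
  proof (cases "n \<le> m")
    case True
    then obtain k where m: "m = n + k" using le_Suc_ex by blast
    then have "absdiff m n = k" by (simp add: absdiff_def)
    then show ?thesis using main[of n k] by (simp add: m ccoef_def x_def)
  next
    case False
    then obtain k where n: "n = m + k" using le_Suc_ex nat_le_linear by blast
    then have "absdiff m n = k" by (simp add: absdiff_def)
    then show ?thesis using main[of m k] by (simp add: n ccoef_def x_def mult_ac)
  qed
  then have "ccoef \<beta> (absdiff m n) = (pochhammer (1 - x - real n) m * pochhammer (1 - x - real m) n / pochhammer x m)
       / pochhammer x n"
    using pp[of m] pp[of n] by (simp add: field_simps)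
  then show ?thesis
    unfolding S[symmetric] by (simp add: x_def)
qed

text \<open>Summability is left as a hypothesis: inside the square it is automatic, while at y = 1
  it will come from \<beta> > 1/3.\<close>

lemma A0_row_sums:
  assumes \<beta>: "\<beta> > 0" and y: "\<bar>y\<bar> \<le> 1"
    and s: "\<And>j. summable (\<lambda>n. \<bar>pochhammer (1 - 2 * \<beta> - real j) n / fact n\<bar>
         * (pochhammer \<beta> n / pochhammer (2 * \<beta>) n) * \<bar>y\<bar> ^ n)"
  shows "(\<lambda>n. A0 \<beta> m n * y ^ n) sums (bcoef \<beta> m *
     (\<Sum>j\<le>m. real (m choose j) * (- 1) ^ j * pochhammer (4 * \<beta> - 1) j / pochhammer (2 * \<beta>) j
       * (\<integral>t. (1 - t * y) powr (2 * \<beta> - 1 + real j) \<partial>beta_measure \<beta>)))"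
proof -
  let ?k = "\<lambda>j. real (m choose j) * (- 1) ^ j * pochhammer (4 * \<beta> - 1) j / pochhammer (2 * \<beta>) j"
  have "(\<lambda>n. pochhammer (1 - 2 * \<beta> - real j) n / fact n * (pochhammer \<beta> n / pochhammer (2 * \<beta>) n) * y ^ n)
      sums (\<integral>t. (1 - t * y) powr (2 * \<beta> - 1 + real j) \<partial>beta_measure \<beta>)" for j
    using euler_integral(2)[OF \<beta> y s[of j]] by (simp add: algebra_simps)
  then have "(\<lambda>n. bcoef \<beta> m * (\<Sum>j\<le>m. ?k j * (pochhammer (1 - 2 * \<beta> - real j) n / fact n *
        (pochhammer \<beta> n / pochhammer (2 * \<beta>) n) * y ^ n)))
      sums (bcoef \<beta> m * (\<Sum>j\<le>m. ?k j * (\<integral>t. (1 - t * y) powr (2 * \<beta> - 1 + real j) \<partial>beta_measure \<beta>)))"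
    by (intro sums_mult sums_sum)
  moreover have "bcoef \<beta> m * (\<Sum>j\<le>m. ?k j * (pochhammer (1 - 2 * \<beta> - real j) n / fact n *
        (pochhammer \<beta> n / pochhammer (2 * \<beta>) n) * y ^ n)) = A0 \<beta> m n * y ^ n" for n
    unfolding A0_altdef ccoef_expansion[OF \<beta>] bcoef_def[of \<beta> n] sum_distrib_left sum_distrib_right sum_divide_distrib
    by (intro sum.cong) (auto simp: mult_ac)
  ultimately show ?thesis by simp
qed

section \<open>Generating function of the row polynomials\<close>

text \<open>The terminating series \<open>2F1(-m, 4\<beta> - 1; 2\<beta>; w)\<close>.\<close>

definition jpoly :: "real \<Rightarrow> nat \<Rightarrow> real \<Rightarrow> real" where
  "jpoly \<beta> m w = (\<Sum>j\<le>m. real (m choose j) * (- 1) ^ j * pochhammer (4 * \<beta> - 1) j / pochhammer (2 * \<beta>) j * w ^ j)"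

lemma A0_row_sums_jpoly:
  assumes \<beta>: "\<beta> > 0" and y: "\<bar>y\<bar> < 1"
  shows "(\<lambda>n. A0 \<beta> m n * y ^ n) sums
     (\<integral>t. (1 - t * y) powr (2 * \<beta> - 1) * (bcoef \<beta> m * jpoly \<beta> m (1 - t * y)) \<partial>beta_measure \<beta>)"
proof -
  let ?k = "\<lambda>j. real (m choose j) * (- 1) ^ j * pochhammer (4 * \<beta> - 1) j / pochhammer (2 * \<beta>) j"
  have s: "summable (\<lambda>n. \<bar>pochhammer (1 - 2 * \<beta> - real j) n / fact n\<bar>
         * (pochhammer \<beta> n / pochhammer (2 * \<beta>) n) * \<bar>y\<bar> ^ n)" for j
    by (rule euler_summable[OF \<beta> y])
  have int: "integrable (beta_measure \<beta>) (\<lambda>t. (1 - t * y) powr (2 * \<beta> - 1 + real j))" for j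
    using euler_integral(1)[OF \<beta> _ s[of j]] y by (simp add: algebra_simps)
  have "bcoef \<beta> m * (\<Sum>j\<le>m. ?k j * (\<integral>t. (1 - t * y) powr (2 * \<beta> - 1 + real j) \<partial>beta_measure \<beta>))
      = (\<integral>t. bcoef \<beta> m * (\<Sum>j\<le>m. ?k j * (1 - t * y) powr (2 * \<beta> - 1 + real j)) \<partial>beta_measure \<beta>)"
    using int by (simp add: Bochner_Integration.integral_sum)
  also have "\<dots> = (\<integral>t. (1 - t * y) powr (2 * \<beta> - 1) * (bcoef \<beta> m * jpoly \<beta> m (1 - t * y)) \<partial>beta_measure \<beta>)"
  proof (rule beta_measure_integral_cong)
    fix t :: real assume t: "0 < t" "t < 1"
    have "\<bar>t * y\<bar> < 1" using abs_mult_less[of t 1 y 1] t y by (simp add: abs_mult)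
    then have "1 - t * y > 0" by simp
    then show "bcoef \<beta> m * (\<Sum>j\<le>m. ?k j * (1 - t * y) powr (2 * \<beta> - 1 + real j))
        = (1 - t * y) powr (2 * \<beta> - 1) * (bcoef \<beta> m * jpoly \<beta> m (1 - t * y))"
      by (simp add: jpoly_def powr_add powr_realpow sum_distrib_left mult_ac)
  qed (unfold jpoly_def, measurable)
  finally show ?thesis
    using A0_row_sums[OF \<beta> _ s, of m] y by simp
qed

text \<open>The coefficient of \<open>x^m\<close> in
  \<open>(1 - xv)^(-a) (1 - x)^(-a')\<close>.\<close>

definition qpoly :: "real \<Rightarrow> real \<Rightarrow> nat \<Rightarrow> real \<Rightarrow> real" where
  "qpoly a' a m v = (\<Sum>j\<le>m. (pochhammer a j / fact j * v ^ j) * (pochhammer a' (m - j) / fact (m - j)))"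

lemma qpoly_sums:
  assumes x: "\<bar>x\<bar> < 1" and v: "\<bar>v\<bar> \<le> 1"
  shows "(\<lambda>m. qpoly a' a m v * x ^ m) sums ((1 - x * v) powr (- a) * (1 - x) powr (- a'))"
proof -
  have xv: "\<bar>x * v\<bar> < 1"
    using x v by (metis abs_ge_zero abs_mult le_less_trans mult.right_neutral mult_left_mono)
  have "summable (\<lambda>n. norm (pochhammer a n / fact n * (x * v) ^ n))"
    using binomial_series_abs_summable[OF xv, of a] by (simp add: abs_mult power_abs)
  moreover have "summable (\<lambda>n. norm (pochhammer a' n / fact n * x ^ n))"
    using binomial_series_abs_summable[OF x, of a'] by (simp add: abs_mult power_abs)
  ultimately have "(\<lambda>m. \<Sum>j\<le>m. (pochhammer a j / fact j * (x * v) ^ j) * (pochhammer a' (m - j) / fact (m - j) * x ^ (m - j)))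
      sums ((\<Sum>n. pochhammer a n / fact n * (x * v) ^ n) * (\<Sum>n. pochhammer a' n / fact n * x ^ n))"
    by (rule Cauchy_product_sums)
  also have "(\<Sum>n. pochhammer a n / fact n * (x * v) ^ n) = (1 - x * v) powr (- a)"
    using binomial_series_sums[OF xv, of a] by (simp add: sums_iff)
  also have "(\<Sum>n. pochhammer a' n / fact n * x ^ n) = (1 - x) powr (- a')"
    using binomial_series_sums[OF x, of a'] by (simp add: sums_iff)
  also have "(\<lambda>m. \<Sum>j\<le>m. (pochhammer a j / fact j * (x * v) ^ j) * (pochhammer a' (m - j) / fact (m - j) * x ^ (m - j)))
      = (\<lambda>m. qpoly a' a m v * x ^ m)"
  proof
    fix m
    have "x ^ j * x ^ (m - j) = x ^ m" if "j \<le> m" for j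
      using that by (simp flip: power_add)
    then show "(\<Sum>j\<le>m. (pochhammer a j / fact j * (x * v) ^ j) * (pochhammer a' (m - j) / fact (m - j) * x ^ (m - j)))
        = qpoly a' a m v * x ^ m"
      unfolding qpoly_def sum_distrib_right
      by (intro sum.cong) (auto simp: power_mult_distrib mult_ac)
  qed
  finally show ?thesis .
qed

text \<open>The Cauchy product of the absolute coefficients. It bounds \<open>qpoly\<close>
  uniformly for |v| at most 1 and still gives a power series convergent for |x| < 1.\<close>

definition qbound :: "real \<Rightarrow> real \<Rightarrow> nat \<Rightarrow> real" where
  "qbound a' a m = (\<Sum>j\<le>m. \<bar>pochhammer a j / fact j\<bar> * \<bar>pochhammer a' (m - j) / fact (m - j)\<bar>)"

lemma qpoly_bound: "\<bar>v\<bar> \<le> 1 \<Longrightarrow> \<bar>qpoly a' a m v\<bar> \<le> qbound a' a m"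
  unfolding qpoly_def qbound_def
proof (intro order.trans[OF sum_abs] sum_mono)
  fix j assume v: "\<bar>v\<bar> \<le> 1"
  have "\<bar>pochhammer a j / fact j\<bar> * \<bar>v\<bar> ^ j \<le> \<bar>pochhammer a j / fact j\<bar>"
    using v by (intro mult_left_le power_le_one) auto
  then show "\<bar>pochhammer a j / fact j * v ^ j * (pochhammer a' (m - j) / fact (m - j))\<bar>
      \<le> \<bar>pochhammer a j / fact j\<bar> * \<bar>pochhammer a' (m - j) / fact (m - j)\<bar>"
    unfolding abs_mult[of _ "pochhammer a' (m - j) / fact (m - j)"] abs_mult[of _ "v ^ j"] power_abs
    by (rule mult_right_mono) simp
qed

lemma qbound_summable:
  assumes x: "\<bar>x\<bar> < 1"
  shows "summable (\<lambda>m. qbound a' a m * \<bar>x\<bar> ^ m)"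
proof -
  have "summable (\<lambda>m. \<Sum>j\<le>m. (\<bar>pochhammer a j / fact j\<bar> * \<bar>x\<bar> ^ j) * (\<bar>pochhammer a' (m - j) / fact (m - j)\<bar> * \<bar>x\<bar> ^ (m - j)))"
    using binomial_series_abs_summable[OF x]
    by (intro summable_Cauchy_product) (auto simp: abs_mult)
  also have "(\<lambda>m. \<Sum>j\<le>m. (\<bar>pochhammer a j / fact j\<bar> * \<bar>x\<bar> ^ j) * (\<bar>pochhammer a' (m - j) / fact (m - j)\<bar> * \<bar>x\<bar> ^ (m - j)))
      = (\<lambda>m. qbound a' a m * \<bar>x\<bar> ^ m)"
  proof
    fix m
    have "\<bar>x\<bar> ^ j * \<bar>x\<bar> ^ (m - j) = \<bar>x\<bar> ^ m" if "j \<le> m" for j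
      using that by (simp flip: power_add)
    then show "(\<Sum>j\<le>m. (\<bar>pochhammer a j / fact j\<bar> * \<bar>x\<bar> ^ j) * (\<bar>pochhammer a' (m - j) / fact (m - j)\<bar> * \<bar>x\<bar> ^ (m - j)))
      = qbound a' a m * \<bar>x\<bar> ^ m"
      unfolding qbound_def sum_distrib_right
      by (intro sum.cong) (auto simp: mult_ac)
  qed
  finally show ?thesis .
qed

text \<open>On generating functions this is \<open>(1 - x + xz)^(-a) (1 - x)^(-a')\<close> expanded
  in powers of \<open>xz / (1 - x)\<close>. Comparing coefficients of \<open>x^m\<close> by finite
  sums avoids any restriction on the size of that quotient; the inner sum is the binomial theorem
  for rising factorials.\<close>

lemma qpoly_one_minus:
  "qpoly a' a m (1 - z) = (\<Sum>i\<le>m. (- 1) ^ i * (pochhammer a i / fact i) *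
     (pochhammer (a + a' + real i) (m - i) / fact (m - i)) * z ^ i)"
proof -
  define h where "h j i = (- 1) ^ i * (pochhammer a j / fact j) * real (j choose i) * z ^ i * (pochhammer a' (m - j) / fact (m - j))" for i j
  have "qpoly a' a m (1 - z) = (\<Sum>j\<le>m. \<Sum>i\<le>j. h j i)"
    unfolding qpoly_def
  proof (rule sum.cong)
    fix j
    have "(1 - z) ^ j = (- z + 1) ^ j" by simp
    also have "\<dots> = (\<Sum>i\<le>j. real (j choose i) * (- z) ^ i)"
      by (subst binomial_ring) simp
    finally show "(pochhammer a j / fact j * (1 - z) ^ j) * (pochhammer a' (m - j) / fact (m - j)) = (\<Sum>i\<le>j. h j i)"
      unfolding h_def by (simp add: sum_distrib_left sum_distrib_right power_minus[of z] mult_ac)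
  qed simp
  also have "\<dots> = (\<Sum>i\<le>m. \<Sum>j\<in>{i..m}. h j i)"
    unfolding sum.Sigma[OF finite_atMost ballI[OF finite_atMost]] sum.Sigma[OF finite_atMost ballI[OF finite_atLeastAtMost]]
    by (rule sum.reindex_bij_witness[of _ "\<lambda>(i, j). (j, i)" "\<lambda>(j, i). (i, j)"]) auto
  also have "\<dots> = (\<Sum>i\<le>m. (- 1) ^ i * (pochhammer a i / fact i) *
     (pochhammer (a + a' + real i) (m - i) / fact (m - i)) * z ^ i)"
  proof (rule sum.cong)
    fix i assume "i \<in> {..m}"
    then have i: "i \<le> m" by simp
    have "(\<Sum>j\<in>{i..m}. h j i) = (\<Sum>k\<le>m - i. h (i + k) i)"
      using i by (intro sum.reindex_bij_witness[of _ "\<lambda>k. i + k" "\<lambda>j. j - i"]) auto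
    also have "\<dots> = (\<Sum>k\<le>m - i. (- 1) ^ i * (pochhammer a i / fact i) * z ^ i / fact (m - i) *
        (real (m - i choose k) * pochhammer (a + real i) k * pochhammer a' (m - i - k)))"
    proof (rule sum.cong)
      fix k assume "k \<in> {..m - i}"
      then have k: "k \<le> m - i" by simp
      have 1: "real (i + k choose i) = fact (i + k) / (fact i * fact k)"
        by (subst binomial_fact) auto
      have 2: "real (m - i choose k) = fact (m - i) / (fact k * fact (m - i - k))"
        using k by (subst binomial_fact) auto
      have 3: "pochhammer a (i + k) = pochhammer a i * pochhammer (a + real i) k"
        by (rule pochhammer_product')
      have 4: "m - (i + k) = m - i - k" by simp
      show "h (i + k) i = (- 1) ^ i * (pochhammer a i / fact i) * z ^ i / fact (m - i) *
        (real (m - i choose k) * pochhammer (a + real i) k * pochhammer a' (m - i - k))"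
        unfolding h_def 1 2 3 4 by (simp add: mult_ac)
    qed simp
    also have "\<dots> = (- 1) ^ i * (pochhammer a i / fact i) * z ^ i / fact (m - i) * pochhammer (a + real i + a') (m - i)"
      unfolding pochhammer_binomial_sum[of "a + real i" a'] by (simp add: sum_distrib_left)
    finally show "(\<Sum>j\<in>{i..m}. h j i) = (- 1) ^ i * (pochhammer a i / fact i) *
     (pochhammer (a + a' + real i) (m - i) / fact (m - i)) * z ^ i"
      by (simp add: add_ac mult_ac)
  qed simp
  finally show ?thesis .
qed

text \<open>The exponents are chosen so that \<open>a + a' = \<beta>\<close>: then
  \<open>(\<beta>)_i\<close> from the i-th moment of s and \<open>(\<beta> + i)_(m - i)\<close> from
  \<open>qpoly_one_minus\<close> combine to \<open>(\<beta>)_m\<close>. The alternating polynomial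
  in w is thereby an average of \<open>qpoly\<close> over arguments in [-1, 1], for w in [0, 2], and
  inherits its bound.\<close>

lemma bcoef_jpoly_eq:
  assumes \<beta>: "\<beta> > 0"
  shows "(\<integral>s. qpoly (1 - 3 * \<beta>) (4 * \<beta> - 1) m (1 - s * w) \<partial>beta_measure \<beta>) = bcoef \<beta> m * jpoly \<beta> m w"
proof -
  let ?k = "\<lambda>i. (- 1) ^ i * (pochhammer (4 * \<beta> - 1) i / fact i) * (pochhammer (\<beta> + real i) (m - i) / fact (m - i)) * w ^ i"
  have mom: "integrable (beta_measure \<beta>) (\<lambda>s. s ^ i)"
    "(\<integral>s. s ^ i \<partial>beta_measure \<beta>) = pochhammer \<beta> i / pochhammer (2 * \<beta>) i" for i
    using beta_measure_power_moment[OF \<beta>, of i] by (auto simp: has_bochner_integral_iff)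
  have "qpoly (1 - 3 * \<beta>) (4 * \<beta> - 1) m (1 - s * w) = (\<Sum>i\<le>m. ?k i * s ^ i)" for s
    unfolding qpoly_one_minus by (intro sum.cong) (auto simp: power_mult_distrib mult_ac)
  then have "(\<integral>s. qpoly (1 - 3 * \<beta>) (4 * \<beta> - 1) m (1 - s * w) \<partial>beta_measure \<beta>)
      = (\<Sum>i\<le>m. ?k i * (pochhammer \<beta> i / pochhammer (2 * \<beta>) i))"
    using mom by (simp add: Bochner_Integration.integral_sum mult_ac)
  also have "\<dots> = bcoef \<beta> m * jpoly \<beta> m w"
    unfolding bcoef_def jpoly_def sum_distrib_left
  proof (rule sum.cong)
    fix i assume "i \<in> {..m}"
    then have i: "i \<le> m" by simp
    have "pochhammer \<beta> m = pochhammer \<beta> i * pochhammer (\<beta> + real i) (m - i)"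
      using i by (rule pochhammer_product)
    moreover have "real (m choose i) = fact m / (fact i * fact (m - i))"
      using i by (rule binomial_fact)
    ultimately show "?k i * (pochhammer \<beta> i / pochhammer (2 * \<beta>) i) = pochhammer \<beta> m / fact m *
        (real (m choose i) * (- 1) ^ i * pochhammer (4 * \<beta> - 1) i / pochhammer (2 * \<beta>) i * w ^ i)"
      by simp
  qed simp
  finally show ?thesis .
qed

lemma powr_ge_min:
  fixes z l u a :: real
  assumes "0 < l" "l \<le> z" "z \<le> u"
  shows "min (l powr a) (u powr a) \<le> z powr a"
proof (cases "a \<ge> 0")
  case True
  then have "l powr a \<le> z powr a" using assms by (intro powr_mono2) auto
  then show ?thesis by simp
next
  case False
  then have "u powr a \<le> z powr a" using assms by (intro powr_mono2') auto
  then show ?thesis by simp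
qed

lemma powr_le_max:
  fixes z l u a :: real
  assumes "0 < l" "l \<le> z" "z \<le> u"
  shows "z powr a \<le> max (l powr a) (u powr a)"
proof (cases "a \<ge> 0")
  case True
  then have "z powr a \<le> u powr a" using assms by (intro powr_mono2) auto
  then show ?thesis by simp
next
  case False
  then have "z powr a \<le> l powr a" using assms by (intro powr_mono2') auto
  then show ?thesis by simp
qed

text \<open>The value at x of the power series with coefficients
  \<open>bcoef \<beta> m * jpoly \<beta> m w\<close>. Formally it is \<open>(1 - x)^(-\<beta>)
  2F1(4\<beta> - 1, \<beta>; 2\<beta>; -xw / (1 - x))\<close>.\<close>

definition inner_integral :: "real \<Rightarrow> real \<Rightarrow> real \<Rightarrow> real" where
  "inner_integral \<beta> x w =
     (\<integral>s. (1 - x * (1 - s * w)) powr (1 - 4 * \<beta>) * (1 - x) powr (3 * \<beta> - 1) \<partial>beta_measure \<beta>)"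

lemma inner_integral_measurable [measurable]:
  assumes "\<beta> > 0" "f \<in> borel_measurable borel"
  shows "(\<lambda>t. inner_integral \<beta> x (f t)) \<in> borel_measurable borel"
proof -
  interpret finite_measure "beta_measure \<beta>" by (rule beta_measure_finite[OF assms(1)])
  note [measurable] = assms(2)
  show ?thesis unfolding inner_integral_def by measurable
qed

lemma one_minus_bounds:
  fixes s w :: real
  assumes "0 < s" "s < 1" "0 \<le> w" "w \<le> 2"
  shows "\<bar>1 - s * w\<bar> \<le> 1"
proof -
  have "s * w \<le> 1 * 2" using assms by (intro mult_mono) auto
  moreover have "0 \<le> s * w" using assms by simp
  ultimately show ?thesis by simp
qed

text \<open>The range [0, 2] is that of \<open>1 - ty\<close> for |y| at most 1. It makes
  \<open>1 - sw\<close> stay in [-1, 1], so \<open>qbound\<close> is a majorant independent of both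
  s and w and can be reused when the series is integrated over t.\<close>

lemma inner_integral_sums:
  assumes \<beta>: "\<beta> > 0" and x: "\<bar>x\<bar> < 1" and w: "0 \<le> w" "w \<le> 2"
  shows "(\<lambda>m. bcoef \<beta> m * jpoly \<beta> m w * x ^ m) sums inner_integral \<beta> x w"
    and "\<bar>bcoef \<beta> m * jpoly \<beta> m w\<bar> \<le> qbound (1 - 3 * \<beta>) (4 * \<beta> - 1) m"
proof -
  let ?q = "qpoly (1 - 3 * \<beta>) (4 * \<beta> - 1)" and ?Q = "qbound (1 - 3 * \<beta>) (4 * \<beta> - 1)"
  have qm: "(\<lambda>s. ?q m (1 - s * w)) \<in> borel_measurable borel" for m
    unfolding qpoly_def by measurable
  have "(\<lambda>m. \<integral>s. ?q m (1 - s * w) * x ^ m \<partial>beta_measure \<beta>) sums inner_integral \<beta> x w"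
    unfolding inner_integral_def
  proof (rule beta_measure_series[OF \<beta>])
    show "summable (\<lambda>m. ?Q m * \<bar>x\<bar> ^ m)" by (rule qbound_summable[OF x])
    fix m and s :: real assume s: "0 < s" "s < 1"
    note v = one_minus_bounds[OF s w]
    show "\<bar>?q m (1 - s * w) * x ^ m\<bar> \<le> ?Q m * \<bar>x\<bar> ^ m"
      using qpoly_bound[OF v] by (simp add: abs_mult power_abs mult_right_mono)
    show "(\<lambda>m. ?q m (1 - s * w) * x ^ m) sums ((1 - x * (1 - s * w)) powr (1 - 4 * \<beta>) * (1 - x) powr (3 * \<beta> - 1))"
      using qpoly_sums[OF x v, of "1 - 3 * \<beta>" "4 * \<beta> - 1"] by simp
  qed (use qm in measurable)
  then show "(\<lambda>m. bcoef \<beta> m * jpoly \<beta> m w * x ^ m) sums inner_integral \<beta> x w"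
    by (simp add: bcoef_jpoly_eq[OF \<beta>])
  show "\<bar>bcoef \<beta> m * jpoly \<beta> m w\<bar> \<le> ?Q m"
    unfolding bcoef_jpoly_eq[OF \<beta>, symmetric]
    by (rule beta_measure_integral_abs_le[OF \<beta> qm qpoly_bound[OF one_minus_bounds]]) (use w in auto)
qed

lemma F0_integral:
  assumes \<beta>: "\<beta> > 0" and x: "\<bar>x\<bar> < 1" and y: "\<bar>y\<bar> < 1"
  shows "F0 \<beta> (x, y) = (\<integral>t. (1 - t * y) powr (2 * \<beta> - 1) * inner_integral \<beta> x (1 - t * y) \<partial>beta_measure \<beta>)"
proof -
  let ?Q = "qbound (1 - 3 * \<beta>) (4 * \<beta> - 1)"
  have ty: "1 - \<bar>y\<bar> \<le> 1 - t * y \<and> 1 - t * y \<le> 1 + \<bar>y\<bar>" if "0 < t" "t < 1" for t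
  proof -
    have "\<bar>t * y\<bar> \<le> \<bar>y\<bar>" using that by (simp add: abs_mult mult_left_le_one_le)
    then show ?thesis by (auto simp: abs_le_iff)
  qed
  have 1: "(\<lambda>m. (\<Sum>\<^sub>\<infinity>n. A0 \<beta> m n * y ^ n) * x ^ m) sums F0 \<beta> (x, y)"
    unfolding F0_def by (intro series2_iterated prod_dominated_summable prod_dominated_A0 \<beta> x y)
  define R where "R m = (\<integral>t. (1 - t * y) powr (2 * \<beta> - 1) * (bcoef \<beta> m * jpoly \<beta> m (1 - t * y)) \<partial>beta_measure \<beta>)" for m
  have row: "(\<Sum>\<^sub>\<infinity>n. A0 \<beta> m n * y ^ n) = R m" for m
  proof -
    \<comment> \<open>Convergence of the row at a slightly larger point upgrades to absolute
      convergence at y, which the unordered sum requires.\<close>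
    obtain z where z: "\<bar>y\<bar> < z" "z < 1" using y dense by blast
    have "summable (\<lambda>n. norm (A0 \<beta> m n * y ^ n))"
      using A0_row_sums_jpoly[OF \<beta>, of z m] z by (intro powser_insidea[of _ z]) (auto simp: sums_iff)
    then have "((\<lambda>n. A0 \<beta> m n * y ^ n) has_sum R m) UNIV"
      unfolding R_def by (intro norm_summable_imp_has_sum A0_row_sums_jpoly[OF \<beta> y])
    then show ?thesis by (rule infsumI)
  qed
  \<comment> \<open>The exponent \<open>2\<beta> - 1\<close> may have either sign, so the extreme
    value can occur at either end of the interval.\<close>
  define K where "K = max ((1 - \<bar>y\<bar>) powr (2 * \<beta> - 1)) ((1 + \<bar>y\<bar>) powr (2 * \<beta> - 1))"
  have K: "\<bar>(1 - t * y) powr (2 * \<beta> - 1)\<bar> \<le> K" if "0 < t" "t < 1" for t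
    using powr_le_max[of "1 - \<bar>y\<bar>" "1 - t * y" "1 + \<bar>y\<bar>" "2 * \<beta> - 1"] ty[OF that] y by (simp add: K_def)
  have jm: "(\<lambda>t. jpoly \<beta> m (1 - t * y)) \<in> borel_measurable borel" for m
    unfolding jpoly_def by measurable
  have "(\<lambda>m. \<integral>t. (1 - t * y) powr (2 * \<beta> - 1) * (bcoef \<beta> m * jpoly \<beta> m (1 - t * y) * x ^ m) \<partial>beta_measure \<beta>)
      sums (\<integral>t. (1 - t * y) powr (2 * \<beta> - 1) * inner_integral \<beta> x (1 - t * y) \<partial>beta_measure \<beta>)"
  proof (rule beta_measure_series[OF \<beta>])
    show "summable (\<lambda>m. K * (?Q m * \<bar>x\<bar> ^ m))"
      by (intro summable_mult qbound_summable[OF x])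
    fix m and t :: real assume t: "0 < t" "t < 1"
    have w: "0 \<le> 1 - t * y" "1 - t * y \<le> 2" using ty[OF t] y by auto
    have "\<bar>bcoef \<beta> m * jpoly \<beta> m (1 - t * y) * x ^ m\<bar> \<le> ?Q m * \<bar>x\<bar> ^ m"
      unfolding abs_mult[of _ "x ^ m"] power_abs
      using inner_integral_sums(2)[OF \<beta> x w] by (intro mult_right_mono) auto
    then show "\<bar>(1 - t * y) powr (2 * \<beta> - 1) * (bcoef \<beta> m * jpoly \<beta> m (1 - t * y) * x ^ m)\<bar> \<le> K * (?Q m * \<bar>x\<bar> ^ m)"
      unfolding abs_mult[of "(1 - t * y) powr (2 * \<beta> - 1)"] using K[OF t] by (intro mult_mono) (auto simp: K_def le_max_iff_disj)
    show "(\<lambda>m. (1 - t * y) powr (2 * \<beta> - 1) * (bcoef \<beta> m * jpoly \<beta> m (1 - t * y) * x ^ m)) sums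
        ((1 - t * y) powr (2 * \<beta> - 1) * inner_integral \<beta> x (1 - t * y))"
      by (intro sums_mult inner_integral_sums(1)[OF \<beta> x w])
  qed (use jm inner_integral_measurable[OF \<beta>] in measurable)
  moreover have "(\<integral>t. (1 - t * y) powr (2 * \<beta> - 1) * (bcoef \<beta> m * jpoly \<beta> m (1 - t * y) * x ^ m) \<partial>beta_measure \<beta>)
      = R m * x ^ m" for m
    unfolding R_def mult.assoc[symmetric] by simp
  ultimately show ?thesis
    using 1 unfolding row by (simp add: sums_iff)
qed

lemma inner_integral_bounds:
  assumes \<beta>: "\<beta> > 0" and x: "\<bar>x\<bar> < 1"
  obtains c d where "c > 0" "\<And>w. 0 \<le> w \<Longrightarrow> w \<le> 2 \<Longrightarrow> c \<le> inner_integral \<beta> x w \<and> \<bar>inner_integral \<beta> x w\<bar> \<le> d"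
proof -
  let ?l = "1 - \<bar>x\<bar>" and ?u = "1 + \<bar>x\<bar>" and ?p = "(1 - x) powr (3 * \<beta> - 1)"
  define c where "c = min (?l powr (1 - 4 * \<beta>)) (?u powr (1 - 4 * \<beta>)) * ?p"
  define d where "d = max (?l powr (1 - 4 * \<beta>)) (?u powr (1 - 4 * \<beta>)) * ?p"
  have "c > 0" using x by (auto simp: c_def)
  moreover have "c \<le> inner_integral \<beta> x w \<and> \<bar>inner_integral \<beta> x w\<bar> \<le> d" if w: "0 \<le> w" "w \<le> 2" for w
  proof -
    let ?f = "\<lambda>s. (1 - x * (1 - s * w)) powr (1 - 4 * \<beta>) * ?p"
    have b: "c \<le> ?f s" "\<bar>?f s\<bar> \<le> d" if s: "0 < s" "s < 1" for s
    proof -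
      have "\<bar>x * (1 - s * w)\<bar> \<le> \<bar>x\<bar>"
        using one_minus_bounds[OF s w] by (simp add: abs_mult mult_left_le)
      then have "?l \<le> 1 - x * (1 - s * w)" "1 - x * (1 - s * w) \<le> ?u" "0 < ?l" using x by (auto simp: abs_le_iff)
      then show "c \<le> ?f s" "\<bar>?f s\<bar> \<le> d"
        unfolding c_def d_def using powr_ge_min[of ?l _ ?u] powr_le_max[of ?l _ ?u]
        by (auto intro!: mult_right_mono simp: abs_mult)
    qed
    have m: "?f \<in> borel_measurable borel" by measurable
    show ?thesis
      unfolding inner_integral_def
      using beta_measure_integral_abs_le[OF \<beta> m b(2)]
        beta_measure_integral_ge[OF \<beta> beta_measure_integrable_bounded[OF \<beta> m b(2)] b(1)] by auto
  qed
  ultimately show ?thesis using that by blast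
qed

text \<open>Both factors of the integrand are bounded below by positive constants that do not depend
  on t, and the measure has total mass 1. The signs of x, y and of the coefficients do not
  enter.\<close>

lemma F0_pos:
  assumes \<beta>: "\<beta> > 0" and x: "\<bar>x\<bar> < 1" and y: "\<bar>y\<bar> < 1"
  shows "F0 \<beta> (x, y) > 0"
proof -
  obtain c d where c: "c > 0" and
    cd: "\<And>w. 0 \<le> w \<Longrightarrow> w \<le> 2 \<Longrightarrow> c \<le> inner_integral \<beta> x w \<and> \<bar>inner_integral \<beta> x w\<bar> \<le> d"
    by (rule inner_integral_bounds[OF \<beta> x], blast)
  let ?l = "1 - \<bar>y\<bar>" and ?u = "1 + \<bar>y\<bar>"
  define k where "k = min (?l powr (2 * \<beta> - 1)) (?u powr (2 * \<beta> - 1))"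
  define K where "K = max (?l powr (2 * \<beta> - 1)) (?u powr (2 * \<beta> - 1))"
  have k: "k > 0" using y by (auto simp: k_def)
  let ?f = "\<lambda>t. (1 - t * y) powr (2 * \<beta> - 1) * inner_integral \<beta> x (1 - t * y)"
  have b: "k * c \<le> ?f t" "\<bar>?f t\<bar> \<le> K * d" if t: "0 < t" "t < 1" for t
  proof -
    have "\<bar>t * y\<bar> \<le> \<bar>y\<bar>" using t by (simp add: abs_mult mult_left_le_one_le)
    then have ty: "?l \<le> 1 - t * y" "1 - t * y \<le> ?u" "0 < ?l" using y by (auto simp: abs_le_iff)
    have i: "c \<le> inner_integral \<beta> x (1 - t * y)" "\<bar>inner_integral \<beta> x (1 - t * y)\<bar> \<le> d"
      using cd[of "1 - t * y"] ty y by auto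
    have p: "k \<le> (1 - t * y) powr (2 * \<beta> - 1)" "(1 - t * y) powr (2 * \<beta> - 1) \<le> K"
      unfolding k_def K_def using ty by (auto intro: powr_ge_min powr_le_max)
    show "k * c \<le> ?f t" using i p c k by (intro mult_mono) auto
    show "\<bar>?f t\<bar> \<le> K * d" unfolding abs_mult using i p k by (intro mult_mono) auto
  qed
  have m: "?f \<in> borel_measurable borel"
    using inner_integral_measurable[OF \<beta>] by measurable
  have "k * c \<le> F0 \<beta> (x, y)"
    unfolding F0_integral[OF assms]
    by (rule beta_measure_integral_ge[OF \<beta> beta_measure_integrable_bounded[OF \<beta> m b(2)] b(1)])
  moreover have "k * c > 0" using k c by simp
  ultimately show ?thesis by linarith
qed


subsection \<open>Boundary values\<close>

text \<open>Normalised by n + 1 rather than n, so that the bounds derived from it hold from n = 0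
  on. At nonpositive integers z the limit \<open>rGamma z\<close> is 0.\<close>

lemma pochhammer_asymptotic:
  fixes z :: real
  shows "(\<lambda>n. pochhammer z n / fact n / (real n + 1) powr (z - 1)) \<longlonglongrightarrow> rGamma z"
proof (rule LIMSEQ_imp_Suc)
  \<comment> \<open>This factor is \<open>(n / (n + 2))^z (n + 2) / (n + 1)\<close>. It converts
    \<open>rGamma_series z n\<close>, which contains \<open>pochhammer z (n + 1)\<close> and
    \<open>n^z\<close>, into the shifted quotient, and it tends to 1.\<close>
  have l: "(\<lambda>n. (1 - 2 * inverse (real (Suc (Suc n)))) powr z * (1 + inverse (real (Suc n)))) \<longlonglongrightarrow> (1 - 2 * 0) powr z * (1 + 0)"
    by (intro tendsto_intros LIMSEQ_Suc[OF LIMSEQ_inverse_real_of_nat] LIMSEQ_inverse_real_of_nat) auto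
  have "(\<lambda>n. rGamma_series z n * ((1 - 2 * inverse (real (Suc (Suc n)))) powr z * (1 + inverse (real (Suc n))))) \<longlonglongrightarrow> rGamma z * ((1 - 2 * 0) powr z * (1 + 0))"
    by (intro tendsto_mult[OF rGamma_series_LIMSEQ l])
  moreover have "eventually (\<lambda>n. rGamma_series z n * ((1 - 2 * inverse (real (Suc (Suc n)))) powr z * (1 + inverse (real (Suc n))))
      = pochhammer z (Suc n) / fact (Suc n) / (real (Suc n) + 1) powr (z - 1)) sequentially"
    using eventually_gt_at_top[of 0]
  proof eventually_elim
    case (elim n)
    define N where "N = real n"
    have N: "N > 0" using elim by (simp add: N_def)
    have e: "exp (z * ln N) = N powr z" using N by (simp add: powr_def)
    have p: "(1 - 2 * inverse (N + 2)) powr z = N powr z / (N + 2) powr z"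
    proof -
      have "1 - 2 * inverse (N + 2) = N / (N + 2)" using N by (simp add: field_simps)
      then show ?thesis using N by (simp add: powr_divide)
    qed
    have q: "(N + 2) powr (z - 1) = (N + 2) powr z / (N + 2)" using N by (simp add: powr_diff)
    have r: "1 + inverse (N + 1) = (N + 2) / (N + 1)" using N by (simp add: field_simps)
    have f: "fact (Suc n) = (N + 1) * fact n" by (simp add: N_def)
    have "rGamma_series z n * ((1 - 2 * inverse (N + 2)) powr z * (1 + inverse (N + 1)))
        = pochhammer z (Suc n) / fact (Suc n) / (N + 2) powr (z - 1)"
      unfolding rGamma_series_def p q r f using N
      by (simp add: e N_def[symmetric])
    then show ?case by (simp add: N_def add_ac del: fact_Suc pochhammer_Suc)
  qed
  ultimately show "(\<lambda>n. pochhammer z (Suc n) / fact (Suc n) / (real (Suc n) + 1) powr (z - 1)) \<longlonglongrightarrow> rGamma z"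
    by (simp add: tendsto_cong del: fact_Suc)
qed

lemma pochhammer_upper:
  fixes z :: real
  obtains C where "C > 0" "\<And>n. \<bar>pochhammer z n / fact n\<bar> \<le> C * (real n + 1) powr (z - 1)"
proof -
  obtain C where C: "C > 0" "\<And>n. norm (pochhammer z n / fact n / (real n + 1) powr (z - 1)) \<le> C"
    by (rule BseqE[OF convergent_imp_Bseq[OF convergentI[OF pochhammer_asymptotic[of z]]]], blast)
  have "\<bar>pochhammer z n / fact n\<bar> \<le> C * (real n + 1) powr (z - 1)" for n
    using C(2)[of n] by (simp add: abs_mult abs_divide pos_divide_le_eq mult_ac)
  then show ?thesis using that C(1) by blast
qed

text \<open>Obtained by inverting the limit, so \<open>rGamma z\<close> must not vanish; z > 0 also
  makes every Pochhammer symbol positive.\<close>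

lemma pochhammer_lower:
  fixes z :: real
  assumes z: "z > 0"
  obtains C where "C > 0" "\<And>n. (real n + 1) powr (z - 1) \<le> C * (pochhammer z n / fact n)"
proof -
  have "rGamma z \<noteq> 0" using z by (auto simp: rGamma_eq_zero_iff elim!: nonpos_Ints_cases)
  then have *: "(\<lambda>n. inverse (pochhammer z n / fact n / (real n + 1) powr (z - 1))) \<longlonglongrightarrow> inverse (rGamma z)"
    by (intro tendsto_inverse pochhammer_asymptotic)
  obtain C where C: "C > 0" "\<And>n. norm (inverse (pochhammer z n / fact n / (real n + 1) powr (z - 1))) \<le> C"
    by (rule BseqE[OF convergent_imp_Bseq[OF convergentI[OF *]]], blast)
  have "(real n + 1) powr (z - 1) \<le> C * (pochhammer z n / fact n)" for n
  proof -
    have "pochhammer z n / fact n > 0" using z by (simp add: pochhammer_pos)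
    then show ?thesis
      using C(2)[of n] by (simp add: field_simps)
  qed
  then show ?thesis using that C(1) by blast
qed

lemma ccoef_powr_bound:
  assumes \<beta>: "\<beta> > 0"
  obtains C where "C > 0" "\<And>k. \<bar>ccoef \<beta> k\<bar> \<le> C * (real k + 1) powr (1 - 4 * \<beta>)"
proof -
  obtain C1 where C1: "C1 > 0" "\<And>n. \<bar>pochhammer (1 - 2 * \<beta>) n / fact n\<bar> \<le> C1 * (real n + 1) powr (1 - 2 * \<beta> - 1)"
    using pochhammer_upper by blast
  obtain C2 where C2: "C2 > 0" "\<And>n. (real n + 1) powr (2 * \<beta> - 1) \<le> C2 * (pochhammer (2 * \<beta>) n / fact n)"
    using pochhammer_lower[of "2 * \<beta>"] \<beta> by auto
  have "\<bar>ccoef \<beta> k\<bar> \<le> C1 * C2 * (real k + 1) powr (1 - 4 * \<beta>)" for k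
  proof -
    define P where "P = pochhammer (2 * \<beta>) k / fact k"
    have P: "P > 0" using \<beta> by (simp add: P_def pochhammer_pos)
    have "\<bar>ccoef \<beta> k\<bar> = \<bar>pochhammer (1 - 2 * \<beta>) k / fact k\<bar> / P"
      using P by (simp add: ccoef_def P_def abs_divide abs_of_pos[OF pochhammer_pos] \<beta>)
    also have "\<dots> \<le> C1 * (real k + 1) powr (- 2 * \<beta>) / P"
      using C1(2)[of k] P by (intro divide_right_mono) auto
    also have "\<dots> \<le> C1 * (real k + 1) powr (- 2 * \<beta>) * (C2 / (real k + 1) powr (2 * \<beta> - 1))"
    proof -
      have "1 / P \<le> C2 / (real k + 1) powr (2 * \<beta> - 1)"
        using C2(2)[of k] P unfolding P_def[symmetric] by (simp add: field_simps)
      then have "C1 * (real k + 1) powr (- 2 * \<beta>) * (1 / P) \<le> C1 * (real k + 1) powr (- 2 * \<beta>) * (C2 / (real k + 1) powr (2 * \<beta> - 1))"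
        using C1(1) by (intro mult_left_mono) auto
      then show ?thesis by simp
    qed
    also have "\<dots> = C1 * C2 * ((real k + 1) powr (- 2 * \<beta>) / (real k + 1) powr (2 * \<beta> - 1))"
      by simp
    also have "(real k + 1) powr (- 2 * \<beta>) / (real k + 1) powr (2 * \<beta> - 1) = (real k + 1) powr (1 - 4 * \<beta>)"
      by (simp flip: powr_diff)
    finally show ?thesis .
  qed
  then show ?thesis using that C1(1) C2(1) by (meson mult_pos_pos)
qed

text \<open>\<open>ccoef\<close> decays like a power of |m - n| + 1 with the negative exponent
  \<open>1 - 4\<beta>\<close>. This decay is transferred to n at the price of a power of m, leaving
  \<open>H n = (n + 1)^(-3\<beta>)\<close>, which is summable because 3\<beta> > 1, against a factor
  \<open>G\<close> of at most polynomial growth.\<close>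

lemma A0_bound_summable:
  assumes \<beta>: "\<beta> > 1 / 3"
  obtains G H where "\<And>m n. \<bar>A0 \<beta> m n\<bar> \<le> G m * H n" "\<And>m. 0 \<le> G m" "\<And>n. 0 \<le> H n"
    "summable H" "\<And>x. \<bar>x\<bar> < 1 \<Longrightarrow> summable (\<lambda>m. G m * \<bar>x\<bar> ^ m)"
proof -
  have \<beta>0: "\<beta> > 0" using \<beta> by simp
  obtain C1 where C1: "C1 > 0" "\<And>k. \<bar>ccoef \<beta> k\<bar> \<le> C1 * (real k + 1) powr (1 - 4 * \<beta>)"
    using ccoef_powr_bound[OF \<beta>0] by blast
  obtain C2 where C2: "C2 > 0" "\<And>n. \<bar>pochhammer \<beta> n / fact n\<bar> \<le> C2 * (real n + 1) powr (\<beta> - 1)"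
    using pochhammer_upper by blast
  \<comment> \<open>\<open>G m\<close> is at most a constant times
    \<open>(m + 1)^(5\<beta> - 2)\<close>, and this is compared with the coefficients of
    \<open>(1 - x)^(1 - 5\<beta>)\<close>.\<close>
  obtain C3 where C3: "C3 > 0" "\<And>n. (real n + 1) powr (5 * \<beta> - 1 - 1) \<le> C3 * (pochhammer (5 * \<beta> - 1) n / fact n)"
    using pochhammer_lower[of "5 * \<beta> - 1"] \<beta> by auto
  have b: "0 < bcoef \<beta> n" "bcoef \<beta> n \<le> C2 * (real n + 1) powr (\<beta> - 1)" for n
    using C2(2)[of n] bcoef_pos[OF \<beta>0, of n] by (auto simp: bcoef_def[symmetric])
  define G where "G m = C1 * C2 * bcoef \<beta> m * (real m + 1) powr (4 * \<beta> - 1)" for m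
  define H where "H n = (real n + 1) powr (- 3 * \<beta>)" for n
  show ?thesis
  proof (rule that)
    show "\<bar>A0 \<beta> m n\<bar> \<le> G m * H n" for m n
    proof -
      \<comment> \<open>This inequality separates the indices: a negative power of |m - n| + 1 is at
        most the same power of the quotient of n + 1 by m + 1.\<close>
      have "real n + 1 \<le> (real m + 1) * (real (absdiff m n) + 1)"
      proof -
        have "n \<le> m + absdiff m n" by (simp add: absdiff_def)
        then have "n + 1 \<le> (m + 1) * (absdiff m n + 1)" by (simp add: algebra_simps)
        then have "real (n + 1) \<le> real ((m + 1) * (absdiff m n + 1))" by (rule of_nat_mono)
        then show ?thesis by (simp add: algebra_simps)
      qed
      then have "(real n + 1) / (real m + 1) \<le> real (absdiff m n) + 1" by (simp add: field_simps)
      then have "(real (absdiff m n) + 1) powr (1 - 4 * \<beta>) \<le> ((real n + 1) / (real m + 1)) powr (1 - 4 * \<beta>)"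
        using \<beta> by (intro powr_mono2') auto
      also have "\<dots> = (real n + 1) powr (1 - 4 * \<beta>) * (real m + 1) powr (4 * \<beta> - 1)"
        using powr_minus[of "real m + 1" "4 * \<beta> - 1"] by (simp add: powr_divide field_simps)
      finally have "\<bar>ccoef \<beta> (absdiff m n)\<bar> \<le> C1 * ((real n + 1) powr (1 - 4 * \<beta>) * (real m + 1) powr (4 * \<beta> - 1))"
        using C1(2)[of "absdiff m n"] C1(1) by (meson less_imp_le mult_left_mono order_trans)
      then have "bcoef \<beta> n * \<bar>ccoef \<beta> (absdiff m n)\<bar> \<le> (C2 * (real n + 1) powr (\<beta> - 1)) *
          (C1 * ((real n + 1) powr (1 - 4 * \<beta>) * (real m + 1) powr (4 * \<beta> - 1)))"
        using b[of n] C2(1) by (intro mult_mono) auto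
      also have "\<dots> = C1 * C2 * (real m + 1) powr (4 * \<beta> - 1) * ((real n + 1) powr (\<beta> - 1) * (real n + 1) powr (1 - 4 * \<beta>))"
        by (simp add: mult_ac)
      also have "(real n + 1) powr (\<beta> - 1) * (real n + 1) powr (1 - 4 * \<beta>) = H n"
        by (simp add: H_def flip: powr_add)
      finally have "bcoef \<beta> m * (bcoef \<beta> n * \<bar>ccoef \<beta> (absdiff m n)\<bar>) \<le> bcoef \<beta> m * (C1 * C2 * (real m + 1) powr (4 * \<beta> - 1) * H n)"
        using b(1)[of m] by (intro mult_left_mono) auto
      moreover have "\<bar>A0 \<beta> m n\<bar> = bcoef \<beta> m * (bcoef \<beta> n * \<bar>ccoef \<beta> (absdiff m n)\<bar>)"
        using b(1)[of m] b(1)[of n] by (simp add: A0_altdef abs_mult)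
      ultimately show ?thesis by (simp add: G_def mult_ac)
    qed
    show G0: "0 \<le> G m" for m using b(1)[of m] C1(1) C2(1) by (simp add: G_def)
    show "0 \<le> H n" for n by (simp add: H_def)
    have "summable (\<lambda>n. real n powr (- 3 * \<beta>))"
      using \<beta> by (subst summable_real_powr_iff) auto
    then have "summable (\<lambda>n. real (Suc n) powr (- 3 * \<beta>))" by (subst summable_Suc_iff)
    then show "summable H" by (simp add: H_def[abs_def] add.commute)
    show "summable (\<lambda>m. G m * \<bar>x\<bar> ^ m)" if x: "\<bar>x\<bar> < 1" for x
    proof (rule summable_comparison_test')
      show "summable (\<lambda>m. (C1 * C2 * C2 * C3) * (\<bar>pochhammer (5 * \<beta> - 1) m / fact m\<bar> * \<bar>x\<bar> ^ m))"
        by (intro summable_mult binomial_series_abs_summable[OF x])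
      fix m :: nat
      have "bcoef \<beta> m * (real m + 1) powr (4 * \<beta> - 1) \<le> (C2 * (real m + 1) powr (\<beta> - 1)) * (real m + 1) powr (4 * \<beta> - 1)"
        using b[of m] by (intro mult_right_mono) auto
      also have "\<dots> = C2 * (real m + 1) powr (5 * \<beta> - 1 - 1)" by (simp flip: powr_add)
      also have "\<dots> \<le> C2 * (C3 * (pochhammer (5 * \<beta> - 1) m / fact m))"
        using C3(2) C2(1) by (intro mult_left_mono) auto
      finally have "G m \<le> C1 * C2 * (C2 * (C3 * (pochhammer (5 * \<beta> - 1) m / fact m)))"
        unfolding G_def mult.assoc using C1(1) C2(1) by (intro mult_left_mono) auto
      also have "\<dots> = (C1 * C2 * C2 * C3) * (pochhammer (5 * \<beta> - 1) m / fact m)" by (simp add: mult_ac)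
      also have "\<dots> \<le> (C1 * C2 * C2 * C3) * \<bar>pochhammer (5 * \<beta> - 1) m / fact m\<bar>"
        using C1(1) C2(1) C3(1) by (intro mult_left_mono abs_ge_self) auto
      finally have "G m * \<bar>x\<bar> ^ m \<le> ((C1 * C2 * C2 * C3) * \<bar>pochhammer (5 * \<beta> - 1) m / fact m\<bar>) * \<bar>x\<bar> ^ m"
        by (intro mult_right_mono) auto
      then show "norm (G m * \<bar>x\<bar> ^ m) \<le> (C1 * C2 * C2 * C3) * (\<bar>pochhammer (5 * \<beta> - 1) m / fact m\<bar> * \<bar>x\<bar> ^ m)"
        using G0[of m] by (simp add: abs_mult mult_ac)
    qed
  qed
qed

lemma beta_measure_one_minus_moment:
  assumes "\<beta> > 0" "\<beta> + q > 0"
  shows "has_bochner_integral (beta_measure \<beta>) (\<lambda>t. (1 - t) powr q) (Beta \<beta> (\<beta> + q) / Beta \<beta> \<beta>)"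
proof -
  have "has_bochner_integral (beta_measure \<beta>) (\<lambda>t. t powr 0 * (1 - t) powr q) (Beta \<beta> (\<beta> + q) / Beta \<beta> \<beta>)"
    using beta_measure_moment[of \<beta> 0 q] assms by simp
  also have "?this \<longleftrightarrow> ?thesis"
    by (intro has_bochner_integral_cong_AE AE_beta_measureI) auto
  finally show ?thesis .
qed

section \<open>Row sums at the edge\<close>

text \<open>The expectation of \<open>(1 - t)^(2\<beta> - 1)\<close> for \<beta> > 1/3.\<close>

definition row_const :: "real \<Rightarrow> real" where
  "row_const \<beta> = Gamma (2 * \<beta>) * Gamma (3 * \<beta> - 1) / (Gamma \<beta> * Gamma (4 * \<beta> - 1))"

text \<open>At y = 1 the j-th integral is \<open>row_const \<beta>\<close> times
  \<open>(3\<beta> - 1)_j / (4\<beta> - 1)_j\<close>. The factor \<open>(4\<beta> - 1)_j\<close>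
  cancels against the expansion, and Chu-Vandermonde with \<open>c = 2\<beta>\<close> and
  \<open>a = 3\<beta> - 1\<close> sums what remains to
  \<open>(1 - \<beta>)_m / (2\<beta>)_m\<close>.\<close>

lemma A0_row_sum_1:
  assumes \<beta>: "\<beta> > 1 / 3"
  shows "(\<lambda>n. A0 \<beta> m n) sums (row_const \<beta> * (pochhammer \<beta> m * pochhammer (1 - \<beta>) m
                   / (pochhammer 1 m * pochhammer (2 * \<beta>) m)))"
proof -
  have \<beta>0: "\<beta> > 0" using \<beta> by simp
  obtain C2 where C2: "C2 > 0" "\<And>n. \<bar>pochhammer \<beta> n / fact n\<bar> \<le> C2 * (real n + 1) powr (\<beta> - 1)"
    using pochhammer_upper by blast
  obtain C3 where C3: "C3 > 0" "\<And>n. (real n + 1) powr (2 * \<beta> - 1) \<le> C3 * (pochhammer (2 * \<beta>) n / fact n)"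
    using pochhammer_lower[of "2 * \<beta>"] \<beta> by auto
  have s: "summable (\<lambda>n. \<bar>pochhammer (1 - 2 * \<beta> - real j) n / fact n\<bar>
         * (pochhammer \<beta> n / pochhammer (2 * \<beta>) n) * \<bar>1\<bar> ^ n)" for j
  proof -
    obtain C1 where C1: "C1 > 0" "\<And>n. \<bar>pochhammer (1 - 2 * \<beta> - real j) n / fact n\<bar> \<le> C1 * (real n + 1) powr (1 - 2 * \<beta> - real j - 1)"
      using pochhammer_upper by blast
    show ?thesis
    proof (rule summable_comparison_test')
      have "summable (\<lambda>n. real n powr (- 3 * \<beta>))"
        using \<beta> by (subst summable_real_powr_iff) auto
      then have "summable (\<lambda>n. real (Suc n) powr (- 3 * \<beta>))" by (subst summable_Suc_iff)
      then show "summable (\<lambda>n. C1 * C2 * C3 * (real n + 1) powr (- 3 * \<beta>))"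
        by (intro summable_mult) (simp add: add.commute)
      fix n :: nat
      define N where "N = real n + 1"
      have N: "N \<ge> 1" by (simp add: N_def)
      define P Q where "P = pochhammer (2 * \<beta>) n / fact n" and "Q = pochhammer \<beta> n / fact n"
      have P: "P > 0" and Q: "Q > 0" using \<beta>0 by (auto simp: P_def Q_def pochhammer_pos)
      have QP: "pochhammer \<beta> n / pochhammer (2 * \<beta>) n = Q * (1 / P)" by (simp add: P_def Q_def)
      have "1 / P \<le> C3 / N powr (2 * \<beta> - 1)"
        using C3(2)[of n] P unfolding P_def[symmetric] N_def[symmetric] by (simp add: N_def field_simps)
      moreover have "Q \<le> C2 * N powr (\<beta> - 1)" using C2(2)[of n] Q by (simp add: Q_def[symmetric] N_def)
      moreover have "\<bar>pochhammer (1 - 2 * \<beta> - real j) n / fact n\<bar> \<le> C1 * N powr (- 2 * \<beta>)"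
      proof -
        \<comment> \<open>Larger j only improves the decay, so the case j = 0 bounds all of them;
          the exponents then add up to \<open>-3\<beta>\<close>.\<close>
        have "N powr (1 - 2 * \<beta> - real j - 1) \<le> N powr (- 2 * \<beta>)" using N by (intro powr_mono) auto
        then show ?thesis using C1(2)[of n] C1(1) unfolding N_def[symmetric]
          by (meson less_imp_le mult_left_mono order_trans)
      qed
      ultimately have "\<bar>pochhammer (1 - 2 * \<beta> - real j) n / fact n\<bar> * (Q * (1 / P))
          \<le> (C1 * N powr (- 2 * \<beta>)) * ((C2 * N powr (\<beta> - 1)) * (C3 / N powr (2 * \<beta> - 1)))"
        using P Q C1(1) C2(1) C3(1) by (intro mult_mono) auto
      also have "\<dots> = C1 * C2 * C3 * (N powr (- 2 * \<beta>) * N powr (\<beta> - 1) / N powr (2 * \<beta> - 1))" by simp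
      also have "N powr (- 2 * \<beta>) * N powr (\<beta> - 1) / N powr (2 * \<beta> - 1) = N powr (- 3 * \<beta>)"
        by (simp flip: powr_add powr_diff)
      finally show "norm (\<bar>pochhammer (1 - 2 * \<beta> - real j) n / fact n\<bar>
         * (pochhammer \<beta> n / pochhammer (2 * \<beta>) n) * \<bar>1\<bar> ^ n) \<le> C1 * C2 * C3 * (real n + 1) powr (- 3 * \<beta>)"
        unfolding QP using P Q by (simp add: abs_mult N_def)
    qed
  qed
  let ?k = "\<lambda>j. real (m choose j) * (- 1) ^ j * pochhammer (4 * \<beta> - 1) j / pochhammer (2 * \<beta>) j"
  have int: "(\<integral>t. (1 - t * 1) powr (2 * \<beta> - 1 + real j) \<partial>beta_measure \<beta>)
      = row_const \<beta> * (pochhammer (3 * \<beta> - 1) j / pochhammer (4 * \<beta> - 1) j)" for j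
  proof -
    have "(\<integral>t. (1 - t) powr (2 * \<beta> - 1 + real j) \<partial>beta_measure \<beta>) = Beta \<beta> (\<beta> + (2 * \<beta> - 1 + real j)) / Beta \<beta> \<beta>"
      using beta_measure_one_minus_moment[of \<beta> "2 * \<beta> - 1 + real j"] \<beta> by (simp add: has_bochner_integral_iff)
    also have "\<beta> + (2 * \<beta> - 1 + real j) = 3 * \<beta> - 1 + real j" by simp
    also have "Beta \<beta> (3 * \<beta> - 1 + real j) / Beta \<beta> \<beta> = row_const \<beta> * (pochhammer (3 * \<beta> - 1) j / pochhammer (4 * \<beta> - 1) j)"
    proof -
      have n: "3 * \<beta> - 1 \<notin> \<int>\<^sub>\<le>\<^sub>0" "4 * \<beta> - 1 \<notin> \<int>\<^sub>\<le>\<^sub>0" using \<beta> by (auto elim!: nonpos_Ints_cases)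
      have e: "\<beta> + (3 * \<beta> - 1 + real j) = 4 * \<beta> - 1 + real j" "\<beta> + \<beta> = 2 * \<beta>" by auto
      have "Gamma \<beta> > 0" "Gamma (2 * \<beta>) > 0" "Gamma (3 * \<beta> - 1) > 0" "Gamma (4 * \<beta> - 1) > 0" "Gamma (4 * \<beta> - 1 + real j) > 0"
        using \<beta> by (auto intro!: Gamma_real_pos)
      then show ?thesis
        unfolding pochhammer_Gamma[OF n(1)] pochhammer_Gamma[OF n(2)] Beta_def row_const_def e
        by (simp add: field_simps)
    qed
    finally show ?thesis by simp
  qed
  have "bcoef \<beta> m * (\<Sum>j\<le>m. ?k j * (\<integral>t. (1 - t * 1) powr (2 * \<beta> - 1 + real j) \<partial>beta_measure \<beta>))
      = bcoef \<beta> m * (\<Sum>j\<le>m. row_const \<beta> * (real (m choose j) * (- 1) ^ j * pochhammer (3 * \<beta> - 1) j / pochhammer (2 * \<beta>) j))"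
  proof -
    have "pochhammer (4 * \<beta> - 1) j \<noteq> 0" for j
      using pochhammer_pos[of "4 * \<beta> - 1" j] \<beta> by simp
    then show ?thesis unfolding int by (simp add: mult_ac)
  qed
  also have "\<dots> = bcoef \<beta> m * (row_const \<beta> * (pochhammer (1 - \<beta>) m / pochhammer (2 * \<beta>) m))"
    unfolding sum_distrib_left[symmetric] using vandermonde_quotient[of "2 * \<beta>" m "3 * \<beta> - 1"] \<beta>0 by simp
  also have "\<dots> = row_const \<beta> * (pochhammer \<beta> m * pochhammer (1 - \<beta>) m
                   / (pochhammer 1 m * pochhammer (2 * \<beta>) m))"
    by (simp add: bcoef_def pochhammer_fact)
  finally show ?thesis
    using A0_row_sums[OF \<beta>0 _ s, of m] by simp
qed

lemma A0_row_abs_summable: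
  assumes "\<beta> > 1 / 3"
  shows "summable (\<lambda>n. \<bar>A0 \<beta> m n\<bar>)"
proof -
  obtain G H where GH: "\<And>m n. \<bar>A0 \<beta> m n\<bar> \<le> G m * H n" "\<And>m. 0 \<le> G m" "\<And>n. 0 \<le> H n" "summable H"
    by (rule A0_bound_summable[OF assms], blast)
  show ?thesis
    by (rule summable_comparison_test'[OF summable_mult[OF GH(4), of "G m"]]) (use GH(1) in auto)
qed

section \<open>Weighted sums and continuity up to the edges\<close>

lemma suminf_swap_ennreal:
  fixes f :: "nat \<Rightarrow> nat \<Rightarrow> ennreal"
  shows "(\<Sum>m. \<Sum>n. f m n) = (\<Sum>n. \<Sum>m. f m n)"
proof -
  have "(\<Sum>m. \<Sum>n. f m n) = (\<integral>\<^sup>+m. (\<Sum>n. f m n) \<partial>count_space UNIV)"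
    by (simp add: nn_integral_count_space_nat)
  also have "\<dots> = (\<Sum>n. \<integral>\<^sup>+m. f m n \<partial>count_space UNIV)"
    by (rule nn_integral_suminf) simp
  finally show ?thesis by (simp add: nn_integral_count_space_nat)
qed

lemma A0_weighted_sum_swap:
  "(\<Sum>n1. \<Sum>n2. ennreal (\<bar>A0 \<beta> n1 n2\<bar> * L ^ n2)) = (\<Sum>n1. \<Sum>n2. ennreal (\<bar>A0 \<beta> n1 n2\<bar> * L ^ n1))"
  by (subst suminf_swap_ennreal) (simp add: A0_commute)

lemma A0_weighted_sum_finite:
  assumes \<beta>: "\<beta> > 1 / 3" and L: "0 < L" "L < 1"
  shows "(\<Sum>n1. \<Sum>n2. ennreal (\<bar>A0 \<beta> n1 n2\<bar> * L ^ n1)) < \<infinity>"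
proof -
  obtain G H where GH: "\<And>m n. \<bar>A0 \<beta> m n\<bar> \<le> G m * H n" "\<And>m. 0 \<le> G m" "\<And>n. 0 \<le> H n" "summable H"
    "\<And>x. \<bar>x\<bar> < 1 \<Longrightarrow> summable (\<lambda>m. G m * \<bar>x\<bar> ^ m)"
    by (rule A0_bound_summable[OF \<beta>], blast)
  have "(\<Sum>n1. \<Sum>n2. ennreal (\<bar>A0 \<beta> n1 n2\<bar> * L ^ n1)) \<le> (\<Sum>n1. \<Sum>n2. ennreal (G n1 * L ^ n1 * H n2))"
  proof (intro suminf_le summableI ennreal_leI)
    fix m n
    show "\<bar>A0 \<beta> m n\<bar> * L ^ m \<le> G m * L ^ m * H n"
      using mult_right_mono[OF GH(1)[of m n], of "L ^ m"] L by (simp add: mult_ac)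
  qed
  also have "\<dots> = (\<Sum>n1. ennreal (\<Sum>n2. G n1 * L ^ n1 * H n2))"
    using GH L by (intro suminf_cong suminf_ennreal2 summable_mult) auto
  also have "\<dots> = ennreal (\<Sum>n1. \<Sum>n2. G n1 * L ^ n1 * H n2)"
  proof (rule suminf_ennreal2)
    show "0 \<le> (\<Sum>n2. G n1 * L ^ n1 * H n2)" for n1
      using GH L by (intro suminf_nonneg summable_mult) auto
    have "(\<Sum>n2. G n1 * L ^ n1 * H n2) = G n1 * L ^ n1 * suminf H" for n1
      by (rule suminf_mult[OF GH(4)])
    then show "summable (\<lambda>n1. \<Sum>n2. G n1 * L ^ n1 * H n2)"
      using GH(5)[of L] L by (simp add: summable_mult2)
  qed
  also have "\<dots> < \<infinity>" by simp
  finally show ?thesis .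
qed

lemma A0_summable_closed:
  assumes \<beta>: "\<beta> > 1 / 3" and x: "\<bar>x\<bar> \<le> 1" and y: "\<bar>y\<bar> < 1"
  shows "term2 (A0 \<beta>) (x, y) summable_on UNIV" "term2 (A0 \<beta>) (y, x) summable_on UNIV"
proof -
  obtain G H where GH: "\<And>m n. \<bar>A0 \<beta> m n\<bar> \<le> G m * H n" "\<And>m. 0 \<le> G m" "\<And>n. 0 \<le> H n" "summable H"
    "\<And>x. \<bar>x\<bar> < 1 \<Longrightarrow> summable (\<lambda>m. G m * \<bar>x\<bar> ^ m)"
    by (rule A0_bound_summable[OF \<beta>], blast)
  have H: "summable (\<lambda>n. H n * \<bar>x\<bar> ^ n)"
    by (rule summable_comparison_test'[OF GH(4)])
      (use GH(3) x in \<open>auto simp: abs_mult power_abs intro!: mult_left_le power_le_one\<close>)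
  show "term2 (A0 \<beta>) (y, x) summable_on UNIV"
    by (rule term2_summable_on[OF GH(1-3) GH(5)[OF y] H])
  have GH': "\<bar>A0 \<beta> m n\<bar> \<le> H m * G n" for m n
    using GH(1)[of n m] by (simp add: A0_commute mult.commute)
  show "term2 (A0 \<beta>) (x, y) summable_on UNIV"
    by (rule term2_summable_on[OF GH' GH(3) GH(2) H GH(5)[OF y]])
qed

text \<open>On a box with lower corner at the origin, every term is dominated by its value at the
  upper corner (a, b), so summability at (a, b) gives uniform convergence on the box.\<close>

lemma F0_continuous_closed:
  assumes \<beta>: "\<beta> > 1 / 3"
  shows "continuous_on (unit_square - {(1, 1)}) (F0 \<beta>)"
proof -
  have A: "continuous_on ({0..a} \<times> {0..b}) (F0 \<beta>)"
    if s: "term2 (A0 \<beta>) (a, b) summable_on UNIV" and ab: "0 \<le> a" "0 \<le> b" for a b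
  proof (rule uniform_limit_theorem)
    show "uniform_limit ({0..a} \<times> {0..b}) (\<lambda>N s. \<Sum>n\<in>N. term2 (A0 \<beta>) s n) (F0 \<beta>) (finite_subsets_at_top UNIV)"
      unfolding F0_def series2_def[abs_def]
    proof (rule Weierstrass_m_test_general[where M = "\<lambda>k. \<bar>term2 (A0 \<beta>) (a, b) k\<bar>"])
      show "(\<lambda>k. \<bar>term2 (A0 \<beta>) (a, b) k\<bar>) summable_on UNIV"
        using s by (subst (asm) summable_on_iff_abs_summable_on_real) simp
      fix k s assume s: "s \<in> {0..a} \<times> {0..b}"
      have "fst s ^ fst k * snd s ^ snd k \<le> a ^ fst k * b ^ snd k"
        using s by (intro mult_mono power_mono) auto
      then show "norm (term2 (A0 \<beta>) s k) \<le> \<bar>term2 (A0 \<beta>) (a, b) k\<bar>"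
        using s ab by (auto simp: term2_def abs_mult intro!: mult_left_mono)
    qed
    show "\<forall>\<^sub>F N in finite_subsets_at_top UNIV. continuous_on ({0..a} \<times> {0..b}) (\<lambda>s. \<Sum>n\<in>N. term2 (A0 \<beta>) s n)"
      by (intro always_eventually allI) (auto simp: term2_def intro!: continuous_intros)
  qed auto
  have B: "continuous (at r within unit_square - {(1, 1)}) (F0 \<beta>)"
    if r: "r \<in> unit_square - {(1, 1)}" for r
  proof -
    \<comment> \<open>Away from (1, 1) at least one coordinate is below 1; the upper corner keeps 1
      in the other coordinate and takes a value L < 1 in this one.\<close>
    obtain U a b where U: "open U" "r \<in> U" "U \<inter> unit_square \<subseteq> {0..a} \<times> {0..b}"
      and s: "term2 (A0 \<beta>) (a, b) summable_on UNIV" and ab: "0 \<le> a" "0 \<le> b"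
    proof (cases "snd r < 1")
      case True
      then obtain L where L: "snd r < L" "L < 1" using dense by blast
      have "term2 (A0 \<beta>) (1, L) summable_on UNIV"
        using A0_summable_closed(1)[OF \<beta>, of 1 L] L r by auto
      moreover have "open ((UNIV :: real set) \<times> {..<L})" by (intro open_Times) auto
      moreover have "r \<in> UNIV \<times> {..<L}" using L by (simp add: mem_Times_iff)
      moreover have "(UNIV \<times> {..<L}) \<inter> unit_square \<subseteq> {0..1} \<times> {0..L}" by auto
      ultimately show ?thesis using that[of "UNIV \<times> {..<L}" 1 L] L r by auto
    next
      case False
      then have "fst r < 1" using r by (cases r) auto
      then obtain L where L: "fst r < L" "L < 1" using dense by blast
      have "term2 (A0 \<beta>) (L, 1) summable_on UNIV"
        using A0_summable_closed(2)[OF \<beta>, of 1 L] L r by auto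
      moreover have "open ({..<L} \<times> (UNIV :: real set))" by (intro open_Times) auto
      moreover have "r \<in> {..<L} \<times> UNIV" using L by (simp add: mem_Times_iff)
      moreover have "({..<L} \<times> UNIV) \<inter> unit_square \<subseteq> {0..L} \<times> {0..1}" by auto
      ultimately show ?thesis using that[of "{..<L} \<times> UNIV" L 1] L r by auto
    qed
    have "continuous_on (U \<inter> (unit_square - {(1, 1)})) (F0 \<beta>)"
      by (rule continuous_on_subset[OF A[OF s ab]]) (use U(3) in auto)
    then have "continuous (at r within (unit_square - {(1, 1)}) \<inter> U) (F0 \<beta>)"
      using r U(2) by (simp add: continuous_on_eq_continuous_within Int_commute)
    moreover have "at r within (unit_square - {(1, 1)}) \<inter> U = at r within unit_square - {(1, 1)}"
      by (rule at_within_nhd[OF U(2) U(1)]) auto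
    ultimately show ?thesis by simp
  qed
  then show ?thesis by (simp add: continuous_on_eq_continuous_within)
qed

text \<open>Positivity comes from the integral, since \<open>(1 - \<beta>)_m\<close> can be negative
  when \<beta> > 1.\<close>

lemma f_hyp_integral:
  assumes \<beta>: "\<beta> > 0" and x: "\<bar>x\<bar> < 1"
  shows "(\<lambda>m. pochhammer \<beta> m * pochhammer (1 - \<beta>) m / (pochhammer 1 m * pochhammer (2 * \<beta>) m) * x ^ m)
           sums f_hyp \<beta> x"
    and "f_hyp \<beta> x > 0"
proof -
  note int = euler_integral(1)[OF \<beta> less_imp_le[OF x] euler_summable[OF \<beta> x], of "1 - \<beta>"]
  note s = euler_integral(2)[OF \<beta> less_imp_le[OF x] euler_summable[OF \<beta> x], of "1 - \<beta>"]
  have "f_hyp \<beta> x = (\<Sum>m. pochhammer (1 - \<beta>) m / fact m * (pochhammer \<beta> m / pochhammer (2 * \<beta>) m) * x ^ m)"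
    by (simp add: f_hyp_def eval_fps_def mult_ac)
  then have f: "f_hyp \<beta> x = (\<integral>t. (1 - t * x) powr (- (1 - \<beta>)) \<partial>beta_measure \<beta>)"
    using s by (simp add: sums_iff)
  show "(\<lambda>m. pochhammer \<beta> m * pochhammer (1 - \<beta>) m / (pochhammer 1 m * pochhammer (2 * \<beta>) m) * x ^ m)
           sums f_hyp \<beta> x"
    using s unfolding f by (simp add: pochhammer_fact mult_ac)
  define c where "c = min ((1 - \<bar>x\<bar>) powr (- (1 - \<beta>))) ((1 + \<bar>x\<bar>) powr (- (1 - \<beta>)))"
  have "c \<le> f_hyp \<beta> x"
    unfolding f
  proof (rule beta_measure_integral_ge[OF \<beta> int])
    fix t :: real assume t: "0 < t" "t < 1"
    have "\<bar>t * x\<bar> \<le> \<bar>x\<bar>" using t by (simp add: abs_mult mult_left_le_one_le)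
    then show "c \<le> (1 - t * x) powr (- (1 - \<beta>))"
      unfolding c_def using x by (intro powr_ge_min) (auto simp: abs_le_iff)
  qed
  moreover have "c > 0" using x by (auto simp: c_def)
  ultimately show "f_hyp \<beta> x > 0" by simp
qed

lemma F0_boundary:
  assumes \<beta>: "\<beta> > 1 / 3" and x: "\<bar>x\<bar> < 1"
  shows "F0 \<beta> (x, 1) = row_const \<beta> * f_hyp \<beta> x"
proof -
  have row: "(\<Sum>\<^sub>\<infinity>n. A0 \<beta> m n * 1 ^ n) = row_const \<beta> * (pochhammer \<beta> m * pochhammer (1 - \<beta>) m
                   / (pochhammer 1 m * pochhammer (2 * \<beta>) m))" for m
  proof -
    have "summable (\<lambda>n. norm (A0 \<beta> m n))" using A0_row_abs_summable[OF \<beta>] by simp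
    then have "((\<lambda>n. A0 \<beta> m n) has_sum row_const \<beta> * (pochhammer \<beta> m * pochhammer (1 - \<beta>) m
                   / (pochhammer 1 m * pochhammer (2 * \<beta>) m))) UNIV"
      by (intro norm_summable_imp_has_sum A0_row_sum_1[OF \<beta>])
    then show ?thesis by (simp add: infsumI)
  qed
  have "(\<lambda>m. (\<Sum>\<^sub>\<infinity>n. A0 \<beta> m n * 1 ^ n) * x ^ m) sums F0 \<beta> (x, 1)"
    unfolding F0_def by (intro series2_iterated A0_summable_closed(2)[OF \<beta>]) (use x in auto)
  moreover have "(\<lambda>m. row_const \<beta> * (pochhammer \<beta> m * pochhammer (1 - \<beta>) m
                   / (pochhammer 1 m * pochhammer (2 * \<beta>) m) * x ^ m)) sums (row_const \<beta> * f_hyp \<beta> x)"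
    using \<beta> x by (intro sums_mult f_hyp_integral(1)) auto
  ultimately show ?thesis
    unfolding row by (simp add: sums_iff mult.assoc)
qed

lemma row_const_pos: "\<beta> > 1 / 3 \<Longrightarrow> row_const \<beta> > 0"
  unfolding row_const_def by (intro divide_pos_pos mult_pos_pos Gamma_real_pos) auto

lemma F0_pos_closed:
  assumes \<beta>: "\<beta> > 1 / 3" and r: "r \<in> unit_square - {(1, 1)}"
  shows "F0 \<beta> r > 0"
proof -
  obtain x y where xy: "r = (x, y)" by fastforce
  have b: "F0 \<beta> (z, 1) > 0" if "\<bar>z\<bar> < 1" for z
    using F0_boundary[OF \<beta> that] row_const_pos[OF \<beta>] f_hyp_integral(2)[OF _ that, of \<beta>] \<beta> by simp
  consider "x < 1" "y < 1" | "x < 1" "y = 1" | "x = 1" "y < 1" using r xy by fastforce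
  then show ?thesis
  proof cases
    case 1 then show ?thesis using F0_pos[of \<beta> x y] \<beta> r by (auto simp: xy)
  next
    case 2 then show ?thesis using b[of x] r by (auto simp: xy)
  next
    case 3 then show ?thesis using b[of y] r by (auto simp: xy F0_commute[of \<beta> 1])
  qed
qed


subsection \<open>The corner\<close>

text \<open>A bridge to \<open>integral\<close> over the open unit interval, the setting of the
  change-of-variables theorem used for Euler's transformation.\<close>

lemma beta_measure_eq_integral:
  fixes h :: "real \<Rightarrow> real"
  assumes \<beta>: "\<beta> > 0" and h: "h \<in> borel_measurable borel" and b: "\<And>t. 0 < t \<Longrightarrow> t < 1 \<Longrightarrow> \<bar>h t\<bar> \<le> B"
  shows "(\<lambda>t. t powr (\<beta> - 1) * (1 - t) powr (\<beta> - 1) * h t) absolutely_integrable_on {0<..<1}"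
    and "(\<integral>t. h t \<partial>beta_measure \<beta>)
       = integral {0<..<1} (\<lambda>t. t powr (\<beta> - 1) * (1 - t) powr (\<beta> - 1) * h t) / Beta \<beta> \<beta>"
proof -
  let ?f = "\<lambda>t. t powr (\<beta> - 1) * (1 - t) powr (\<beta> - 1) * h t"
  let ?w = "\<lambda>t. indicator {0<..<1} t * (t powr (\<beta> - 1) * (1 - t) powr (\<beta> - 1)) / Beta \<beta> \<beta>"
  note [measurable] = h
  have B: "Beta \<beta> \<beta> > 0" by (rule Beta_pos[OF \<beta> \<beta>])
  have wm: "?w \<in> borel_measurable lborel" and wn: "AE t in lborel. 0 \<le> ?w t"
    using B by (measurable, auto)
  have "integrable (beta_measure \<beta>) h" by (rule beta_measure_integrable_bounded[OF \<beta> h b])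
  then have "integrable lborel (\<lambda>t. ?w t *\<^sub>R h t)"
    unfolding beta_measure_def by (subst (asm) integrable_density) (use wm wn h in auto)
  then have "integrable lborel (\<lambda>t. Beta \<beta> \<beta> * (?w t *\<^sub>R h t))" by (rule integrable_mult_right)
  also have "(\<lambda>t. Beta \<beta> \<beta> * (?w t *\<^sub>R h t)) = (\<lambda>t. indicator {0<..<1} t *\<^sub>R ?f t)"
    using B by (auto simp: fun_eq_iff)
  finally have si: "set_integrable lborel {0<..<1} ?f" by (simp add: set_integrable_def)
  then show "?f absolutely_integrable_on {0<..<1}"
    unfolding set_integrable_def by (subst integrable_completion) auto
  have "(\<integral>t. h t \<partial>beta_measure \<beta>) = (\<integral>t. ?w t *\<^sub>R h t \<partial>lborel)"
    unfolding beta_measure_def by (rule integral_density) (use wm wn h in auto)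
  also have "\<dots> = (\<integral>t. (indicator {0<..<1} t *\<^sub>R ?f t) / Beta \<beta> \<beta> \<partial>lborel)"
    by (rule Bochner_Integration.integral_cong) auto
  also have "\<dots> = (LINT t:{0<..<1}|lborel. ?f t) / Beta \<beta> \<beta>"
    unfolding set_lebesgue_integral_def by simp
  also have "(LINT t:{0<..<1}|lborel. ?f t) = integral {0<..<1} ?f"
    by (rule set_borel_integral_eq_integral(2)[OF si])
  finally show "(\<integral>t. h t \<partial>beta_measure \<beta>) = integral {0<..<1} ?f / Beta \<beta> \<beta>" .
qed

text \<open>Substitute \<open>s = \<sigma>(1 - u)/(1 - u\<sigma>)\<close>.\<close>

lemma euler_transformation:
  assumes \<beta>: "\<beta> > 0" and u: "0 \<le> u" "u < 1"
  shows "(\<integral>s. (1 - u * (1 - s)) powr (- a) \<partial>beta_measure \<beta>)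
       = (1 - u) powr (\<beta> - a) * (\<integral>s. (1 - u * s) powr (a - 2 * \<beta>) \<partial>beta_measure \<beta>)"
proof -
  define g where "g s = s * (1 - u) / (1 - u * s)" for s
  define g' where "g' s = (1 - u) / (1 - u * s)\<^sup>2" for s
  define f where "f s = s powr (\<beta> - 1) * (1 - s) powr (\<beta> - 1) * (1 - u * (1 - s)) powr (- a)" for s
  let ?S = "{0<..<1::real}"
  have us: "1 - u \<le> 1 - u * s \<and> 1 - u * s \<le> 1 \<and> 0 < 1 - u * s" if "0 < s" "s < 1" for s
  proof -
    have "u * s \<le> u" "0 \<le> u * s" using u that by (auto simp: mult_left_le)
    then show ?thesis using u by auto
  qed
  have us': "1 - u \<le> 1 - u * (1 - s) \<and> 1 - u * (1 - s) \<le> 1" if "0 < s" "s < 1" for s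
    using us[of "1 - s"] that by auto
  \<comment> \<open>The Moebius map \<open>g\<close> fixes 0 and 1. It turns each of the three bases
    s, 1 - s and 1 - u(1 - s) into one of the quotients with denominator 1 - us, so the transformed
    integrand is again of Euler type.\<close>
  have g1: "1 - g s = (1 - s) / (1 - u * s)" "1 - u * (1 - g s) = (1 - u) / (1 - u * s)" if "0 < s" "s < 1" for s
    using us[OF that] by (auto simp: g_def field_simps)
  have gS: "0 < g s" "g s < 1" if "0 < s" "s < 1" for s
  proof -
    show "0 < g s" using us[OF that] that u by (simp add: g_def)
    have "0 < 1 - g s" unfolding g1[OF that] using us[OF that] that by simp
    then show "g s < 1" by simp
  qed
  have inv: "g s * (1 / (1 - u + u * g s)) = s" if "0 < s" "s < 1" for s
  proof -
    have "1 - u + u * g s = (1 - u) / (1 - u * s)" using g1(2)[OF that] by (simp add: algebra_simps)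
    then show ?thesis using us[OF that] u by (simp add: g_def)
  qed
  have inj: "inj_on g ?S"
    by (rule inj_on_inverseI[where g = "\<lambda>z. z * (1 / (1 - u + u * z))"]) (use inv in auto)
  have surj: "g ` ?S = ?S"
  proof (intro equalityI subsetI)
    fix z assume "z \<in> g ` ?S" then show "z \<in> ?S" using gS by auto
  next
    fix z :: real assume z: "z \<in> ?S"
    define s where "s = z / (1 - u + u * z)"
    have d: "1 - u + u * z > 0" using u z by (intro add_pos_nonneg) auto
    have "0 < s" using z d by (simp add: s_def)
    moreover have "s < 1"
    proof -
      have "z < 1 - u + u * z"
      proof -
        have "0 < (1 - u) * (1 - z)" using u z by simp
        then show ?thesis by (simp add: algebra_simps)
      qed
      then show ?thesis using d by (simp add: s_def)
    qed
    moreover have "g s = z"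
    proof -
      have e: "1 - u * s = (1 - u) / (1 - u + u * z)" using d by (simp add: s_def field_simps)
      show ?thesis unfolding g_def e using u d by (simp add: s_def)
    qed
    ultimately show "z \<in> g ` ?S" by force
  qed
  have der: "(g has_field_derivative g' s) (at s within ?S)" if "s \<in> ?S" for s
  proof -
    have "1 - u * s \<noteq> 0" using us[of s] that by auto
    then show ?thesis
      unfolding g_def[abs_def] g'_def
      by (auto intro!: derivative_eq_intros simp: power2_eq_square field_simps)
  qed
  have hb: "\<bar>(1 - u * (1 - s)) powr (- a)\<bar> \<le> max ((1 - u) powr (- a)) (1 powr (- a))" if "0 < s" "s < 1" for s
    using powr_le_max[of "1 - u" "1 - u * (1 - s)" 1 "- a"] us'[OF that] u by simp
  have hb2: "\<bar>(1 - u * s) powr (a - 2 * \<beta>)\<bar> \<le> max ((1 - u) powr (a - 2 * \<beta>)) (1 powr (a - 2 * \<beta>))" if "0 < s" "s < 1" for s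
    using powr_le_max[of "1 - u" "1 - u * s" 1 "a - 2 * \<beta>"] us[OF that] u by simp
  have m: "(\<lambda>s. (1 - u * (1 - s)) powr (- a)) \<in> borel_measurable borel"
    "(\<lambda>s. (1 - u * s) powr (a - 2 * \<beta>)) \<in> borel_measurable borel" by measurable
  note A = beta_measure_eq_integral[OF \<beta> m(1) hb]
  note A2 = beta_measure_eq_integral[OF \<beta> m(2) hb2]
  have "f absolutely_integrable_on g ` ?S \<and> integral (g ` ?S) f = integral ?S f"
    using A(1) unfolding surj f_def[abs_def] by simp
  then have "integral ?S (\<lambda>s. \<bar>g' s\<bar> * f (g s)) = integral ?S f"
    using has_absolute_integral_change_of_variables_1'[OF _ der inj, of f "integral ?S f"] by simp
  moreover have "integral ?S (\<lambda>s. \<bar>g' s\<bar> * f (g s)) = integral ?S (\<lambda>s. (1 - u) powr (\<beta> - a) *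
      (s powr (\<beta> - 1) * (1 - s) powr (\<beta> - 1) * (1 - u * s) powr (a - 2 * \<beta>)))"
  proof (rule integral_cong)
    fix s assume "s \<in> ?S"
    then have s: "0 < s" "s < 1" by auto
    define D where "D = 1 - u * s"
    have D: "D > 0" using us[OF s] by (simp add: D_def)
    have U: "1 - u > 0" using u by simp
    have "\<bar>g' s\<bar> = (1 - u) powr 1 * D powr (- 2)"
      using U D by (simp add: g'_def D_def[symmetric] powr_minus powr_numeral divide_inverse)
    moreover have "f (g s) = s powr (\<beta> - 1) * (1 - u) powr (\<beta> - 1) * D powr (1 - \<beta>)
       * ((1 - s) powr (\<beta> - 1) * D powr (1 - \<beta>)) * ((1 - u) powr (- a) * D powr a)"
    proof -
      have q: "(x / D) powr b = x powr b * D powr (- b)" if "x \<ge> 0" for x b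
        unfolding powr_minus using powr_divide[of x D b] that D by (simp add: divide_inverse)
      have "g s = s * (1 - u) / D" by (simp add: g_def D_def)
      then show ?thesis
        unfolding f_def unfolding g1(2)[OF s] unfolding g1(1)[OF s] D_def[symmetric] using q[of "s * (1 - u)" "\<beta> - 1"] q[of "1 - s" "\<beta> - 1"] q[of "1 - u" "- a"] s U
        by (simp add: powr_mult)
    qed
    ultimately have "\<bar>g' s\<bar> * f (g s) = ((1 - u) powr 1 * (1 - u) powr (\<beta> - 1) * (1 - u) powr (- a)) *
       (s powr (\<beta> - 1) * (1 - s) powr (\<beta> - 1) * (D powr (- 2) * D powr (1 - \<beta>) * D powr (1 - \<beta>) * D powr a))"
      by (simp only: mult_ac)
    also have "(1 - u) powr 1 * (1 - u) powr (\<beta> - 1) * (1 - u) powr (- a) = (1 - u) powr (\<beta> - a)"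
      by (simp only: powr_add[symmetric]) simp
    also have "D powr (- 2) * D powr (1 - \<beta>) * D powr (1 - \<beta>) * D powr a = D powr (a - 2 * \<beta>)"
      by (simp only: powr_add[symmetric]) simp
    finally show "\<bar>g' s\<bar> * f (g s) = (1 - u) powr (\<beta> - a) *
      (s powr (\<beta> - 1) * (1 - s) powr (\<beta> - 1) * (1 - u * s) powr (a - 2 * \<beta>))"
      by (simp add: D_def)
  qed
  ultimately have "integral ?S f = (1 - u) powr (\<beta> - a) *
      integral ?S (\<lambda>s. s powr (\<beta> - 1) * (1 - s) powr (\<beta> - 1) * (1 - u * s) powr (a - 2 * \<beta>))"
    by simp
  moreover have "(\<integral>s. (1 - u * (1 - s)) powr (- a) \<partial>beta_measure \<beta>) = integral ?S f / Beta \<beta> \<beta>"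
    using A(2) by (simp add: f_def[abs_def])
  ultimately show ?thesis using A2(2) by simp
qed

section \<open>An integrand regular at the corner\<close>

text \<open>For |u| < 1 this is \<open>2F1(1 - 2\<beta>, \<beta>; 2\<beta>; u)\<close>; for \<beta>
  > 1/2 it stays bounded and continuous up to u = 1.\<close>

definition theta :: "real \<Rightarrow> real \<Rightarrow> real" where
  "theta \<beta> u = (\<integral>s. (1 - u * s) powr (2 * \<beta> - 1) \<partial>beta_measure \<beta>)"

text \<open>Here D is the base \<open>1 - x(1 - sw)\<close> at s = 1, and u is chosen so that this
  base equals \<open>D (1 - u(1 - s))\<close>; then \<open>1 - u = (1 - x) / D\<close>. Euler's
  transformation with exponent \<open>a = 4\<beta> - 1\<close> yields
  \<open>(1 - u)^(1 - 3\<beta>)\<close>, whose part in 1 - x cancels the prefactor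
  \<open>(1 - x)^(3\<beta> - 1)\<close> exactly.\<close>

lemma inner_integral_theta:
  assumes \<beta>: "\<beta> > 0" and x: "0 \<le> x" "x < 1" and w: "0 \<le> w"
  shows "inner_integral \<beta> x w = (1 - x * (1 - w)) powr (- \<beta>) * theta \<beta> (x * w / (1 - x * (1 - w)))"
proof -
  define D where "D = 1 - x * (1 - w)"
  define u where "u = x * w / D"
  have D: "D \<ge> 1 - x" using x w by (simp add: D_def algebra_simps)
  then have D0: "D > 0" using x by simp
  have u0: "0 \<le> u" using x w D0 by (simp add: u_def)
  have u1: "1 - u = (1 - x) / D" using D0 by (simp add: u_def D_def field_simps)
  have "u < 1"
  proof -
    have "0 < 1 - u" unfolding u1 using x D0 by simp
    then show ?thesis by simp
  qed
  have us: "1 - u * (1 - s) \<ge> 0" if "0 < s" "s < 1" for s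
  proof -
    have "u * (1 - s) \<le> 1 * 1" using u0 \<open>u < 1\<close> that by (intro mult_mono) auto
    then show ?thesis by simp
  qed
  have "inner_integral \<beta> x w = (\<integral>s. (D powr (1 - 4 * \<beta>) * (1 - x) powr (3 * \<beta> - 1)) * (1 - u * (1 - s)) powr (- (4 * \<beta> - 1)) \<partial>beta_measure \<beta>)"
    unfolding inner_integral_def
  proof (rule beta_measure_integral_cong)
    fix s :: real assume s: "0 < s" "s < 1"
    have "D * (1 - u * (1 - s)) = 1 - x * (1 - s * w)"
    proof -
      have "D * u = x * w" using D0 by (simp add: u_def)
      then have "D * (1 - u * (1 - s)) = D - x * w * (1 - s)" by (metis mult.assoc mult.right_neutral right_diff_distrib)
      then show ?thesis by (simp add: D_def algebra_simps)
    qed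
    then have "(1 - x * (1 - s * w)) powr (1 - 4 * \<beta>) = D powr (1 - 4 * \<beta>) * (1 - u * (1 - s)) powr (1 - 4 * \<beta>)"
      using D0 us[OF s] by (metis less_imp_le powr_mult)
    then show "(1 - x * (1 - s * w)) powr (1 - 4 * \<beta>) * (1 - x) powr (3 * \<beta> - 1)
        = D powr (1 - 4 * \<beta>) * (1 - x) powr (3 * \<beta> - 1) * (1 - u * (1 - s)) powr (- (4 * \<beta> - 1))"
      by (simp add: mult_ac)
  qed measurable
  also have "\<dots> = (D powr (1 - 4 * \<beta>) * (1 - x) powr (3 * \<beta> - 1)) *
      ((1 - u) powr (\<beta> - (4 * \<beta> - 1)) * (\<integral>s. (1 - u * s) powr (4 * \<beta> - 1 - 2 * \<beta>) \<partial>beta_measure \<beta>))"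
    by (simp only: integral_mult_right_zero euler_transformation[OF \<beta> u0 \<open>u < 1\<close>])
  also have "(\<integral>s. (1 - u * s) powr (4 * \<beta> - 1 - 2 * \<beta>) \<partial>beta_measure \<beta>) = theta \<beta> u"
    by (simp add: theta_def)
  also have "(1 - u) powr (\<beta> - (4 * \<beta> - 1)) = (1 - x) powr (1 - 3 * \<beta>) * D powr (3 * \<beta> - 1)"
  proof -
    have "((1 - x) / D) powr (1 - 3 * \<beta>) = (1 - x) powr (1 - 3 * \<beta>) / D powr (1 - 3 * \<beta>)"
      by (rule powr_divide)
    then show ?thesis unfolding u1 using powr_minus[of D "3 * \<beta> - 1"] by (simp add: divide_inverse)
  qed
  also have "(D powr (1 - 4 * \<beta>) * (1 - x) powr (3 * \<beta> - 1)) * ((1 - x) powr (1 - 3 * \<beta>) * D powr (3 * \<beta> - 1) * theta \<beta> u)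
      = (D powr (1 - 4 * \<beta>) * D powr (3 * \<beta> - 1)) * ((1 - x) powr (3 * \<beta> - 1) * (1 - x) powr (1 - 3 * \<beta>)) * theta \<beta> u"
    by (simp only: mult_ac)
  also have "(1 - x) powr (3 * \<beta> - 1) * (1 - x) powr (1 - 3 * \<beta>) = 1"
    using x by (simp flip: powr_add)
  also have "D powr (1 - 4 * \<beta>) * D powr (3 * \<beta> - 1) = D powr (- \<beta>)"
    by (simp flip: powr_add)
  finally show ?thesis by (simp add: D_def u_def)
qed

lemma theta_bounds:
  assumes \<beta>: "\<beta> > 1 / 2" and u: "0 \<le> u" "u \<le> 1"
  shows "\<bar>theta \<beta> u\<bar> \<le> 1"
  unfolding theta_def
proof (rule beta_measure_integral_abs_le)
  fix s :: real assume s: "0 < s" "s < 1"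
  have "u * s \<le> 1" "0 \<le> u * s" using u s by (auto intro: mult_le_one)
  then show "\<bar>(1 - u * s) powr (2 * \<beta> - 1)\<bar> \<le> 1" using \<beta> by (simp add: powr_le1)
qed (use \<beta> in auto)

lemma theta_continuous:
  assumes \<beta>: "\<beta> > 1 / 2"
  shows "continuous_on {0..1} (theta \<beta>)"
proof (rule continuous_on_sequentiallyI)
  fix v u assume v: "\<forall>n. v n \<in> {0..1::real}" and u: "u \<in> {0..1}" and l: "v \<longlonglongrightarrow> u"
  show "(\<lambda>n. theta \<beta> (v n)) \<longlonglongrightarrow> theta \<beta> u"
    unfolding theta_def
  proof (rule integral_dominated_convergence[where w = "\<lambda>_. 1"])
    show "integrable (beta_measure \<beta>) (\<lambda>_. 1 :: real)"
      using \<beta> by (intro beta_measure_integrable_bounded[of _ _ 1]) auto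
    show "AE s in beta_measure \<beta>. (\<lambda>n. (1 - v n * s) powr (2 * \<beta> - 1)) \<longlonglongrightarrow> (1 - u * s) powr (2 * \<beta> - 1)"
    proof (rule AE_beta_measureI)
      fix s :: real assume s: "0 < s" "s < 1"
      have "u * s \<le> s" using u s by (simp add: mult_left_le_one_le)
      then have "1 - u * s \<noteq> 0" using s by linarith
      then show "(\<lambda>n. (1 - v n * s) powr (2 * \<beta> - 1)) \<longlonglongrightarrow> (1 - u * s) powr (2 * \<beta> - 1)"
        using l by (intro tendsto_intros) auto
    qed
    show "AE s in beta_measure \<beta>. norm ((1 - v n * s) powr (2 * \<beta> - 1)) \<le> 1" for n
    proof (rule AE_beta_measureI)
      fix s :: real assume s: "0 < s" "s < 1"
      have "0 \<le> v n" "v n \<le> 1" using v by auto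
      then have "v n * s \<le> 1" "0 \<le> v n * s" using s by (auto intro: mult_le_one)
      then show "norm ((1 - v n * s) powr (2 * \<beta> - 1)) \<le> 1" using \<beta> by (simp add: powr_le1)
    qed
  qed auto
qed

text \<open>The previous formula at \<open>w = 1 - ty\<close>, where
  \<open>1 - x(1 - w) = 1 - txy\<close>. No power of 1 - x is left, so x = 1 is admissible.\<close>

definition F0_integrand :: "real \<Rightarrow> real \<times> real \<Rightarrow> real \<Rightarrow> real" where
  "F0_integrand \<beta> r t = (1 - t * snd r) powr (2 * \<beta> - 1) * (1 - t * (fst r * snd r)) powr (- \<beta>)
     * theta \<beta> (fst r * (1 - t * snd r) / (1 - t * (fst r * snd r)))"

text \<open>The value at (1, 1) is taken from the integral, not from the double series.\<close>

definition F0_ext :: "real \<Rightarrow> real \<times> real \<Rightarrow> real" where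
  "F0_ext \<beta> r = (\<integral>t. F0_integrand \<beta> r t \<partial>beta_measure \<beta>)"

lemma unit_square_aux:
  assumes t: "0 < t" "t < 1" and r: "(x, y) \<in> unit_square"
  shows "1 - t \<le> 1 - t * y" "1 - t * y \<le> 1" "1 - t * y \<le> 1 - t * (x * y)" "0 < 1 - t * y" "0 < 1 - t * (x * y)"
    "0 \<le> x * (1 - t * y) / (1 - t * (x * y))" "x * (1 - t * y) / (1 - t * (x * y)) \<le> 1"
proof -
  have xy: "0 \<le> x" "x \<le> 1" "0 \<le> y" "y \<le> 1" using r by auto
  have "t * y \<le> t" using t xy by (simp add: mult_left_le)
  then show 1: "1 - t \<le> 1 - t * y" by simp
  show "1 - t * y \<le> 1" using t xy by simp
  show 2: "0 < 1 - t * y" using 1 t by linarith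
  have "x * y \<le> y" using xy by (simp add: mult_left_le_one_le)
  then show 3: "1 - t * y \<le> 1 - t * (x * y)" using t by simp
  show 4: "0 < 1 - t * (x * y)" using 2 3 by simp
  show "0 \<le> x * (1 - t * y) / (1 - t * (x * y))" using 2 4 xy by simp
  have "x * (1 - t * y) \<le> 1 - t * (x * y)" using xy by (simp add: algebra_simps)
  then show "x * (1 - t * y) / (1 - t * (x * y)) \<le> 1" using 4 by simp
qed

text \<open>Since xy is at most y, the base \<open>1 - txy\<close> may be replaced by
  \<open>1 - ty\<close> under the negative exponent \<open>-\<beta>\<close>. This leaves
  \<open>(1 - ty)^(\<beta> - 1)\<close> with base in [1 - t, 1], whose largest value depends on the
  sign of \<open>\<beta> - 1\<close>; the sum of the two candidates covers both cases.\<close>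

lemma F0_integrand_bound:
  assumes \<beta>: "\<beta> > 1 / 2" and t: "0 < t" "t < 1" and r: "r \<in> unit_square"
  shows "\<bar>F0_integrand \<beta> r t\<bar> \<le> 1 + (1 - t) powr (\<beta> - 1)"
proof -
  obtain x y where xy: "r = (x, y)" by fastforce
  note aux = unit_square_aux[OF t r[unfolded xy]]
  have "\<bar>F0_integrand \<beta> r t\<bar> \<le> (1 - t * y) powr (2 * \<beta> - 1) * (1 - t * y) powr (- \<beta>) * 1"
    unfolding F0_integrand_def xy fst_conv snd_conv abs_mult
    using aux \<beta> by (intro mult_mono theta_bounds powr_mono2') (auto intro!: powr_mono2')
  also have "\<dots> = (1 - t * y) powr (\<beta> - 1)" by (simp flip: powr_add)
  also have "\<dots> \<le> max ((1 - t) powr (\<beta> - 1)) (1 powr (\<beta> - 1))"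
    using aux t by (intro powr_le_max) auto
  also have "\<dots> \<le> 1 + (1 - t) powr (\<beta> - 1)" by simp
  finally show ?thesis .
qed

lemma theta_measurable [measurable]:
  assumes "\<beta> > 0" "f \<in> borel_measurable borel"
  shows "(\<lambda>t. theta \<beta> (f t)) \<in> borel_measurable borel"
proof -
  interpret finite_measure "beta_measure \<beta>" by (rule beta_measure_finite[OF assms(1)])
  note [measurable] = assms(2)
  show ?thesis unfolding theta_def by measurable
qed

lemma F0_integrand_measurable:
  assumes "\<beta> > 0" shows "F0_integrand \<beta> r \<in> borel_measurable borel"
  unfolding F0_integrand_def[abs_def] using theta_measurable[OF assms] by measurable

lemma F0_ext_continuous:
  assumes \<beta>: "\<beta> > 1 / 2"
  shows "continuous_on unit_square (F0_ext \<beta>)"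
proof (rule continuous_on_sequentiallyI)
  fix v r assume v: "\<forall>n. v n \<in> unit_square" and r: "r \<in> unit_square" and l: "v \<longlonglongrightarrow> r"
  have \<beta>0: "\<beta> > 0" using \<beta> by simp
  show "(\<lambda>n. F0_ext \<beta> (v n)) \<longlonglongrightarrow> F0_ext \<beta> r"
    unfolding F0_ext_def
  proof (rule integral_dominated_convergence[where w = "\<lambda>t. 1 + (1 - t) powr (\<beta> - 1)"])
    have "integrable (beta_measure \<beta>) (\<lambda>_. 1 :: real)"
      using \<beta>0 by (intro beta_measure_integrable_bounded[of _ _ 1]) auto
    \<comment> \<open>The exponent shifts the second beta parameter to \<open>2\<beta> - 1\<close>;
      its positivity is the condition \<beta> > 1/2.\<close>
    moreover have "integrable (beta_measure \<beta>) (\<lambda>t. (1 - t) powr (\<beta> - 1))"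
      using beta_measure_one_minus_moment[of \<beta> "\<beta> - 1"] \<beta> by (simp add: has_bochner_integral_iff)
    ultimately show "integrable (beta_measure \<beta>) (\<lambda>t. 1 + (1 - t) powr (\<beta> - 1))" by simp
    show "AE t in beta_measure \<beta>. norm (F0_integrand \<beta> (v n) t) \<le> 1 + (1 - t) powr (\<beta> - 1)" for n
      using F0_integrand_bound[OF \<beta>] v by (intro AE_beta_measureI) auto
    show "AE t in beta_measure \<beta>. (\<lambda>n. F0_integrand \<beta> (v n) t) \<longlonglongrightarrow> F0_integrand \<beta> r t"
    proof (rule AE_beta_measureI)
      fix t :: real assume t: "0 < t" "t < 1"
      note aux = unit_square_aux[OF t, of "fst p" "snd p" for p, unfolded prod.collapse]
      let ?u = "\<lambda>r. fst r * (1 - t * snd r) / (1 - t * (fst r * snd r))"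
      have nz: "1 - t * snd r \<noteq> 0" "1 - t * (fst r * snd r) \<noteq> 0" using aux[OF r] by auto
      have "(\<lambda>n. ?u (v n)) \<longlonglongrightarrow> ?u r"
        using l nz by (intro tendsto_intros) auto
      then have "(\<lambda>n. theta \<beta> (?u (v n))) \<longlonglongrightarrow> theta \<beta> (?u r)"
        using aux[OF r] aux v by (intro continuous_on_tendsto_compose[OF theta_continuous[OF \<beta>]]) auto
      then show "(\<lambda>n. F0_integrand \<beta> (v n) t) \<longlonglongrightarrow> F0_integrand \<beta> r t"
        unfolding F0_integrand_def using l nz by (intro tendsto_mult tendsto_powr tendsto_intros) auto
    qed
  qed (use F0_integrand_measurable[OF \<beta>0] in auto)
qed

lemma F0_ext_eq:
  assumes \<beta>: "\<beta> > 0" and x: "0 \<le> x" "x < 1" and y: "0 \<le> y" "y < 1"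
  shows "F0_ext \<beta> (x, y) = F0 \<beta> (x, y)"
proof -
  have "F0_ext \<beta> (x, y) = (\<integral>t. (1 - t * y) powr (2 * \<beta> - 1) * inner_integral \<beta> x (1 - t * y) \<partial>beta_measure \<beta>)"
    unfolding F0_ext_def
  proof (rule beta_measure_integral_cong[OF F0_integrand_measurable[OF \<beta>]])
    show "(\<lambda>t. (1 - t * y) powr (2 * \<beta> - 1) * inner_integral \<beta> x (1 - t * y)) \<in> borel_measurable borel"
      using inner_integral_measurable[OF \<beta>] by measurable
    fix t :: real assume t: "0 < t" "t < 1"
    have w: "0 \<le> 1 - t * y" using unit_square_aux(4)[OF t, of x y] x y by simp
    have e: "1 - x * (1 - (1 - t * y)) = 1 - t * (x * y)" by simp
    show "F0_integrand \<beta> (x, y) t = (1 - t * y) powr (2 * \<beta> - 1) * inner_integral \<beta> x (1 - t * y)"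
      unfolding inner_integral_theta[OF \<beta> x w] e by (simp add: F0_integrand_def)
  qed
  then show ?thesis using F0_integral[OF \<beta>, of x y] x y by simp
qed

text \<open>On the edges the identity follows by continuity of both sides, so no integral has to be
  evaluated there.\<close>

lemma F0_ext_eq_closed:
  assumes \<beta>: "\<beta> > 1 / 2" and r: "r \<in> unit_square - {(1, 1)}"
  shows "F0_ext \<beta> r = F0 \<beta> r"
proof -
  \<comment> \<open>Points on the segment from the origin to \<open>r\<close>. Both coordinates are
    below 1 even when \<open>r\<close> lies on an edge, so the interior identity applies to each of
    them.\<close>
  define v where "v n = (1 - inverse (real (Suc n))) *\<^sub>R r" for n
  have l: "v \<longlonglongrightarrow> r"
    unfolding v_def[abs_def]
    using tendsto_scaleR[OF tendsto_diff[OF tendsto_const LIMSEQ_inverse_real_of_nat] tendsto_const, of 1 r] by simp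
  have c: "0 \<le> 1 - inverse (real (Suc n))" "1 - inverse (real (Suc n)) < 1" for n
    by (auto simp: inverse_eq_divide)
  have b: "0 \<le> (1 - inverse (real (Suc n))) * z" "(1 - inverse (real (Suc n))) * z < 1" if "0 \<le> z" "z \<le> 1" for n z
  proof -
    show "0 \<le> (1 - inverse (real (Suc n))) * z" using c that by (intro mult_nonneg_nonneg) auto
    have "(1 - inverse (real (Suc n))) * z \<le> 1 - inverse (real (Suc n))" using c that by (intro mult_left_le) auto
    also have "\<dots> < 1" by (rule c)
    finally show "(1 - inverse (real (Suc n))) * z < 1" .
  qed
  have f: "fst (v n) = (1 - inverse (real (Suc n))) * fst r" "snd (v n) = (1 - inverse (real (Suc n))) * snd r" for n
    by (simp_all add: v_def)
  have vb: "0 \<le> fst (v n)" "fst (v n) < 1" "0 \<le> snd (v n)" "snd (v n) < 1" for n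
    unfolding f using r by (auto intro!: b simp del: of_nat_Suc)
  have v: "v n \<in> unit_square - {(1, 1)}" for n
    using vb[of n] by (cases "v n") auto
  have "(\<lambda>n. F0_ext \<beta> (v n)) \<longlonglongrightarrow> F0_ext \<beta> r"
    using v r by (intro continuous_on_tendsto_compose[OF F0_ext_continuous[OF \<beta>] l]) auto
  moreover have "(\<lambda>n. F0 \<beta> (v n)) \<longlonglongrightarrow> F0 \<beta> r"
    using v r \<beta> by (intro continuous_on_tendsto_compose[OF F0_continuous_closed l]) auto
  moreover have "F0_ext \<beta> (v n) = F0 \<beta> (v n)" for n
    using F0_ext_eq[OF _ vb(1-2)[of n] vb(3-4)[of n], of \<beta>] \<beta> by simp
  ultimately show ?thesis by (simp add: LIMSEQ_unique)
qed

text \<open>At (1, 1) the argument of \<open>theta\<close> is 1 for every t, so the integral is a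
  product of two moments, of \<open>(1 - t)^(\<beta> - 1)\<close> and of
  \<open>(1 - s)^(2\<beta> - 1)\<close>. The factor \<open>Gamma (3\<beta> - 1)\<close> cancels
  between them.\<close>

lemma F0_ext_corner:
  assumes \<beta>: "\<beta> > 1 / 2"
  shows "F0_ext \<beta> (1, 1) = (Gamma (2 * \<beta>))\<^sup>2 * Gamma (2 * \<beta> - 1) / ((Gamma \<beta>)\<^sup>2 * Gamma (4 * \<beta> - 1))"
proof -
  have \<beta>0: "\<beta> > 0" using \<beta> by simp
  have "F0_ext \<beta> (1, 1) = (\<integral>t. (1 - t) powr (\<beta> - 1) * theta \<beta> 1 \<partial>beta_measure \<beta>)"
    unfolding F0_ext_def
  proof (rule beta_measure_integral_cong[OF F0_integrand_measurable[OF \<beta>0]])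
    fix t :: real assume t: "0 < t" "t < 1"
    have "(1 - t) powr (2 * \<beta> - 1) * (1 - t) powr (- \<beta>) = (1 - t) powr (\<beta> - 1)"
      by (simp flip: powr_add)
    then show "F0_integrand \<beta> (1, 1) t = (1 - t) powr (\<beta> - 1) * theta \<beta> 1"
      using t by (simp add: F0_integrand_def)
  qed measurable
  also have "\<dots> = (\<integral>t. (1 - t) powr (\<beta> - 1) \<partial>beta_measure \<beta>) * theta \<beta> 1" by simp
  also have "(\<integral>t. (1 - t) powr (\<beta> - 1) \<partial>beta_measure \<beta>) = Beta \<beta> (\<beta> + (\<beta> - 1)) / Beta \<beta> \<beta>"
    using beta_measure_one_minus_moment[of \<beta> "\<beta> - 1"] \<beta> by (simp add: has_bochner_integral_iff)
  also have "theta \<beta> 1 = Beta \<beta> (\<beta> + (2 * \<beta> - 1)) / Beta \<beta> \<beta>"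
    using beta_measure_one_minus_moment[of \<beta> "2 * \<beta> - 1"] \<beta> by (simp add: theta_def has_bochner_integral_iff)
  also have "Beta \<beta> (\<beta> + (\<beta> - 1)) / Beta \<beta> \<beta> * (Beta \<beta> (\<beta> + (2 * \<beta> - 1)) / Beta \<beta> \<beta>)
      = (Gamma (2 * \<beta>))\<^sup>2 * Gamma (2 * \<beta> - 1) / ((Gamma \<beta>)\<^sup>2 * Gamma (4 * \<beta> - 1))"
  proof -
    have e: "\<beta> + (\<beta> - 1) = 2 * \<beta> - 1" "\<beta> + (2 * \<beta> - 1) = 3 * \<beta> - 1" "\<beta> + (3 * \<beta> - 1) = 4 * \<beta> - 1" "\<beta> + \<beta> = 2 * \<beta>"
      by auto
    have "Gamma \<beta> > 0" "Gamma (2 * \<beta>) > 0" "Gamma (3 * \<beta> - 1) > 0" "Gamma (4 * \<beta> - 1) > 0"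
      using \<beta> by (auto intro!: Gamma_real_pos)
    then show ?thesis
      unfolding Beta_def e by (simp add: field_simps power2_eq_square)
  qed
  finally show ?thesis .
qed

theorem proposition4p2:
  fixes \<beta> :: real
  assumes "\<beta> > 0"
  shows "series2_conv_loc_unif_on (A0 \<beta>) open_square
    \<and> series2_conv_loc_unif_on (B0 \<beta>) open_square
    \<and> real_analytic2_on (F0 \<beta>) open_square
    \<and> real_analytic2_on (G0 \<beta>) open_square
    \<and> (\<forall>(r1, r2)\<in>open_square. F0 \<beta> (r1, r2) = F0 \<beta> (r2, r1))
    \<and> (\<forall>(r1, r2)\<in>open_square. G0 \<beta> (r1, r2) = G0 \<beta> (r2, r1))
    \<and> (\<forall>(r1, r2)\<in>open_square.
         r1 * (1 - r1) * partial1 (partial1 (F0 \<beta>)) (r1, r2)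
         + (2 * \<beta> - 2 * r1) * partial1 (F0 \<beta>) (r1, r2)
         - \<beta> * (1 - \<beta>) * F0 \<beta> (r1, r2) = (1 - r2) * G0 \<beta> (r1, r2))
    \<and> (\<forall>(r1, r2)\<in>open_square.
         r2 * (1 - r2) * partial2 (partial2 (F0 \<beta>)) (r1, r2)
         + (2 * \<beta> - 2 * r2) * partial2 (F0 \<beta>) (r1, r2)
         - \<beta> * (1 - \<beta>) * F0 \<beta> (r1, r2) = (1 - r1) * G0 \<beta> (r1, r2))
    \<and> (\<forall>(r1, r2)\<in>open_square.
         \<beta> * r1 * partial1 (F0 \<beta>) (r1, r2) + \<beta> * r2 * partial2 (F0 \<beta>) (r1, r2)
         + \<beta>\<^sup>2 * F0 \<beta> (r1, r2) = - (1 - r1 * r2) * G0 \<beta> (r1, r2))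
    \<and> (\<forall>r\<in>open_square. F0 \<beta> r > 0)
    \<and> (\<forall>(r1, r2)\<in>open_square.
         F0 \<beta> (r1, r2) = horn_G2 \<beta> \<beta> (1 - 2 * \<beta>) (1 - 2 * \<beta>) (- r1) (- r2))
    \<and> (\<beta> > 1 / 3 \<longrightarrow>
         (\<forall>n1. summable (\<lambda>n2. \<bar>A0 \<beta> n1 n2\<bar>)
            \<and> (\<Sum>n2. A0 \<beta> n1 n2) =
                Gamma (2 * \<beta>) * Gamma (3 * \<beta> - 1) / (Gamma \<beta> * Gamma (4 * \<beta> - 1))
                * (pochhammer \<beta> n1 * pochhammer (1 - \<beta>) n1
                   / (pochhammer 1 n1 * pochhammer (2 * \<beta>) n1)))
         \<and> (\<forall>L. 0 < L \<and> L < 1 \<longrightarrow>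
              (\<Sum>n1. \<Sum>n2. ennreal (\<bar>A0 \<beta> n1 n2\<bar> * L ^ n2)) =
                (\<Sum>n1. \<Sum>n2. ennreal (\<bar>A0 \<beta> n1 n2\<bar> * L ^ n1))
              \<and> (\<Sum>n1. \<Sum>n2. ennreal (\<bar>A0 \<beta> n1 n2\<bar> * L ^ n1)) < \<infinity>)
         \<and> (\<forall>r\<in>unit_square - {(1, 1)}. term2 (A0 \<beta>) r summable_on UNIV)
         \<and> continuous_on (unit_square - {(1, 1)}) (F0 \<beta>)
         \<and> (\<forall>r\<in>unit_square - {(1, 1)}. F0 \<beta> r > 0)
         \<and> (\<forall>x\<in>{0..<1}.
              F0 \<beta> (x, 1) = F0 \<beta> (1, x)
              \<and> F0 \<beta> (1, x) =
                  Gamma (2 * \<beta>) * Gamma (3 * \<beta> - 1) / (Gamma \<beta> * Gamma (4 * \<beta> - 1))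
                  * f_hyp \<beta> x))
    \<and> (\<beta> > 1 / 2 \<longrightarrow>
         (\<exists>F. continuous_on unit_square F
            \<and> (\<forall>r\<in>unit_square - {(1, 1)}. F r = F0 \<beta> r)
            \<and> (\<forall>r\<in>unit_square. F r > 0)
            \<and> F (1, 1) =
                (Gamma (2 * \<beta>))\<^sup>2 * Gamma (2 * \<beta> - 1) / ((Gamma \<beta>)\<^sup>2 * Gamma (4 * \<beta> - 1))))"
proof (intro conjI impI)
  show "series2_conv_loc_unif_on (A0 \<beta>) open_square" "series2_conv_loc_unif_on (B0 \<beta>) open_square"
    using assms by (auto intro: prod_dominated_loc_unif prod_dominated_A0 prod_dominated_B0)
  show "real_analytic2_on (F0 \<beta>) open_square" "real_analytic2_on (G0 \<beta>) open_square"
    unfolding F0_def G0_def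
    using assms by (auto intro: prod_dominated_analytic prod_dominated_A0 prod_dominated_B0)
  show "\<forall>(r1, r2)\<in>open_square. F0 \<beta> (r1, r2) = F0 \<beta> (r2, r1)"
    by (intro ballI case_prodI2 F0_commute)
  show "\<forall>(r1, r2)\<in>open_square. G0 \<beta> (r1, r2) = G0 \<beta> (r2, r1)"
    by (intro ballI case_prodI2 G0_commute)
  show "\<forall>(r1, r2)\<in>open_square.
         r1 * (1 - r1) * partial1 (partial1 (F0 \<beta>)) (r1, r2)
         + (2 * \<beta> - 2 * r1) * partial1 (F0 \<beta>) (r1, r2)
         - \<beta> * (1 - \<beta>) * F0 \<beta> (r1, r2) = (1 - r2) * G0 \<beta> (r1, r2)"
    by (intro ballI case_prodI2 F0_pde1[OF assms]) auto
  show "\<forall>(r1, r2)\<in>open_square.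
         r2 * (1 - r2) * partial2 (partial2 (F0 \<beta>)) (r1, r2)
         + (2 * \<beta> - 2 * r2) * partial2 (F0 \<beta>) (r1, r2)
         - \<beta> * (1 - \<beta>) * F0 \<beta> (r1, r2) = (1 - r1) * G0 \<beta> (r1, r2)"
  proof (intro ballI case_prodI2)
    \<comment> \<open>The first equation at the swapped point, carried back by the symmetry of
      \<open>F0\<close> and \<open>G0\<close>.\<close>
    fix r :: "real \<times> real" and r1 r2 assume "r \<in> open_square" "r = (r1, r2)"
    then have "\<bar>r2\<bar> < 1" "\<bar>r1\<bar> < 1" by auto
    from F0_pde1[OF assms this]
    show "r2 * (1 - r2) * partial2 (partial2 (F0 \<beta>)) (r1, r2)
         + (2 * \<beta> - 2 * r2) * partial2 (F0 \<beta>) (r1, r2)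
         - \<beta> * (1 - \<beta>) * F0 \<beta> (r1, r2) = (1 - r1) * G0 \<beta> (r1, r2)"
      unfolding partial2_F0 partial2_partial2_F0 F0_commute[of \<beta> r2 r1] G0_commute[of \<beta> r2 r1] .
  qed
  show "\<forall>(r1, r2)\<in>open_square.
         \<beta> * r1 * partial1 (F0 \<beta>) (r1, r2) + \<beta> * r2 * partial2 (F0 \<beta>) (r1, r2)
         + \<beta>\<^sup>2 * F0 \<beta> (r1, r2) = - (1 - r1 * r2) * G0 \<beta> (r1, r2)"
    by (intro ballI case_prodI2 F0_euler[OF assms]) auto
  show "\<forall>r\<in>open_square. F0 \<beta> r > 0"
    using F0_pos[OF assms] by auto
  show "\<forall>(r1, r2)\<in>open_square.
         F0 \<beta> (r1, r2) = horn_G2 \<beta> \<beta> (1 - 2 * \<beta>) (1 - 2 * \<beta>) (- r1) (- r2)"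
    by (intro ballI case_prodI2 F0_eq_horn[OF assms])
  {
    assume \<beta>: "\<beta> > 1 / 3"
    show "\<forall>n1. summable (\<lambda>n2. \<bar>A0 \<beta> n1 n2\<bar>)
            \<and> (\<Sum>n2. A0 \<beta> n1 n2) =
                Gamma (2 * \<beta>) * Gamma (3 * \<beta> - 1) / (Gamma \<beta> * Gamma (4 * \<beta> - 1))
                * (pochhammer \<beta> n1 * pochhammer (1 - \<beta>) n1
                   / (pochhammer 1 n1 * pochhammer (2 * \<beta>) n1))"
      using A0_row_abs_summable[OF \<beta>] sums_unique[OF A0_row_sum_1[OF \<beta>]] by (simp add: row_const_def)
    show "\<forall>L. 0 < L \<and> L < 1 \<longrightarrow>
              (\<Sum>n1. \<Sum>n2. ennreal (\<bar>A0 \<beta> n1 n2\<bar> * L ^ n2)) =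
                (\<Sum>n1. \<Sum>n2. ennreal (\<bar>A0 \<beta> n1 n2\<bar> * L ^ n1))
              \<and> (\<Sum>n1. \<Sum>n2. ennreal (\<bar>A0 \<beta> n1 n2\<bar> * L ^ n1)) < \<infinity>"
      using A0_weighted_sum_swap A0_weighted_sum_finite[OF \<beta>] by blast
    show "\<forall>r\<in>unit_square - {(1, 1)}. term2 (A0 \<beta>) r summable_on UNIV"
    proof
      fix r :: "real \<times> real" assume r: "r \<in> unit_square - {(1, 1)}"
      obtain x y where xy: "r = (x, y)" by fastforce
      have "\<bar>x\<bar> \<le> 1 \<and> \<bar>y\<bar> < 1 \<or> \<bar>y\<bar> \<le> 1 \<and> \<bar>x\<bar> < 1" using r by (auto simp: xy)
      then show "term2 (A0 \<beta>) r summable_on UNIV"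
        unfolding xy using A0_summable_closed[OF \<beta>] by blast
    qed
    show "continuous_on (unit_square - {(1, 1)}) (F0 \<beta>)"
      by (rule F0_continuous_closed[OF \<beta>])
    show "\<forall>r\<in>unit_square - {(1, 1)}. F0 \<beta> r > 0"
      using F0_pos_closed[OF \<beta>] by blast
    show "\<forall>x\<in>{0..<1}. F0 \<beta> (x, 1) = F0 \<beta> (1, x)
              \<and> F0 \<beta> (1, x) =
                  Gamma (2 * \<beta>) * Gamma (3 * \<beta> - 1) / (Gamma \<beta> * Gamma (4 * \<beta> - 1))
                  * f_hyp \<beta> x"
      using F0_boundary[OF \<beta>] by (auto simp: F0_commute[of \<beta> 1] row_const_def)
  }
  assume \<beta>: "\<beta> > 1 / 2"
  have "F0_ext \<beta> r > 0" if "r \<in> unit_square" for r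
  proof (cases "r = (1, 1)")
    case True
    \<comment> \<open>At the corner positivity is read off the closed form; elsewhere it comes from
      the positivity of \<open>F0\<close>.\<close>
    have "Gamma (2 * \<beta>) > 0" "Gamma (2 * \<beta> - 1) > 0" "Gamma \<beta> > 0" "Gamma (4 * \<beta> - 1) > 0"
      using \<beta> by (auto intro!: Gamma_real_pos)
    then show ?thesis unfolding True F0_ext_corner[OF \<beta>] by simp
  next
    case False
    then show ?thesis using F0_ext_eq_closed[OF \<beta>, of r] F0_pos_closed[of \<beta> r] \<beta> that by simp
  qed
  then show "\<exists>F. continuous_on unit_square F
            \<and> (\<forall>r\<in>unit_square - {(1, 1)}. F r = F0 \<beta> r)
            \<and> (\<forall>r\<in>unit_square. F r > 0)
            \<and> F (1, 1) =
                (Gamma (2 * \<beta>))\<^sup>2 * Gamma (2 * \<beta> - 1) / ((Gamma \<beta>)\<^sup>2 * Gamma (4 * \<beta> - 1))"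
    using F0_ext_continuous[OF \<beta>] F0_ext_eq_closed[OF \<beta>] F0_ext_corner[OF \<beta>]
    by (intro exI[of _ "F0_ext \<beta>"]) auto
qed

end
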